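(* Let $n\ge 1$ and let $V=\{v_1,\dots,v_n\}\subseteq\Lambda^{\mathrm{in}}$ be a good set, with $v_i\ne v_j$ for all $i\neq j$, and let $k_v\in\mathbb N$ ($k_v\geq 1$) for all $v\in V$. The $n$-th joint cumulant of the fields $\big(X_v^{(k_v)}Y_v\big)_{v\in V}$ is given by $$\kappa\big(X_v^{(k_v)}Y_v:\ v\in V\big)=(-1)^{\sum_{v\in V}k_v}\sum_{\substack{\mathcal E\subseteq E(V):\\ |\mathcal E_v|\ge k_v\ \forall v\in V}}K(\mathcal E)\sum_{\tau\in S_{\mathrm{co}}(\mathcal E)}\operatorname{sign}(\tau)\prod_{f\in\mathcal E}M\big(f,\tau(f)\big),$$ where $\mathcal E_v=\{f\in\mathcal E: f^-=v\}$ and $$K(\mathcal E)=\prod_{v\in V}K(\mathcal E_v),\qquad K(\mathcal E_v)=(-1)^{|\mathcal E_v|}\binom{|\mathcal E_v|}{k_v}.$$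
   Context: **Graph.** Let $\mathbf L$ be a connected, locally finite simple graph (for example a lattice), and let $\Lambda$ be a finite nonempty proper subset of its vertex set; $\Lambda^{\mathrm{in}}$ is the set of $u\in\Lambda$ having no neighbour in $\mathbf L\setminus\Lambda$. $E$ is the set of edges of $\mathbf L$ with at least one endpoint in $\Lambda$, $E_v$ the set of edges incident to $v$, and $E(V)=\bigcup_{v\in V}E_v$. A set $V\subseteq\Lambda$ is *good* if no two of its elements are nearest neighbours in $\mathbf L$. For a good set $V$ every edge of $E(V)$ has exactly one endpoint in $V$; edges $f\in E(V)$ are oriented as $f=(f^-,f^+)$ with tail $f^-\in V$. **Laplacian, Green's function, transfer-current matrix.** $\Delta_\Lambda$ is the $\Lambda\times\Lambda$ matrix with $\Delta_\Lambda(u,u)=-|\{w\in\mathbf L: w\sim u\}|$, $\Delta_\Lambda(u,v)=1$ if $u\sim v$, and $0$ otherwise. The Green's function with Dirichlet boundary conditions is $G_\Lambda=(-\Delta_\Lambda)^{-1}$, extended by $0$ when an argument is outside $\Lambda$. For $f,g\in E(V)$, $$M(f,g)=G_\Lambda(f^+,g^+)-G_\Lambda(f^+,g^-)-G_\Lambda(f^-,g^+)+G_\Lambda(f^-,g^-).$$ **Fermions.** $\Omega^{2\Lambda}$ is the real Grassmann algebra with generators $\psi_v,\bar\psi_v$ ($v\in\Lambda$), all of which anticommute with each other. For a generator $\xi$, $\partial_\xi$ is the left derivative: the linear map with $\partial_\xi(\xi P)=P$ and $\partial_\xi P=0$ for every $P$ not involving $\xi$. The normalized fermionic Gaussian free field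 state is $$\langle P\rangle=\frac{1}{\det(-\Delta_\Lambda)}\Big(\prod_{v\in\Lambda}\partial_{\bar\psi_v}\partial_{\psi_v}\Big)\exp\Big(\sum_{u,v\in\Lambda}\psi_u(-\Delta_\Lambda)(u,v)\bar\psi_v\Big)P,\qquad P\in\Omega^{2\Lambda}.$$ Put $\psi_v=\bar\psi_v=0$ for $v\notin\Lambda$, and $\zeta(e)=(\psi_{e^+}-\psi_{e^-})(\bar\psi_{e^+}-\bar\psi_{e^-})$ for $e\in E$ (these elements commute and are independent of the orientation). Define $$X_v^{(k)}=\sum_{\mathcal E\subseteq E_v:\,|\mathcal E|=k}\ \prod_{e\in\mathcal E}\zeta(e),\qquad Y_v=\prod_{e\in E_v}\big(1-\zeta(e)\big).$$ **Cumulants.** For commuting elements $Z_v\in\Omega^{2\Lambda}$, $v\in V$, the joint cumulant with respect to $\langle\cdot\rangle$ is $$\kappa(Z_v: v\in V)=\sum_{\pi\in\Pi(V)}(|\pi|-1)!\,(-1)^{|\pi|-1}\prod_{B\in\pi}\Big\langle\prod_{v\in B}Z_v\Big\rangle,$$ where $\Pi(V)$ is the set of partitions of $V$. **Connected permutations.** Let $A\subseteq E(V)$ with $A\cap E_v\ne\emptyset$ for all $v\in V$, and let $\tau$ be a permutation of $A$. The multigraph $V_\tau$ has vertex set $V$ and, for $v\ne w$ in $V$, one edge between $v$ and $w$ for each pair $f\in A\cap E_v$, $f'\in A\cap E_w$ with $\tau(f)=f'$ or $\tau(f')=f$ (no loops). If $|V|\ge2$, $\tau$ is *connected* if $V_\tau$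 is connected; if $|V|=1$ every permutation is considered connected. $S_{\mathrm{co}}(A)$ is the set of connected permutations of $A$. *)

theory Defs
  imports
    Complex_Main
    "HOL-Library.Disjoint_Sets"
    "HOL-Library.Groups_Big_Fun"
    "HOL-Combinatorics.Permutations"
begin

section \<open>The real Grassmann algebra\<close>

text \<open>
  An element is the family of its coefficients with respect to the monomials
  indexed by finite sets of generators.  The monomial of a finite set is the product of
  its elements in increasing order, for an arbitrary but fixed linear order on the
  generators.
\<close>

typedef 'i grassmann = "{f :: 'i set \<Rightarrow> real. finite {A. f A \<noteq> 0} \<and> (\<forall>A. f A \<noteq> 0 \<longrightarrow> finite A)}"
  morphisms gcoeff Abs_grassmann
  by (rule exI[of _ "\<lambda>_. 0"]) auto

setup_lifting type_definition_grassmann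

definition gorder :: "'i rel" where
  "gorder = (SOME r. Well_order r \<and> Field r = UNIV)"

text \<open>\<open>gsgn A B\<close> is the sign of the shuffle that sorts the monomial of \<open>A\<close> followed by that of \<open>B\<close>.\<close>

definition gsgn :: "'i set \<Rightarrow> 'i set \<Rightarrow> real" where
  "gsgn A B = (-1) ^ card {(a, b). a \<in> A \<and> b \<in> B \<and> (b, a) \<in> gorder}"

lemma gorder_total: "a \<noteq> b \<Longrightarrow> (a, b) \<in> gorder \<longleftrightarrow> (b, a) \<notin> gorder"
proof -
  assume ne: "a \<noteq> b"
  have W: "Well_order (gorder :: 'a rel) \<and> Field (gorder :: 'a rel) = UNIV"
    unfolding gorder_def by (rule someI_ex) (rule well_ordering)
  then have "antisym (gorder :: 'a rel)" "total_on UNIV (gorder :: 'a rel)"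
    by (auto simp: order_on_defs)
  with ne show ?thesis by (meson UNIV_I antisymD total_on_def)
qed

lemma gsgn_sq [simp]: "gsgn A B * gsgn A B = 1"
  by (simp add: gsgn_def flip: power_add mult_2)

lemma gsgn_sq' [simp]: "gsgn A B * (gsgn A B * x) = x"
  by (simp flip: mult.assoc)

lemma gsgn_empty [simp]: "gsgn {} B = 1" "gsgn A {} = 1"
  by (simp_all add: gsgn_def)

lemma gsgn_finite: "finite A \<Longrightarrow> finite B \<Longrightarrow> finite {(a, b). a \<in> A \<and> b \<in> B \<and> (b, a) \<in> gorder}"
  by (rule finite_subset[of _ "A \<times> B"]) auto

lemma gsgn_Un_left:
  assumes "finite A" "finite B" "finite C" "A \<inter> B = {}"
  shows "gsgn (A \<union> B) C = gsgn A C * gsgn B C"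
proof -
  have "{(a, b). a \<in> A \<union> B \<and> b \<in> C \<and> (b, a) \<in> gorder} =
     {(a, b). a \<in> A \<and> b \<in> C \<and> (b, a) \<in> gorder} \<union> {(a, b). a \<in> B \<and> b \<in> C \<and> (b, a) \<in> gorder}"
    by auto
  moreover have "card \<dots> = card {(a, b). a \<in> A \<and> b \<in> C \<and> (b, a) \<in> gorder} +
      card {(a, b). a \<in> B \<and> b \<in> C \<and> (b, a) \<in> gorder}"
    using assms by (intro card_Un_disjoint gsgn_finite) auto
  ultimately show ?thesis by (simp add: gsgn_def power_add)
qed

lemma gsgn_Un_right:
  assumes "finite A" "finite B" "finite C" "B \<inter> C = {}"
  shows "gsgn A (B \<union> C) = gsgn A B * gsgn A C"
proof -
  have "{(a, b). a \<in> A \<and> b \<in> B \<union> C \<and> (b, a) \<in> gorder} =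
     {(a, b). a \<in> A \<and> b \<in> B \<and> (b, a) \<in> gorder} \<union> {(a, b). a \<in> A \<and> b \<in> C \<and> (b, a) \<in> gorder}"
    by auto
  moreover have "card \<dots> = card {(a, b). a \<in> A \<and> b \<in> B \<and> (b, a) \<in> gorder} +
      card {(a, b). a \<in> A \<and> b \<in> C \<and> (b, a) \<in> gorder}"
    using assms by (intro card_Un_disjoint gsgn_finite) auto
  ultimately show ?thesis by (simp add: gsgn_def power_add)
qed

lemma gsgn_swap: "i \<noteq> j \<Longrightarrow> gsgn {i} {j} = - gsgn {j} {i}"
proof -
  assume "i \<noteq> j"
  moreover have "{(a, b). a \<in> {x} \<and> b \<in> {y} \<and> (b, a) \<in> gorder} =
      (if (y, x) \<in> gorder then {(x, y)} else {})" for x y :: 'a by auto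
  ultimately show ?thesis by (simp add: gsgn_def gorder_total[of i j])
qed

instantiation grassmann :: (type) real_vector
begin
lift_definition zero_grassmann :: "'a grassmann" is "\<lambda>_. 0" by simp
lift_definition plus_grassmann :: "'a grassmann \<Rightarrow> 'a grassmann \<Rightarrow> 'a grassmann"
  is "\<lambda>f g A. f A + g A"
proof -
  fix f g :: "'a set \<Rightarrow> real"
  assume a: "finite {A. f A \<noteq> 0} \<and> (\<forall>A. f A \<noteq> 0 \<longrightarrow> finite A)"
    "finite {A. g A \<noteq> 0} \<and> (\<forall>A. g A \<noteq> 0 \<longrightarrow> finite A)"
  have "finite {A. f A + g A \<noteq> 0}"
    by (rule finite_subset[of _ "{A. f A \<noteq> 0} \<union> {A. g A \<noteq> 0}"]) (use a in auto)
  moreover have "finite A" if "f A + g A \<noteq> 0" for A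
    using a that by (cases "f A = 0") auto
  ultimately show "finite {A. f A + g A \<noteq> 0} \<and> (\<forall>A. f A + g A \<noteq> 0 \<longrightarrow> finite A)"
    by blast
qed
lift_definition minus_grassmann :: "'a grassmann \<Rightarrow> 'a grassmann \<Rightarrow> 'a grassmann"
  is "\<lambda>f g A. f A - g A"
proof -
  fix f g :: "'a set \<Rightarrow> real"
  assume a: "finite {A. f A \<noteq> 0} \<and> (\<forall>A. f A \<noteq> 0 \<longrightarrow> finite A)"
    "finite {A. g A \<noteq> 0} \<and> (\<forall>A. g A \<noteq> 0 \<longrightarrow> finite A)"
  have "finite {A. f A - g A \<noteq> 0}"
    by (rule finite_subset[of _ "{A. f A \<noteq> 0} \<union> {A. g A \<noteq> 0}"]) (use a in auto)
  moreover have "finite A" if "f A - g A \<noteq> 0" for A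
    using a that by (cases "f A = 0") auto
  ultimately show "finite {A. f A - g A \<noteq> 0} \<and> (\<forall>A. f A - g A \<noteq> 0 \<longrightarrow> finite A)"
    by blast
qed
lift_definition uminus_grassmann :: "'a grassmann \<Rightarrow> 'a grassmann" is "\<lambda>f A. - f A" by simp
lift_definition scaleR_grassmann :: "real \<Rightarrow> 'a grassmann \<Rightarrow> 'a grassmann" is "\<lambda>c f A. c * f A"
  by (auto elim: rev_finite_subset)
instance
  by standard (transfer; simp add: fun_eq_iff algebra_simps)+
end

instantiation grassmann :: (type) real_algebra_1
begin
lift_definition one_grassmann :: "'a grassmann" is "\<lambda>A. if A = {} then 1 else 0" by auto
lift_definition times_grassmann :: "'a grassmann \<Rightarrow> 'a grassmann \<Rightarrow> 'a grassmann"
  is "\<lambda>f g C. \<Sum>A\<in>Pow C. gsgn A (C - A) * f A * g (C - A)"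
proof -
  fix f g :: "'a set \<Rightarrow> real"
  assume a: "finite {A. f A \<noteq> 0} \<and> (\<forall>A. f A \<noteq> 0 \<longrightarrow> finite A)"
    "finite {A. g A \<noteq> 0} \<and> (\<forall>A. g A \<noteq> 0 \<longrightarrow> finite A)"
  let ?h = "\<lambda>C. \<Sum>A\<in>Pow C. gsgn A (C - A) * f A * g (C - A)"
  have *: "\<exists>A. A \<subseteq> C \<and> f A \<noteq> 0 \<and> g (C - A) \<noteq> 0" if "?h C \<noteq> 0" for C
  proof -
    obtain A where "A \<in> Pow C" "gsgn A (C - A) * f A * g (C - A) \<noteq> 0"
      using \<open>?h C \<noteq> 0\<close> by (rule sum.not_neutral_contains_not_neutral)
    then show ?thesis by auto
  qed
  have "finite {C. ?h C \<noteq> 0}"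
  proof (rule finite_subset)
    show "{C. ?h C \<noteq> 0} \<subseteq> (\<lambda>(A, B). A \<union> B) ` ({A. f A \<noteq> 0} \<times> {A. g A \<noteq> 0})"
    proof
      fix C assume "C \<in> {C. ?h C \<noteq> 0}"
      then obtain A where A: "A \<subseteq> C" "f A \<noteq> 0" "g (C - A) \<noteq> 0" using * by auto
      then show "C \<in> (\<lambda>(A, B). A \<union> B) ` ({A. f A \<noteq> 0} \<times> {A. g A \<noteq> 0})"
        by (intro image_eqI[of _ _ "(A, C - A)"]) auto
    qed
  qed (use a in auto)
  moreover have "finite C" if "?h C \<noteq> 0" for C
    by (rule ccontr) (use that in \<open>simp add: finite_Pow_iff\<close>)
  ultimately show "finite {C. ?h C \<noteq> 0} \<and> (\<forall>C. ?h C \<noteq> 0 \<longrightarrow> finite C)" by blast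
qed
instance
proof
  fix x y z :: "'a grassmann" and c :: real
  show "x * y * z = x * (y * z)"
  proof (transfer, rule ext)
    fix f g h :: "'a set \<Rightarrow> real" and C :: "'a set"
    let ?L = "\<Sum>D\<in>Pow C. gsgn D (C - D) * (\<Sum>A\<in>Pow D. gsgn A (D - A) * f A * g (D - A)) * h (C - D)"
    let ?R = "\<Sum>A\<in>Pow C. gsgn A (C - A) * f A * (\<Sum>B\<in>Pow (C - A). gsgn B (C - A - B) * g B * h (C - A - B))"
    show "?L = ?R"
    proof (cases "finite C")
      case True
      have "?L = (\<Sum>D\<in>Pow C. \<Sum>A\<in>Pow D. gsgn D (C - D) * (gsgn A (D - A) * f A * g (D - A)) * h (C - D))"
        by (simp add: sum_distrib_left sum_distrib_right)
      also have "\<dots> = (\<Sum>(D, A)\<in>(SIGMA D:Pow C. Pow D). gsgn D (C - D) * (gsgn A (D - A) * f A * g (D - A)) * h (C - D))"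
        using True by (subst sum.Sigma) (auto intro: finite_subset)
      also have "\<dots> = (\<Sum>(A, B)\<in>(SIGMA A:Pow C. Pow (C - A)). gsgn A (C - A) * f A * (gsgn B (C - A - B) * g B * h (C - A - B)))"
      proof (rule sum.reindex_bij_witness[of _ "\<lambda>(A, B). (A \<union> B, A)" "\<lambda>(D, A). (A, D - A)"], goal_cases)
        case (5 p)
        obtain D A where p: "p = (D, A)" by force
        with 5 have sub: "A \<subseteq> D" "D \<subseteq> C" by auto
        then have fin: "finite A" "finite D" "finite (D - A)" "finite (C - D)" using True
          by (auto intro: finite_subset)
        have e: "C - A = (D - A) \<union> (C - D)" "D = A \<union> (D - A)" "C - A - (D - A) = C - D"
          using sub by auto
        have "gsgn D (C - D) = gsgn A (C - D) * gsgn (D - A) (C - D)"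
          by (subst e(2), rule gsgn_Un_left) (use fin in auto)
        moreover have "gsgn A (C - A) = gsgn A (D - A) * gsgn A (C - D)"
          by (subst e(1), rule gsgn_Un_right) (use fin in auto)
        ultimately show ?case unfolding p by (simp add: e(3))
      qed auto
      also have "\<dots> = ?R"
        using True by (subst sum.Sigma[symmetric]) (auto simp: sum_distrib_left)
      finally show ?thesis .
    qed (simp add: finite_Pow_iff)
  qed
  show "1 * x = x"
  proof (transfer, rule ext)
    fix f :: "'a set \<Rightarrow> real" and C
    assume a: "finite {A. f A \<noteq> 0} \<and> (\<forall>A. f A \<noteq> 0 \<longrightarrow> finite A)"
    show "(\<Sum>A\<in>Pow C. gsgn A (C - A) * (if A = {} then 1 else 0) * f (C - A)) = f C"
    proof (cases "finite C")
      case True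
      then have "(\<Sum>A\<in>Pow C. gsgn A (C - A) * (if A = {} then 1 else 0) * f (C - A)) =
          (\<Sum>A\<in>{{}}. gsgn A (C - A) * (if A = {} then 1 else 0) * f (C - A))"
        by (intro sum.mono_neutral_right) auto
      then show ?thesis by simp
    qed (use a in \<open>auto simp: finite_Pow_iff\<close>)
  qed
  show "x * 1 = x"
  proof (transfer, rule ext)
    fix f :: "'a set \<Rightarrow> real" and C
    assume a: "finite {A. f A \<noteq> 0} \<and> (\<forall>A. f A \<noteq> 0 \<longrightarrow> finite A)"
    show "(\<Sum>A\<in>Pow C. gsgn A (C - A) * f A * (if C - A = {} then 1 else 0)) = f C"
    proof (cases "finite C")
      case True
      then have "(\<Sum>A\<in>Pow C. gsgn A (C - A) * f A * (if C - A = {} then 1 else 0)) =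
          (\<Sum>A\<in>{C}. gsgn A (C - A) * f A * (if C - A = {} then 1 else 0))"
        by (intro sum.mono_neutral_right) auto
      then show ?thesis by simp
    qed (use a in \<open>auto simp: finite_Pow_iff\<close>)
  qed
  show "(x + y) * z = x * z + y * z" "x * (y + z) = x * y + x * z"
    by (transfer, simp add: fun_eq_iff algebra_simps sum.distrib)+
  show "c *\<^sub>R x * y = c *\<^sub>R (x * y)" "x * c *\<^sub>R y = c *\<^sub>R (x * y)"
    by (transfer, simp add: fun_eq_iff sum_distrib_left mult_ac)+
  show "(0 :: 'a grassmann) \<noteq> 1" by transfer (auto simp: fun_eq_iff)
qed
end

lift_definition gen :: "'i \<Rightarrow> 'i grassmann" is "\<lambda>i A. if A = {i} then 1 else 0" by auto

lemma gcoeff_simps [simp]: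
  "gcoeff 0 A = 0" "gcoeff (x + y) A = gcoeff x A + gcoeff y A"
  "gcoeff (x - y) A = gcoeff x A - gcoeff y A" "gcoeff (- x) A = - gcoeff x A"
  "gcoeff (c *\<^sub>R x) A = c * gcoeff x A"
  by (transfer; simp)+

lemma gcoeff_mult: "gcoeff (x * y) C = (\<Sum>A\<in>Pow C. gsgn A (C - A) * gcoeff x A * gcoeff y (C - A))"
  by transfer simp

lemma gcoeff_infinite: "infinite A \<Longrightarrow> gcoeff x A = 0"
  by transfer auto

lemma grassmann_eqI: "(\<And>A. finite A \<Longrightarrow> gcoeff x A = gcoeff y A) \<Longrightarrow> x = y"
  by (metis gcoeff_infinite gcoeff_inject ext)

lemma gcoeff_gen_mult:
  assumes "finite C"
  shows "gcoeff (gen i * x) C = (if i \<in> C then gsgn {i} (C - {i}) * gcoeff x (C - {i}) else 0)"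
proof -
  have "gcoeff (gen i * x) C = (\<Sum>A\<in>Pow C. if A = {i} then gsgn A (C - A) * gcoeff x (C - A) else 0)"
    unfolding gcoeff_mult by (rule sum.cong) (auto simp: gen.rep_eq)
  also have "\<dots> = (if {i} \<in> Pow C then gsgn {i} (C - {i}) * gcoeff x (C - {i}) else 0)"
    using assms by (subst sum.delta) auto
  finally show ?thesis by simp
qed

lemma gen_anticommute: "gen i * gen j = - (gen j * gen i)"
proof (rule grassmann_eqI)
  fix C :: "'a set" assume "finite C"
  show "gcoeff (gen i * gen j) C = gcoeff (- (gen j * gen i)) C"
  proof (cases "i = j")
    case True
    have "C - {j} \<noteq> {j}" by blast
    with True show ?thesis by (simp add: gcoeff_gen_mult[OF \<open>finite C\<close>] gen.rep_eq)
  next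
    case False
    have "i \<in> C \<and> C - {i} = {j} \<longleftrightarrow> C = {i, j}" "j \<in> C \<and> C - {j} = {i} \<longleftrightarrow> C = {i, j}"
      using False by auto
    then show ?thesis using gsgn_swap[OF False]
      by (auto simp: gcoeff_gen_mult[OF \<open>finite C\<close>] gen.rep_eq)
  qed
qed

section \<open>Left derivatives, Berezin integral, exponential, ordered products\<close>

definition not_involving :: "'i \<Rightarrow> 'i grassmann \<Rightarrow> bool" where
  "not_involving i P \<longleftrightarrow> (\<forall>A. i \<in> A \<longrightarrow> gcoeff P A = 0)"

definition gderiv :: "'i \<Rightarrow> 'i grassmann \<Rightarrow> 'i grassmann" where
  "gderiv i = (THE D. linear D \<and> (\<forall>P. not_involving i P \<longrightarrow> D (gen i * P) = P \<and> D P = 0))"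

lift_definition gderiv_formula :: "'i \<Rightarrow> 'i grassmann \<Rightarrow> 'i grassmann"
  is "\<lambda>i f A. if i \<in> A then 0 else gsgn {i} A * f (insert i A)"
proof -
  fix i :: 'i and f :: "'i set \<Rightarrow> real"
  assume a: "finite {A. f A \<noteq> 0} \<and> (\<forall>A. f A \<noteq> 0 \<longrightarrow> finite A)"
  let ?h = "\<lambda>A. if i \<in> A then 0 else gsgn {i} A * f (insert i A)"
  have "{A. ?h A \<noteq> 0} \<subseteq> (\<lambda>A. A - {i}) ` {A. f A \<noteq> 0}"
  proof
    fix A assume "A \<in> {A. ?h A \<noteq> 0}"
    then have "i \<notin> A" "f (insert i A) \<noteq> 0" by (auto split: if_splits)
    then show "A \<in> (\<lambda>A. A - {i}) ` {A. f A \<noteq> 0}" by (intro image_eqI[of _ _ "insert i A"]) auto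
  qed
  then have "finite {A. ?h A \<noteq> 0}" by (rule finite_subset) (use a in auto)
  moreover have "\<forall>A. ?h A \<noteq> 0 \<longrightarrow> finite A"
    using a by (auto split: if_splits)
  ultimately show "finite {A. ?h A \<noteq> 0} \<and> (\<forall>A. ?h A \<noteq> 0 \<longrightarrow> finite A)" by blast
qed

lemma gderiv_formula_props:
  "linear (gderiv_formula i)"
  "not_involving i P \<Longrightarrow> gderiv_formula i (gen i * P) = P"
  "not_involving i P \<Longrightarrow> gderiv_formula i P = 0"
proof -
  show "linear (gderiv_formula i)"
    by (rule linearI; rule grassmann_eqI) (auto simp: gderiv_formula.rep_eq algebra_simps)
  show "gderiv_formula i (gen i * P) = P" if "not_involving i P"
  proof (rule grassmann_eqI)
    fix A :: "'a set" assume "finite A"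
    with that show "gcoeff (gderiv_formula i (gen i * P)) A = gcoeff P A"
      by (auto simp: gderiv_formula.rep_eq gcoeff_gen_mult not_involving_def)
  qed
  show "gderiv_formula i P = 0" if "not_involving i P"
    by (rule grassmann_eqI) (use that in \<open>auto simp: gderiv_formula.rep_eq not_involving_def\<close>)
qed

lift_definition gdrop :: "'i \<Rightarrow> 'i grassmann \<Rightarrow> 'i grassmann"
  is "\<lambda>i f A. if i \<in> A then 0 else f A"
  by (auto elim: rev_finite_subset)

lemma gderiv_decomp:
  "P = gdrop i P + gen i * gderiv_formula i P"
  "not_involving i (gdrop i P)" "not_involving i (gderiv_formula i P)"
proof -
  show "P = gdrop i P + gen i * gderiv_formula i P"
    by (rule grassmann_eqI)
      (auto simp: gderiv_formula.rep_eq gdrop.rep_eq gcoeff_gen_mult insert_absorb)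
qed (auto simp: not_involving_def gderiv_formula.rep_eq gdrop.rep_eq)

lemma gderiv_eq: "gderiv i = gderiv_formula i"
  unfolding gderiv_def
proof (rule the_equality)
  show "linear (gderiv_formula i) \<and> (\<forall>P. not_involving i P \<longrightarrow>
      gderiv_formula i (gen i * P) = P \<and> gderiv_formula i P = 0)"
    by (simp add: gderiv_formula_props)
next
  fix D :: "'a grassmann \<Rightarrow> 'a grassmann"
  assume D: "linear D \<and> (\<forall>P. not_involving i P \<longrightarrow> D (gen i * P) = P \<and> D P = 0)"
  show "D = gderiv_formula i"
  proof
    fix P
    have "D P = D (gdrop i P) + D (gen i * gderiv_formula i P)"
      using D gderiv_decomp(1)[of P i] by (metis linear_add)
    then show "D P = gderiv_formula i P" using D gderiv_decomp(2,3)[of i P] by simp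
  qed
qed

lemma gcoeff_gderiv: "gcoeff (gderiv i P) A = (if i \<in> A then 0 else gsgn {i} A * gcoeff P (insert i A))"
  by (simp add: gderiv_eq gderiv_formula.rep_eq)

lemma gderiv_anticommute: "gderiv i (gderiv j P) = - gderiv j (gderiv i P)"
proof (rule grassmann_eqI)
  fix A :: "'a set" assume fin: "finite A"
  show "gcoeff (gderiv i (gderiv j P)) A = gcoeff (- gderiv j (gderiv i P)) A"
  proof (cases "i = j \<or> i \<in> A \<or> j \<in> A")
    case False
    then have ij: "i \<noteq> j" "i \<notin> A" "j \<notin> A" by auto
    have "gsgn {j} ({i} \<union> A) = gsgn {j} {i} * gsgn {j} A" "gsgn {i} ({j} \<union> A) = gsgn {i} {j} * gsgn {i} A"
      by (rule gsgn_Un_right; use ij fin in simp)+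
    with ij gsgn_swap[of i j] show ?thesis
      by (simp add: gcoeff_gderiv insert_commute)
  qed (auto simp: gcoeff_gderiv)
qed

lemma gderiv_uminus: "gderiv i (- P) = - gderiv i P"
  by (rule grassmann_eqI) (simp add: gcoeff_gderiv)

text \<open>The exponential series; on elements without constant term it has only finitely many
  nonzero terms (\<open>finite_gpowers\<close>).\<close>

definition gexp :: "'i grassmann \<Rightarrow> 'i grassmann" where
  "gexp P = (\<Sum>j. P ^ j /\<^sub>R fact j)"

lemma gcoeff_power_eq_0:
  assumes "gcoeff P {} = 0" "\<And>A. gcoeff P A \<noteq> 0 \<Longrightarrow> A \<subseteq> S"
  shows "gcoeff (P ^ j) C \<noteq> 0 \<Longrightarrow> C \<subseteq> S \<and> j \<le> card C"
proof (induction j arbitrary: C)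
  case 0
  then show ?case by (auto simp: one_grassmann.rep_eq split: if_splits)
next
  case (Suc j)
  have "finite C" using Suc.prems gcoeff_infinite by blast
  obtain A where A: "A \<in> Pow C" "gsgn A (C - A) * gcoeff P A * gcoeff (P ^ j) (C - A) \<noteq> 0"
    using Suc.prems unfolding power_Suc gcoeff_mult by (rule sum.not_neutral_contains_not_neutral)
  then have "C - A \<subseteq> S" "j \<le> card (C - A)" "A \<subseteq> S" "A \<noteq> {}" using Suc.IH assms by auto
  moreover have "card C = card A + card (C - A)"
    using A \<open>finite C\<close> by (metis PowD card_Diff_subset card_mono finite_subset le_add_diff_inverse)
  moreover have "card A > 0" using A \<open>finite C\<close> \<open>A \<noteq> {}\<close> by (auto simp: card_gt_0_iff intro: finite_subset)
  ultimately show ?case by auto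
qed

lemma finite_gpowers:
  assumes "gcoeff P {} = 0"
  shows "finite {j. P ^ j /\<^sub>R fact j \<noteq> 0}"
proof -
  let ?S = "\<Union>{A. gcoeff P A \<noteq> 0}"
  have "finite {A. gcoeff P A \<noteq> 0}" by transfer auto
  then have fin: "finite ?S" using gcoeff_infinite by blast
  have "P ^ j = 0" if "j > card ?S" for j
  proof (rule grassmann_eqI, rule ccontr)
    fix C assume "gcoeff (P ^ j) C \<noteq> gcoeff 0 C"
    then have "C \<subseteq> ?S" "j \<le> card C" using gcoeff_power_eq_0[OF assms, of ?S j C] by auto
    with that fin card_mono[of ?S C] show False by linarith
  qed
  then have "{j. P ^ j /\<^sub>R fact j \<noteq> 0} \<subseteq> {..card ?S}" by (auto simp: not_le[symmetric])
  then show ?thesis by (rule finite_subset) simp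
qed

text \<open>Product of a finite family of commuting elements of a possibly noncommutative algebra.\<close>

definition cprod :: "('b \<Rightarrow> 'c::monoid_mult) \<Rightarrow> 'b set \<Rightarrow> 'c" where
  "cprod f A = Finite_Set.fold (\<lambda>a P. f a * P) 1 A"

lemma cprod_empty [simp]: "cprod f {} = 1"
  by (simp add: cprod_def)

lemma cprod_insert:
  assumes "finite A" "a \<notin> A" "\<And>x y. x \<in> insert a A \<Longrightarrow> y \<in> insert a A \<Longrightarrow> f x * f y = f y * f x"
  shows "cprod f (insert a A) = f a * cprod f A"
proof -
  interpret comp_fun_commute_on "insert a A" "\<lambda>a P. f a * P"
    by standard (auto simp: fun_eq_iff assms(3) simp flip: mult.assoc)
  show ?thesis using assms(1,2) by (simp add: cprod_def)
qed

section \<open>Graph, Laplacian and Green's function\<close>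

text \<open>A graph is given by its vertex set \<open>L\<close> and its adjacency relation \<open>adj\<close>; edges are
  two-element sets of adjacent vertices.\<close>

definition conn_lf_graph :: "'v set \<Rightarrow> ('v \<Rightarrow> 'v \<Rightarrow> bool) \<Rightarrow> bool" where
  "conn_lf_graph L adj \<longleftrightarrow>
     (\<forall>u v. adj u v \<longrightarrow> u \<in> L \<and> v \<in> L \<and> u \<noteq> v \<and> adj v u) \<and>
     (\<forall>u\<in>L. finite {w. adj u w}) \<and>
     (\<forall>u\<in>L. \<forall>v\<in>L. adj\<^sup>*\<^sup>* u v)"

definition inner_vertices :: "'v set \<Rightarrow> ('v \<Rightarrow> 'v \<Rightarrow> bool) \<Rightarrow> 'v set \<Rightarrow> 'v set" where
  "inner_vertices L adj \<Lambda> = {u \<in> \<Lambda>. \<not> (\<exists>w\<in>L - \<Lambda>. adj u w)}"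

definition good :: "('v \<Rightarrow> 'v \<Rightarrow> bool) \<Rightarrow> 'v set \<Rightarrow> 'v set \<Rightarrow> bool" where
  "good adj \<Lambda> V \<longleftrightarrow> V \<subseteq> \<Lambda> \<and> (\<forall>u\<in>V. \<forall>v\<in>V. \<not> adj u v)"

definition edges_at :: "('v \<Rightarrow> 'v \<Rightarrow> bool) \<Rightarrow> 'v \<Rightarrow> 'v set set" where
  "edges_at adj v = {{v, w} | w. adj v w}"

definition edges_of :: "('v \<Rightarrow> 'v \<Rightarrow> bool) \<Rightarrow> 'v set \<Rightarrow> 'v set set" where
  "edges_of adj V = (\<Union>v\<in>V. edges_at adj v)"

definition tail :: "'v set \<Rightarrow> 'v set \<Rightarrow> 'v" where
  "tail V f = (THE v. v \<in> f \<and> v \<in> V)"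

definition head :: "'v set \<Rightarrow> 'v set \<Rightarrow> 'v" where
  "head V f = (THE w. w \<in> f \<and> w \<notin> V)"

lemma tail_head:
  assumes "v \<in> V" "w \<notin> V"
  shows "tail V {v, w} = v" "head V {v, w} = w"
  using assms by (auto simp: tail_def head_def)

definition laplacian :: "('v \<Rightarrow> 'v \<Rightarrow> bool) \<Rightarrow> 'v \<Rightarrow> 'v \<Rightarrow> real" where
  "laplacian adj u v = (if u = v then - real (card {w. adj u w}) else if adj u v then 1 else 0)"

text \<open>Determinant and inverse of matrices indexed by a finite set; the inverse is
  extended by 0, which makes it unique as a function on the whole type.  For the Dirichlet
  Laplacian of a finite proper subset of a connected graph it exists.\<close>

definition det_on :: "'v set \<Rightarrow> ('v \<Rightarrow> 'v \<Rightarrow> real) \<Rightarrow> real" where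
  "det_on S A = (\<Sum>p | p permutes S. of_int (sign p) * (\<Prod>i\<in>S. A i (p i)))"

definition inverse_on :: "'v set \<Rightarrow> ('v \<Rightarrow> 'v \<Rightarrow> real) \<Rightarrow> 'v \<Rightarrow> 'v \<Rightarrow> real" where
  "inverse_on S A = (THE B.
     (\<forall>u\<in>S. \<forall>v\<in>S. (\<Sum>w\<in>S. A u w * B w v) = (if u = v then 1 else 0) \<and>
                   (\<Sum>w\<in>S. B u w * A w v) = (if u = v then 1 else 0)) \<and>
     (\<forall>u v. u \<notin> S \<or> v \<notin> S \<longrightarrow> B u v = 0))"

definition green :: "('v \<Rightarrow> 'v \<Rightarrow> bool) \<Rightarrow> 'v set \<Rightarrow> 'v \<Rightarrow> 'v \<Rightarrow> real" where
  "green adj \<Lambda> = inverse_on \<Lambda> (\<lambda>u v. - laplacian adj u v)"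

definition transfer_current ::
  "('v \<Rightarrow> 'v \<Rightarrow> bool) \<Rightarrow> 'v set \<Rightarrow> 'v set \<Rightarrow> 'v set \<Rightarrow> 'v set \<Rightarrow> real" where
  "transfer_current adj \<Lambda> V f g =
     green adj \<Lambda> (head V f) (head V g) - green adj \<Lambda> (head V f) (tail V g)
     - green adj \<Lambda> (tail V f) (head V g) + green adj \<Lambda> (tail V f) (tail V g)"

section \<open>The fermionic Gaussian free field\<close>

datatype 'v fermion = Psi 'v | Psibar 'v

definition psi :: "'v set \<Rightarrow> 'v \<Rightarrow> 'v fermion grassmann" where
  "psi \<Lambda> v = (if v \<in> \<Lambda> then gen (Psi v) else 0)"

definition psibar :: "'v set \<Rightarrow> 'v \<Rightarrow> 'v fermion grassmann" where
  "psibar \<Lambda> v = (if v \<in> \<Lambda> then gen (Psibar v) else 0)"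

text \<open>The operators \<open>gderiv (Psibar v) \<circ> gderiv (Psi v)\<close> commute, so the fold does not
  depend on an enumeration of \<open>\<Lambda>\<close>.\<close>

definition berezin :: "'v set \<Rightarrow> 'v fermion grassmann \<Rightarrow> 'v fermion grassmann" where
  "berezin \<Lambda> P = Finite_Set.fold (\<lambda>v Q. gderiv (Psibar v) (gderiv (Psi v) Q)) P \<Lambda>"

lemma berezin_insert:
  assumes "finite \<Lambda>" "v \<notin> \<Lambda>"
  shows "berezin (insert v \<Lambda>) P = gderiv (Psibar v) (gderiv (Psi v) (berezin \<Lambda> P))"
proof -
  interpret comp_fun_commute "\<lambda>(v :: 'a) Q. gderiv (Psibar v) (gderiv (Psi v) Q)"
  proof (standard, rule ext)
    fix v u :: 'a and Q
    let ?a = "gderiv (Psi u)" and ?b = "gderiv (Psibar u)"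
    let ?c = "gderiv (Psi v)" and ?d = "gderiv (Psibar v)"
    have "?b (?a (?d (?c Q))) = - ?b (?d (?a (?c Q)))"
      by (subst gderiv_anticommute[of "Psi u" "Psibar v"]) (rule gderiv_uminus)
    also have "\<dots> = ?d (?b (?a (?c Q)))"
      by (subst gderiv_anticommute[of "Psibar u" "Psibar v"]) (rule minus_minus)
    also have "\<dots> = - ?d (?b (?c (?a Q)))"
      by (subst gderiv_anticommute[of "Psi u" "Psi v"]) (simp only: gderiv_uminus)
    also have "\<dots> = ?d (?c (?b (?a Q)))"
      by (subst gderiv_anticommute[of "Psibar u" "Psi v"]) (simp only: gderiv_uminus minus_minus)
    finally have "?b (?a (?d (?c Q))) = ?d (?c (?b (?a Q)))" .
    then show "((\<lambda>Q. gderiv (Psibar u) (gderiv (Psi u) Q)) \<circ> (\<lambda>Q. gderiv (Psibar v) (gderiv (Psi v) Q))) Q =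
       ((\<lambda>Q. gderiv (Psibar v) (gderiv (Psi v) Q)) \<circ> (\<lambda>Q. gderiv (Psibar u) (gderiv (Psi u) Q))) Q"
      by simp
  qed
  show ?thesis using assms by (simp add: berezin_def)
qed

definition action :: "('v \<Rightarrow> 'v \<Rightarrow> bool) \<Rightarrow> 'v set \<Rightarrow> 'v fermion grassmann" where
  "action adj \<Lambda> = (\<Sum>u\<in>\<Lambda>. \<Sum>v\<in>\<Lambda>. (- laplacian adj u v) *\<^sub>R (psi \<Lambda> u * psibar \<Lambda> v))"

text \<open>For \<open>P\<close> in the subalgebra generated by the fields on \<open>\<Lambda>\<close>, the Berezin integral is a
  scalar multiple of 1, and \<open>gcoeff _ {}\<close> reads off that scalar.\<close>

definition fgff :: "('v \<Rightarrow> 'v \<Rightarrow> bool) \<Rightarrow> 'v set \<Rightarrow> 'v fermion grassmann \<Rightarrow> real" where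
  "fgff adj \<Lambda> P = 1 / det_on \<Lambda> (\<lambda>u v. - laplacian adj u v)
     * gcoeff (berezin \<Lambda> (gexp (action adj \<Lambda>) * P)) {}"

definition zeta_oriented :: "'v set \<Rightarrow> 'v \<times> 'v \<Rightarrow> 'v fermion grassmann" where
  "zeta_oriented \<Lambda> = (\<lambda>(a, b). (psi \<Lambda> b - psi \<Lambda> a) * (psibar \<Lambda> b - psibar \<Lambda> a))"

definition zeta :: "'v set \<Rightarrow> 'v set \<Rightarrow> 'v fermion grassmann" where
  "zeta \<Lambda> e = zeta_oriented \<Lambda> (SOME (a, b). e = {a, b})"

lemma zeta_orientation: "zeta \<Lambda> {a, b} = (psi \<Lambda> b - psi \<Lambda> a) * (psibar \<Lambda> b - psibar \<Lambda> a)"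
proof -
  define p where "p = (SOME (c, d). {a, b} = {c, d})"
  have "case p of (c, d) \<Rightarrow> {a, b} = {c, d}"
    unfolding p_def by (rule someI[of "\<lambda>(c, d). {a, b} = {c, d}" "(a, b)"]) simp
  then have "p = (a, b) \<or> p = (b, a)" by (auto simp: doubleton_eq_iff)
  then show ?thesis unfolding zeta_def p_def[symmetric]
    by (auto simp: zeta_oriented_def algebra_simps)
qed

definition X_field :: "('v \<Rightarrow> 'v \<Rightarrow> bool) \<Rightarrow> 'v set \<Rightarrow> nat \<Rightarrow> 'v \<Rightarrow> 'v fermion grassmann" where
  "X_field adj \<Lambda> k v = (\<Sum>\<E> | \<E> \<subseteq> edges_at adj v \<and> card \<E> = k. cprod (zeta \<Lambda>) \<E>)"

definition Y_field :: "('v \<Rightarrow> 'v \<Rightarrow> bool) \<Rightarrow> 'v set \<Rightarrow> 'v \<Rightarrow> 'v fermion grassmann" where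
  "Y_field adj \<Lambda> v = cprod (\<lambda>e. 1 - zeta \<Lambda> e) (edges_at adj v)"

lemma zeta_commute: "zeta \<Lambda> {a, b} * zeta \<Lambda> {c, d} = zeta \<Lambda> {c, d} * zeta \<Lambda> {a, b}"
proof -
  have swap: "(x * y) * (z * w) = (z * w) * (x * y)"
    if "x * z = - (z * x)" "x * w = - (w * x)" "y * z = - (z * y)" "y * w = - (w * y)"
    for x y z w :: "'a fermion grassmann"
  proof -
    have "(x * y) * (z * w) = x * (y * z) * w" by (simp add: mult.assoc)
    also have "\<dots> = - ((x * z) * (y * w))" by (simp add: that(3) mult.assoc)
    also have "\<dots> = - (z * (x * w) * y)" by (simp add: that(1,4) mult.assoc)
    also have "\<dots> = (z * w) * (x * y)" by (simp add: that(2) mult.assoc)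
    finally show ?thesis .
  qed
  have diff: "(x - x') * (y - y') = - ((y - y') * (x - x'))"
    if "x * y = - (y * x)" "x * y' = - (y' * x)" "x' * y = - (y * x')" "x' * y' = - (y' * x')"
    for x x' y y' :: "'a fermion grassmann"
    using that by (simp add: left_diff_distrib right_diff_distrib)
  have g: "psi \<Lambda> u * psi \<Lambda> v = - (psi \<Lambda> v * psi \<Lambda> u)" "psi \<Lambda> u * psibar \<Lambda> v = - (psibar \<Lambda> v * psi \<Lambda> u)"
    "psibar \<Lambda> u * psi \<Lambda> v = - (psi \<Lambda> v * psibar \<Lambda> u)" "psibar \<Lambda> u * psibar \<Lambda> v = - (psibar \<Lambda> v * psibar \<Lambda> u)" for u v
    unfolding psi_def psibar_def
    using gen_anticommute[of "Psi u" "Psi v"] gen_anticommute[of "Psi u" "Psibar v"]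
      gen_anticommute[of "Psibar u" "Psi v"] gen_anticommute[of "Psibar u" "Psibar v"]
    by (cases "u \<in> \<Lambda>"; cases "v \<in> \<Lambda>"; simp)+
  show ?thesis unfolding zeta_orientation
    by (intro swap diff g)
qed

lemma cprod_commute:
  assumes "\<And>a. a \<in> A \<Longrightarrow> x * f a = f a * x" "\<And>a b. a \<in> A \<Longrightarrow> b \<in> A \<Longrightarrow> f a * f b = f b * f a"
  shows "x * cprod f A = cprod f A * x"
proof (cases "finite A")
  case True
  then show ?thesis using assms
  proof (induction A)
    case (insert a A)
    have IH: "x * cprod f A = cprod f A * x" using insert by simp
    have e: "cprod f (insert a A) = f a * cprod f A"
      by (rule cprod_insert) (use insert in auto)
    have "x * (f a * cprod f A) = f a * (x * cprod f A)"
      using insert.prems(1)[of a] by (simp flip: mult.assoc)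
    then show ?case by (simp add: e IH mult.assoc)
  qed simp
qed (simp add: cprod_def)

lemma fields_commute:
  "(X_field adj \<Lambda> k v * Y_field adj \<Lambda> v) * (X_field adj \<Lambda> l w * Y_field adj \<Lambda> w) =
   (X_field adj \<Lambda> l w * Y_field adj \<Lambda> w) * (X_field adj \<Lambda> k v * Y_field adj \<Lambda> v)"
proof -
  have z: "zeta \<Lambda> e * zeta \<Lambda> f = zeta \<Lambda> f * zeta \<Lambda> e"
    if "e \<in> edges_at adj u" "f \<in> edges_at adj u'" for e f u u'
    using that by (auto simp: edges_at_def zeta_commute)
  have gen: "x * (X_field adj \<Lambda> m u * Y_field adj \<Lambda> u) = (X_field adj \<Lambda> m u * Y_field adj \<Lambda> u) * x"
    if x: "\<And>e. e \<in> edges_at adj u \<Longrightarrow> x * zeta \<Lambda> e = zeta \<Lambda> e * x" for x m u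
  proof -
    have "x * cprod (zeta \<Lambda>) \<E> = cprod (zeta \<Lambda>) \<E> * x" if "\<E> \<subseteq> edges_at adj u" for \<E>
      by (rule cprod_commute) (use that x z in blast)+
    then have X: "x * X_field adj \<Lambda> m u = X_field adj \<Lambda> m u * x"
      by (simp add: X_field_def sum_distrib_left sum_distrib_right)
    have Y: "x * Y_field adj \<Lambda> u = Y_field adj \<Lambda> u * x"
      unfolding Y_field_def
      by (rule cprod_commute) (simp_all add: left_diff_distrib right_diff_distrib x z)
    have "x * (X_field adj \<Lambda> m u * Y_field adj \<Lambda> u) = X_field adj \<Lambda> m u * (x * Y_field adj \<Lambda> u)"
      by (simp add: X flip: mult.assoc)
    then show ?thesis by (simp add: Y mult.assoc)
  qed
  show ?thesis
    by (rule gen, rule gen[symmetric], rule z) 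
qed

section \<open>Joint cumulants and connected permutations\<close>

definition cumulant :: "('g::monoid_mult \<Rightarrow> real) \<Rightarrow> ('v \<Rightarrow> 'g) \<Rightarrow> 'v set \<Rightarrow> real" where
  "cumulant state Z V = (\<Sum>\<pi> | partition_on V \<pi>.
     fact (card \<pi> - 1) * (-1) ^ (card \<pi> - 1) * (\<Prod>B\<in>\<pi>. state (cprod Z B)))"

text \<open>The edges of the multigraph between \<open>v\<close> and \<open>w\<close>, labelled by the pairs
  that give rise to them.\<close>

definition multigraph_edges ::
  "('v \<Rightarrow> 'v \<Rightarrow> bool) \<Rightarrow> 'v set set \<Rightarrow> ('v set \<Rightarrow> 'v set) \<Rightarrow> 'v \<Rightarrow> 'v \<Rightarrow> ('v set \<times> 'v set) set" where
  "multigraph_edges adj A \<tau> v w = (if v = w then {} else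
     {(f, f'). f \<in> A \<inter> edges_at adj v \<and> f' \<in> A \<inter> edges_at adj w \<and> (\<tau> f = f' \<or> \<tau> f' = f)})"

definition connected_perm ::
  "('v \<Rightarrow> 'v \<Rightarrow> bool) \<Rightarrow> 'v set \<Rightarrow> 'v set set \<Rightarrow> ('v set \<Rightarrow> 'v set) \<Rightarrow> bool" where
  "connected_perm adj V A \<tau> \<longleftrightarrow> card V = 1 \<or>
     (\<forall>v\<in>V. \<forall>w\<in>V. (\<lambda>a b. a \<in> V \<and> b \<in> V \<and> multigraph_edges adj A \<tau> a b \<noteq> {})\<^sup>*\<^sup>* v w)"

definition S_co :: "('v \<Rightarrow> 'v \<Rightarrow> bool) \<Rightarrow> 'v set \<Rightarrow> 'v set set \<Rightarrow> ('v set \<Rightarrow> 'v set) set" where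
  "S_co adj V A = {\<tau>. \<tau> permutes A \<and> connected_perm adj V A \<tau>}"

definition edges_with_tail :: "'v set \<Rightarrow> 'v set set \<Rightarrow> 'v \<Rightarrow> 'v set set" where
  "edges_with_tail V \<E> v = {f \<in> \<E>. tail V f = v}"

definition K_single :: "nat \<Rightarrow> 'v set set \<Rightarrow> real" where
  "K_single k \<E> = (-1) ^ card \<E> * real (card \<E> choose k)"

definition K_coeff :: "'v set \<Rightarrow> ('v \<Rightarrow> nat) \<Rightarrow> 'v set set \<Rightarrow> real" where
  "K_coeff V k \<E> = (\<Prod>v\<in>V. K_single (k v) (edges_with_tail V \<E> v))"

end

theory Submission
  imports Defs
begin

text \<open>
  Integration by parts against the Gaussian weight gives the fermionic Wick rule, so the
  expectation of \<open>\<Prod>e\<in>\<E>. \<zeta>(e)\<close> is the determinant of the transfer-current matrix on \<open>\<E>\<close>.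
  Since \<open>\<zeta>(e)\<^sup>2 = 0\<close>, the field at \<open>v\<close> is \<open>(-1)^k\<close> times the sum of
  \<open>K(C) \<Prod>e\<in>C. \<zeta>(e)\<close> over the sets \<open>C\<close> of edges at \<open>v\<close>.  Expanding all determinants, the
  cumulant becomes a sum over pairs of an edge set \<open>\<E>\<close> and a permutation \<open>\<tau>\<close> of it, weighted by the
  sum of \<open>(-1)^(m - 1) (m - 1)!\<close>, with \<open>m\<close> the number of blocks, over the partitions of \<open>V\<close> whose
  blocks are unions of components of the graph of \<open>\<tau>\<close>.  That sum is 1 if the graph is connected
  and 0 otherwise.
\<close>

section \<open>Central elements and linear forms of the Grassmann algebra\<close>

text \<open>Neither minors nor an order on the indices is used. Differentiating a product of pairs
  \<open>x j * y j\<close> gives products of pairs again, with one \<open>y b\<close> replaced;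
  expanding a determinant along a row while replacing a column, instead of deleting it, gives the
  same recursion. So no cofactor signs occur, and one uniqueness lemma,
  \<open>det_on_unique\<close>, serves both the partition function and the Wick rule. The Wick rule
  needs the inverse of the Dirichlet Laplacian, which exists by the maximum principle because
  \<Lambda> is a proper subset of a connected graph. The normalization needs a nonzero determinant;
  the Wick rule itself supplies it, as a factorization of 1. Goodness of \<open>V\<close> makes the
  edge sets at different vertices disjoint. Hence a choice of edges in each block of a partition is
  a single edge set \<E>, and the product of the block determinants is the part of the Leibniz sum
  over \<E> in which \<tau> keeps every block. The cumulant weights are values of the Moebius
  function of the partition lattice, which is why their sum detects connectedness.\<close>

definition central :: "'a::monoid_mult \<Rightarrow> bool" where
  "central x \<longleftrightarrow> (\<forall>y. x * y = y * x)"

lemma centralD: "central x \<Longrightarrow> x * y = y * x"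
  by (simp add: central_def)

lemma central_1 [simp]: "central 1"
  by (simp add: central_def)

lemma central_mult: "central x \<Longrightarrow> central y \<Longrightarrow> central (x * y)"
  unfolding central_def by (metis mult.assoc)

lemma central_add: "central x \<Longrightarrow> central y \<Longrightarrow> central (x + y :: 'a::ring_1)"
  by (simp add: central_def algebra_simps)

lemma central_diff: "central x \<Longrightarrow> central y \<Longrightarrow> central (x - y :: 'a::ring_1)"
  by (simp add: central_def algebra_simps)

lemma central_uminus: "central x \<Longrightarrow> central (- x :: 'a::ring_1)"
  by (simp add: central_def)

text \<open>Products of two linear forms are central. Centrality is a condition on each factor
  alone, whereas \<open>cprod_insert\<close> asks for commutation of all pairs.\<close>

lemma cprod_insert_central:
  assumes "finite A" "a \<notin> A" "\<forall>x\<in>insert a A. central (f x)"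
  shows "cprod f (insert a A) = f a * cprod f A"
  using assms by (intro cprod_insert) (auto simp: central_def)

lemma central_cprod: "(\<And>a. a \<in> A \<Longrightarrow> central (f a)) \<Longrightarrow> central (cprod f A)"
proof (induction A rule: infinite_finite_induct)
  case (infinite A)
  then show ?case by (simp add: cprod_def)
qed (simp_all add: cprod_insert_central central_mult)

lemma cprod_cong_central:
  assumes "\<And>a. a \<in> A \<Longrightarrow> f a = g a" "\<And>a. a \<in> A \<Longrightarrow> central (g a)"
  shows "cprod f A = cprod g A"
  using assms
proof (induction A rule: infinite_finite_induct)
  case (infinite A)
  then show ?case by (simp add: cprod_def)
qed (simp_all add: cprod_insert_central)

lemma cprod_Un_central:
  assumes "finite A" "finite B" "A \<inter> B = {}" "\<And>a. a \<in> A \<union> B \<Longrightarrow> central (f a)"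
  shows "cprod f (A \<union> B) = cprod f A * cprod f B"
  using assms
proof (induction A)
  case (insert a A)
  have "cprod f (insert a A \<union> B) = f a * cprod f (A \<union> B)"
    using insert by (simp add: cprod_insert_central)
  then show ?case using insert by (simp add: cprod_insert_central mult.assoc)
qed simp

text \<open>Used for the Gaussian weight, with \<open>s\<close> the summands of the action, and for
  the field Y, with \<open>s\<close> the negative of \<open>zeta\<close>.\<close>

lemma cprod_one_plus:
  fixes s :: "'b \<Rightarrow> 'a::ring_1"
  assumes "finite U" "\<And>a. a \<in> U \<Longrightarrow> central (s a)"
  shows "cprod (\<lambda>i. 1 + s i) U = (\<Sum>A\<in>Pow U. cprod s A)"
  using assms
proof (induction U)
  case (insert a U)
  have "cprod (\<lambda>i. 1 + s i) (insert a U) = (1 + s a) * (\<Sum>A\<in>Pow U. cprod s A)"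
    using insert by (subst cprod_insert_central) (auto intro: central_add)
  also have "\<dots> = (\<Sum>A\<in>Pow U. cprod s A) + (\<Sum>A\<in>Pow U. cprod s (insert a A))"
  proof -
    have "cprod s (insert a A) = s a * cprod s A" if "A \<in> Pow U" for A
      using that insert by (intro cprod_insert_central) (auto intro: finite_subset)
    then show ?thesis by (simp add: distrib_right sum_distrib_left sum.distrib)
  qed
  also have "(\<Sum>A\<in>Pow U. cprod s (insert a A)) = (\<Sum>A\<in>insert a ` Pow U. cprod s A)"
    using insert.hyps by (subst sum.reindex) (auto simp: inj_on_def)
  also have "(\<Sum>A\<in>Pow U. cprod s A) + \<dots> = (\<Sum>A\<in>Pow (insert a U). cprod s A)"
    unfolding Pow_insert using insert.hyps by (intro sum.union_disjoint[symmetric]) auto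
  finally show ?case .
qed simp

lemma not_involving_gdrop_gderiv:
  "not_involving j P \<Longrightarrow> not_involving j (gdrop i P)"
  "not_involving j P \<Longrightarrow> not_involving j (gderiv i P)"
  by (auto simp: not_involving_def gdrop.rep_eq gcoeff_gderiv)

text \<open>An element has finite support and so involves finitely many generators. Each generator
  \<open>i\<close> is removed by writing \<open>P = gdrop i P + gen i * gderiv i P\<close>, where
  both parts are free of \<open>i\<close>.\<close>

lemma grassmann_induct [case_names one scaleR add gen]:
  fixes Q :: "'i grassmann \<Rightarrow> bool"
  assumes one: "Q 1"
    and scaleR: "\<And>c P. Q P \<Longrightarrow> Q (c *\<^sub>R P)"
    and add: "\<And>P R. Q P \<Longrightarrow> Q R \<Longrightarrow> Q (P + R)"
    and gen: "\<And>i P. Q P \<Longrightarrow> Q (gen i * P)"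
  shows "Q P"
proof -
  have "Q P" if "finite I" "\<And>i. i \<notin> I \<Longrightarrow> not_involving i P" for I and P :: "'i grassmann"
    using that
  proof (induction I arbitrary: P)
    case empty
    have "P = gcoeff P {} *\<^sub>R 1"
    proof (rule grassmann_eqI)
      fix A :: "'i set"
      show "gcoeff P A = gcoeff (gcoeff P {} *\<^sub>R 1) A"
        using empty by (cases "A = {}") (auto simp: one_grassmann.rep_eq not_involving_def)
    qed
    then show ?case using scaleR[OF one] by metis
  next
    case (insert i I)
    have d: "P = gdrop i P + gen i * gderiv i P" "not_involving i (gdrop i P)"
        "not_involving i (gderiv i P)"
      using gderiv_decomp(1)[of P i] gderiv_decomp(2,3)[of i P] by (simp_all add: gderiv_eq)
    have "not_involving j (gdrop i P) \<and> not_involving j (gderiv i P)" if "j \<notin> I" for j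
      using d(2,3) insert.prems[of j] that not_involving_gdrop_gderiv[of j P i] by (cases "j = i") auto
    then have "Q (gdrop i P)" "Q (gderiv i P)" using insert.IH by blast+
    then show ?case using d(1) add gen by metis
  qed
  moreover have "finite {A. gcoeff P A \<noteq> 0}" by transfer auto
  then have "finite (\<Union>{A. gcoeff P A \<noteq> 0})" using gcoeff_infinite by blast
  moreover have "not_involving i P" if "i \<notin> \<Union>{A. gcoeff P A \<noteq> 0}" for i
    using that by (auto simp: not_involving_def)
  ultimately show ?thesis by blast
qed

lemma linear_gderiv: "linear (gderiv i)"
  by (simp add: gderiv_eq gderiv_formula_props)

lemmas gderiv_linear = linear_add[OF linear_gderiv] linear_diff[OF linear_gderiv]
  linear_scale[OF linear_gderiv] linear_sum[OF linear_gderiv] linear_0[OF linear_gderiv]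

lemma gderiv_1 [simp]: "gderiv i 1 = 0"
  by (rule grassmann_eqI) (auto simp: gcoeff_gderiv one_grassmann.rep_eq)

lemma gderiv_gderiv [simp]: "gderiv i (gderiv i P) = 0"
  by (rule grassmann_eqI) (auto simp: gcoeff_gderiv)

section \<open>Linear forms and Leibniz rules for the left derivative\<close>

abbreviation gforms :: "'i grassmann set" where
  "gforms \<equiv> span (range gen)"

lemma gen_in_gforms [simp]: "gen i \<in> gforms"
  by (simp add: span_base)

lemma gform_anticommute:
  assumes "x \<in> gforms" "y \<in> gforms"
  shows "x * y = - (y * x)"
proof -
  have "gen i * y = - (y * gen i)" for i
    using assms(2)
  proof (induction rule: span_induct_alt)
    case (step c z y)
    then obtain j where j: "z = gen j" by auto
    show ?case unfolding j by (simp add: distrib_left distrib_right step gen_anticommute[of i j])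
  qed simp
  with assms(1) show ?thesis
  proof (induction rule: span_induct_alt)
    case (step c z x)
    then obtain j where "z = gen j" by auto
    with step show ?case by (simp add: distrib_left distrib_right)
  qed simp
qed

lemma gform_square: "x \<in> gforms \<Longrightarrow> x * x = 0"
proof -
  assume "x \<in> gforms"
  then have "2 *\<^sub>R (x * x) = 0" using gform_anticommute[of x x] by (simp add: scaleR_2 eq_neg_iff_add_eq_0)
  then show ?thesis by simp
qed

text \<open>Moving a product of two forms past a generator changes the sign twice.\<close>

lemma central_gform_mult:
  assumes x: "x \<in> gforms" and y: "y \<in> gforms"
  shows "central (x * y)"
  unfolding central_def
proof
  fix P
  show "x * y * P = P * (x * y)"
  proof (induction P rule: grassmann_induct)
    case (gen i P)
    have "x * y * (gen i * P) = x * (y * gen i) * P" by (simp add: mult.assoc)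
    also have "\<dots> = - (x * gen i) * y * P"
      by (simp add: gform_anticommute[OF y gen_in_gforms] mult.assoc)
    also have "\<dots> = gen i * (x * y * P)"
      by (simp add: gform_anticommute[OF x gen_in_gforms] mult.assoc)
    finally have "x * y * (gen i * P) = gen i * (x * y * P)" .
    then show ?case using gen by (simp add: mult.assoc)
  qed (simp_all add: algebra_simps)
qed

text \<open>\<open>P\<close> is split into the part free of \<open>gen i\<close> and the rest. For
  \<open>i = j\<close> the rest is killed because \<open>gen i\<close> squares to 0; for distinct
  indices \<open>gen j\<close> is moved past \<open>gen i\<close>, at the cost of a sign.\<close>

lemma gderiv_gen_mult: "gderiv i (gen j * P) = (if i = j then P else 0) - gen j * gderiv i P"
proof -
  let ?Q = "gdrop i P" and ?R = "gderiv i P"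
  have d: "P = ?Q + gen i * ?R" "not_involving i ?Q" "not_involving i ?R"
    using gderiv_decomp(1)[of P i] gderiv_decomp(2,3)[of i P] by (simp_all add: gderiv_eq)
  have n: "gderiv i (gen i * S) = S" "gderiv i S = 0" if "not_involving i S" for S
    using gderiv_formula_props that by (simp_all add: gderiv_eq)
  show ?thesis
  proof (cases "i = j")
    case True
    have "gen i * P = gen i * ?Q"
      by (subst d(1)) (simp add: distrib_left gform_square flip: mult.assoc)
    then have "gderiv i (gen i * P) = ?Q" using n d by simp
    then show ?thesis using True d(1) by (simp add: algebra_simps)
  next
    case False
    have inv: "not_involving i (gen j * S)" if "not_involving i S" for S
      unfolding not_involving_def
    proof (intro allI impI)
      fix A assume "i \<in> A"
      then show "gcoeff (gen j * S) A = 0"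
        using that False
        by (cases "finite A") (auto simp: gcoeff_gen_mult gcoeff_infinite not_involving_def)
    qed
    have "gen j * P = gen j * ?Q - gen i * (gen j * ?R)"
      by (subst d(1)) (simp add: distrib_left gen_anticommute[of j i] flip: mult.assoc)
    then have "gderiv i (gen j * P) = - (gen j * ?R)"
      using n inv d by (simp add: gderiv_linear)
    then show ?thesis using False by simp
  qed
qed

text \<open>\<open>gcoeff x {i}\<close> is the coefficient of \<open>gen i\<close> in the form
  \<open>x\<close>, that is, its derivative; the rule for generators extends by linearity.\<close>

lemma gderiv_gform_mult:
  assumes "x \<in> gforms"
  shows "gderiv i (x * P) = gcoeff x {i} *\<^sub>R P - x * gderiv i P"
  using assms
proof (induction rule: span_induct_alt)
  case (step c x y)
  then obtain j where "x = gen j" by auto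
  with step show ?case
    by (auto simp: gderiv_linear gderiv_gen_mult gen.rep_eq algebra_simps)
qed (simp add: gderiv_linear)

lemma gderiv_pair_mult:
  assumes "x \<in> gforms" "y \<in> gforms" "gcoeff x {i} = 0"
  shows "gderiv i (x * y * P) = x * y * gderiv i P - gcoeff y {i} *\<^sub>R (x * P)"
  using assms by (simp add: mult.assoc gderiv_gform_mult algebra_simps)

text \<open>Only the second factor of a pair can be hit, and passing \<open>x b\<close> on the way
  costs the sign. The form \<open>x b\<close> is left without a partner; the other pairs are
  central, so their position does not matter.\<close>

lemma gderiv_cprod_pairs:
  assumes "finite S" "\<And>j. j \<in> S \<Longrightarrow> x j \<in> gforms" "\<And>j. j \<in> S \<Longrightarrow> y j \<in> gforms"
    "\<And>j. j \<in> S \<Longrightarrow> gcoeff (x j) {i} = 0"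
  shows "gderiv i (cprod (\<lambda>j. x j * y j) S) =
    - (\<Sum>b\<in>S. gcoeff (y b) {i} *\<^sub>R (x b * cprod (\<lambda>j. x j * y j) (S - {b})))"
  using assms
proof (induction S)
  case (insert a S)
  let ?s = "\<lambda>j. x j * y j"
  have cen: "central (?s j)" if "j \<in> insert a S" for j
    using insert that by (intro central_gform_mult) auto
  have "gderiv i (cprod ?s (insert a S)) = gderiv i (x a * y a * cprod ?s S)"
    using insert cen by (subst cprod_insert_central) auto
  also have "\<dots> = ?s a * gderiv i (cprod ?s S) - gcoeff (y a) {i} *\<^sub>R (x a * cprod ?s S)"
    using insert by (intro gderiv_pair_mult) auto
  also have "?s a * gderiv i (cprod ?s S) =
      - (\<Sum>b\<in>S. gcoeff (y b) {i} *\<^sub>R (x b * cprod ?s (insert a S - {b})))"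
  proof -
    have "?s a * (x b * cprod ?s (S - {b})) = x b * cprod ?s (insert a S - {b})" if "b \<in> S" for b
    proof -
      have "insert a S - {b} = insert a (S - {b})" using that insert by auto
      moreover have "cprod ?s (insert a (S - {b})) = ?s a * cprod ?s (S - {b})"
        using insert cen by (intro cprod_insert_central) auto
      moreover have "?s a * (x b * cprod ?s (S - {b})) = x b * (?s a * cprod ?s (S - {b}))"
        using arg_cong[OF centralD[OF cen[of a], of "x b"], of "\<lambda>z. z * cprod ?s (S - {b})"]
        by (simp only: mult.assoc insertI1 True_implies_equals)
      ultimately show ?thesis by simp
    qed
    then show ?thesis using insert by (simp add: sum_distrib_left)
  qed
  finally show ?case using insert by simp
qed simp

text \<open>The form \<open>z\<close> in front becomes the new partner of the abandoned
  \<open>x b\<close>. The result consists of products of pairs again, so the computation can be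
  iterated; this is the recursion that determinants share.\<close>

lemma gderiv_form_cprod_pairs:
  assumes S: "finite S" and x: "\<And>j. j \<in> S \<Longrightarrow> x j \<in> gforms" and y: "\<And>j. j \<in> S \<Longrightarrow> y j \<in> gforms"
    and x0: "\<And>j. j \<in> S \<Longrightarrow> gcoeff (x j) {i} = 0" and z: "z \<in> gforms"
  shows "gderiv i (z * cprod (\<lambda>j. x j * y j) S) =
    gcoeff z {i} *\<^sub>R cprod (\<lambda>j. x j * y j) S
    - (\<Sum>b\<in>S. gcoeff (y b) {i} *\<^sub>R cprod (\<lambda>j. x j * (y(b := z)) j) S)"
proof -
  have "z * (x b * cprod (\<lambda>j. x j * y j) (S - {b})) = - cprod (\<lambda>j. x j * (y(b := z)) j) S"
    if b: "b \<in> S" for b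
  proof -
    have "cprod (\<lambda>j. x j * (y(b := z)) j) S = cprod (\<lambda>j. x j * (y(b := z)) j) (insert b (S - {b}))"
      using b by (simp add: insert_absorb)
    also have "\<dots> = x b * z * cprod (\<lambda>j. x j * (y(b := z)) j) (S - {b})"
      using b S x y z by (subst cprod_insert_central) (auto intro!: central_gform_mult)
    also have "cprod (\<lambda>j. x j * (y(b := z)) j) (S - {b}) = cprod (\<lambda>j. x j * y j) (S - {b})"
      using x y by (intro cprod_cong_central) (auto intro!: central_gform_mult)
    finally show ?thesis
      using gform_anticommute[OF z x[OF b]] by (simp flip: mult.assoc)
  qed
  then show ?thesis
    using assms by (simp add: gderiv_gform_mult gderiv_cprod_pairs sum_distrib_left sum_negf)
qed

section \<open>Determinants and the Berezin integral\<close>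

lemma det_on_empty [simp]: "det_on {} M = 1"
  by (simp add: det_on_def)

lemma det_on_cong:
  assumes "\<And>i j. i \<in> S \<Longrightarrow> j \<in> S \<Longrightarrow> M i j = N i j"
  shows "det_on S M = det_on S N"
  unfolding det_on_def
  by (intro sum.cong refl arg_cong2[of _ _ _ _ "(*)"] prod.cong assms) (auto simp: permutes_in_image)

text \<open>Every permutation of \<open>insert a S\<close> is \<open>transpose a b \<circ> q\<close>
  with \<open>q\<close> permuting \<open>S\<close>: row \<open>a\<close> takes column
  \<open>b\<close>, and the row that \<open>q\<close> sends to \<open>b\<close> takes column
  \<open>a\<close>. Hence column \<open>b\<close> is replaced by column \<open>a\<close> in the
  determinant over the unchanged index set \<open>S\<close>.\<close>

lemma det_on_insert:
  assumes S: "finite S" "a \<notin> S"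
  shows "det_on (insert a S) M =
    M a a * det_on S M - (\<Sum>b\<in>S. M a b * det_on S (\<lambda>i j. if j = b then M i a else M i j))"
proof -
  let ?f = "\<lambda>p. of_int (sign p) * (\<Prod>i\<in>insert a S. M i (p i)) :: real"
  have "det_on (insert a S) M =
      (\<Sum>b\<in>insert a S. \<Sum>q | q permutes S. ?f (Transposition.transpose a b \<circ> q))"
    unfolding det_on_def by (rule sum_over_permutations_insert) (use S in auto)
  also have "\<dots> = (\<Sum>q | q permutes S. ?f q) +
      (\<Sum>b\<in>S. \<Sum>q | q permutes S. ?f (Transposition.transpose a b \<circ> q))"
    using S by simp
  also have "(\<Sum>q | q permutes S. ?f q) = M a a * det_on S M"
    unfolding det_on_def sum_distrib_left
  proof (rule sum.cong)
    fix q assume "q \<in> {q. q permutes S}"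
    then have "q a = a" using S by (auto simp: permutes_def)
    then show "?f q = M a a * (of_int (sign q) * (\<Prod>i\<in>S. M i (q i)))"
      using S by simp
  qed simp
  also have "(\<Sum>b\<in>S. \<Sum>q | q permutes S. ?f (Transposition.transpose a b \<circ> q)) =
      (\<Sum>b\<in>S. - (M a b * det_on S (\<lambda>i j. if j = b then M i a else M i j)))"
  proof (rule sum.cong)
    fix b assume b: "b \<in> S"
    have "?f (Transposition.transpose a b \<circ> q) =
        - (M a b * (of_int (sign q) * (\<Prod>i\<in>S. if q i = b then M i a else M i (q i))))"
      if "q permutes S" for q
    proof -
      have "a \<noteq> b" "q a = a" using b S that by (auto simp: permutes_def)
      have "sign (Transposition.transpose a b \<circ> q) = - sign q"
        using \<open>a \<noteq> b\<close> permutation_permutes S that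
        by (subst sign_compose) (auto simp: sign_swap_id permutation_swap_id)
      moreover have "(\<Prod>i\<in>S. M i (Transposition.transpose a b (q i))) =
          (\<Prod>i\<in>S. if q i = b then M i a else M i (q i))"
      proof (rule prod.cong)
        fix i assume "i \<in> S"
        then have "q i \<noteq> a" using permutes_in_image[OF that, of i] S by auto
        then show "M i (Transposition.transpose a b (q i)) = (if q i = b then M i a else M i (q i))"
          by (simp add: Transposition.transpose_def)
      qed simp
      ultimately show ?thesis using S \<open>q a = a\<close> by simp
    qed
    then show "(\<Sum>q | q permutes S. ?f (Transposition.transpose a b \<circ> q)) =
        - (M a b * det_on S (\<lambda>i j. if j = b then M i a else M i j))"
      by (simp add: det_on_def sum_distrib_left sum_negf)
  qed simp
  finally show ?thesis by (simp add: sum_negf)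
qed

text \<open>The recursion is the one satisfied by the Berezin integral when a single fermion is contracted with all others.\<close>

lemma det_on_unique:
  fixes W :: "'a set \<Rightarrow> ('a \<Rightarrow> 'b) \<Rightarrow> real"
  assumes empty: "\<And>y. range y \<subseteq> Y \<Longrightarrow> W {} y = w"
    and insert: "\<And>a S y. finite S \<Longrightarrow> a \<notin> S \<Longrightarrow> insert a S \<subseteq> T \<Longrightarrow> range y \<subseteq> Y \<Longrightarrow>
      W (insert a S) y = m a (y a) * W S y - (\<Sum>b\<in>S. m a (y b) * W S (y(b := y a)))"
    and S: "finite S" "S \<subseteq> T" "range y \<subseteq> Y"
  shows "W S y = w * det_on S (\<lambda>i j. m i (y j))"
  using S
proof (induction S arbitrary: y)
  case (insert a S)
  have "W S (y(b := y a)) = w * det_on S (\<lambda>i j. if j = b then m i (y a) else m i (y j))" for b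
    by (subst insert.IH) (use insert.prems in \<open>auto intro!: arg_cong[of _ _ "det_on S"] simp: fun_eq_iff\<close>)
  then show ?case
    using insert by (simp add: assms(2) det_on_insert algebra_simps sum_distrib_left)
qed (simp add: empty)

section \<open>The Berezin integral of products of pairs\<close>

lemma berezin_empty [simp]: "berezin {} P = P"
  by (simp add: berezin_def)

lemma linear_berezin: "linear (berezin S :: 'v fermion grassmann \<Rightarrow> _)"
proof (induction S rule: infinite_finite_induct)
  case (infinite S)
  then show ?case by (auto simp: berezin_def linear_iff)
next
  case empty
  then show ?case by (simp add: linear_iff)
next
  case (insert v S)
  then have "berezin (insert v S) = gderiv (Psibar v) \<circ> (gderiv (Psi v) \<circ> berezin S)"
    by (simp add: fun_eq_iff berezin_insert)
  then show ?case using insert.IH linear_gderiv by (metis linear_compose)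
qed

text \<open>\<open>berezin_insert\<close> places the new pair of derivatives outermost. To integrate
  out \<open>v\<close> before everything else it has to be innermost, which is the same since the
  pairs commute.\<close>

lemma berezin_insert_inner:
  assumes "finite S" "v \<notin> S"
  shows "berezin (insert v S) P = berezin S (gderiv (Psibar v) (gderiv (Psi v) P))"
  using assms
proof (induction S arbitrary: v P)
  case (insert u S)
  let ?D = "\<lambda>v P. gderiv (Psibar v) (gderiv (Psi v) P)"
  have "berezin (insert v (insert u S)) P = ?D u (berezin (insert v S) P)"
    using insert.hyps insert.prems berezin_insert[of "insert v S" u P] by (auto simp: insert_commute)
  also have "\<dots> = ?D u (berezin S (?D v P))" using insert by simp
  also have "\<dots> = berezin (insert u S) (?D v P)"
    using insert.hyps by (rule berezin_insert[symmetric])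
  finally show ?case .
qed (simp add: berezin_insert)

definition gint :: "'v set \<Rightarrow> 'v fermion grassmann \<Rightarrow> real" where
  "gint S P = gcoeff (berezin S P) {}"

lemma linear_gint: "linear (gint S)"
  using linear_berezin[of S] by (simp add: linear_iff gint_def)

lemmas gint_linear = linear_add[OF linear_gint] linear_diff[OF linear_gint] linear_neg[OF linear_gint]
  linear_scale[OF linear_gint] linear_sum[OF linear_gint] linear_0[OF linear_gint]

lemma gint_remove:
  assumes "finite S" "v \<in> S"
  shows "gint S P = gint (S - {v}) (gderiv (Psibar v) (gderiv (Psi v) P))"
  using assms berezin_insert_inner[of "S - {v}" v P] by (simp add: gint_def insert_absorb)

text \<open>The integral already contains \<open>gderiv (Psibar v)\<close>, and applying it twice
  gives 0. This is the source of integration by parts.\<close>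

lemma gint_gderiv_Psibar:
  assumes "finite S" "v \<in> S"
  shows "gint S (gderiv (Psibar v) P) = 0"
  using gint_remove[OF assms, of "gderiv (Psibar v) P"]
  by (simp add: gderiv_anticommute[of "Psi v"] gderiv_uminus gint_linear gderiv_linear)

lemma gint_eq_0:
  assumes "finite S" "v \<in> S" "gderiv (Psi v) P = 0"
  shows "gint S P = 0"
  using gint_remove[OF assms(1,2), of P] assms(3) by (simp add: gint_linear gderiv_linear)

text \<open>The two kinds of fermions are kept apart so that a derivative by one kind sees only one
  factor of each pair.\<close>

definition psi_forms :: "'v fermion grassmann set" where
  "psi_forms = span (range (\<lambda>v. gen (Psi v)))"

definition psibar_forms :: "'v fermion grassmann set" where
  "psibar_forms = span (range (\<lambda>v. gen (Psibar v)))"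

lemma psi_forms_subset: "psi_forms \<subseteq> gforms" "psibar_forms \<subseteq> gforms"
  unfolding psi_forms_def psibar_forms_def by (intro span_mono; auto)+

lemma gen_in_psi_forms [simp]: "gen (Psi v) \<in> psi_forms" "gen (Psibar v) \<in> psibar_forms"
  unfolding psi_forms_def psibar_forms_def by (intro span_base; simp)+

lemma gcoeff_psi_forms:
  "x \<in> psi_forms \<Longrightarrow> gcoeff x {Psibar v} = 0"
  "x \<in> psibar_forms \<Longrightarrow> gcoeff x {Psi v} = 0"
  unfolding psi_forms_def psibar_forms_def
  by (induction rule: span_induct_alt; auto simp: gen.rep_eq)+

lemma gderiv_Psi_cprod:
  assumes S: "finite S" "a \<notin> S" and y: "range y \<subseteq> psibar_forms"
  shows "gderiv (Psi a) (cprod (\<lambda>j. gen (Psi j) * y j) S) = 0"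
proof -
  have Y: "y j \<in> gforms" "y j \<in> psibar_forms" for j using y psi_forms_subset by auto
  \<comment> \<open>\<open>gderiv_cprod_pairs\<close> requires that the derivative misses the first
    factor of every pair, so the pairs are turned round.\<close>
  have "(\<lambda>j. gen (Psi j) * y j) = (\<lambda>j. - y j * gen (Psi j))"
    using gform_anticommute[OF gen_in_gforms Y(1)] by (simp add: fun_eq_iff)
  then have "gderiv (Psi a) (cprod (\<lambda>j. gen (Psi j) * y j) S) =
      gderiv (Psi a) (cprod (\<lambda>j. - y j * gen (Psi j)) S)"
    by (simp only:)
  also have "\<dots> = 0"
    using S Y by (subst gderiv_cprod_pairs)
      (auto simp: span_neg gcoeff_psi_forms gen.rep_eq intro!: sum.neutral)
  finally show ?thesis .
qed

text \<open>The derivative by \<open>Psi a\<close> removes \<open>gen (Psi a)\<close> and leaves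
  \<open>y a\<close> in front; the derivative by \<open>Psibar a\<close> then either hits
  \<open>y a\<close> or puts it in place of another \<open>y b\<close>. These are the two terms of
  \<open>det_on_insert\<close>.\<close>

lemma gint_cprod_pairs:
  assumes S: "finite S" and y: "range y \<subseteq> psibar_forms"
  shows "gint S (cprod (\<lambda>j. gen (Psi j) * y j) S) = det_on S (\<lambda>i j. gcoeff (y j) {Psibar i})"
proof -
  let ?W = "\<lambda>S y. gint S (cprod (\<lambda>j. gen (Psi j) * y j) S)"
  have "?W S y = 1 * det_on S (\<lambda>i j. gcoeff (y j) {Psibar i})"
  proof (rule det_on_unique[where Y = psibar_forms and T = UNIV])
    show "?W {} y = 1" for y :: "'a \<Rightarrow> 'a fermion grassmann"
      by (simp add: gint_def one_grassmann.rep_eq)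
  next
    fix a :: 'a and S and y :: "'a \<Rightarrow> 'a fermion grassmann"
    assume S: "finite S" "a \<notin> S" and y: "range y \<subseteq> psibar_forms"
    then have Y: "y j \<in> gforms" "y j \<in> psibar_forms" for j using psi_forms_subset by auto
    let ?P = "cprod (\<lambda>j. gen (Psi j) * y j) S"
    have c: "central (gen (Psi j) * y j)" for j by (intro central_gform_mult Y) simp
    have 0: "gderiv (Psi a) ?P = 0" using S y by (intro gderiv_Psi_cprod) auto
    have "gderiv (Psi a) (cprod (\<lambda>j. gen (Psi j) * y j) (insert a S)) = y a * ?P"
      using S c Y by (simp add: cprod_insert_central mult.assoc gderiv_gen_mult gderiv_gform_mult 0 gcoeff_psi_forms)
    then have "?W (insert a S) y = gint S (gderiv (Psibar a) (y a * ?P))"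
      using gint_remove[of "insert a S" a] S by simp
    also have "\<dots> = gcoeff (y a) {Psibar a} * ?W S y -
        (\<Sum>b\<in>S. gcoeff (y b) {Psibar a} * ?W S (y(b := y a)))"
      using S Y by (subst gderiv_form_cprod_pairs) (auto simp: gint_linear gen.rep_eq)
    finally show "?W (insert a S) y = gcoeff (y a) {Psibar a} * ?W S y -
        (\<Sum>b\<in>S. gcoeff (y b) {Psibar a} * ?W S (y(b := y a)))" .
  qed (use assms in auto)
  then show ?thesis by simp
qed

section \<open>The exponential of a sum of central nilpotent elements\<close>

lemma gexp_0 [simp]: "gexp 0 = 1"
proof -
  have "gexp (0 :: 'a grassmann) = Sum_any (\<lambda>j. 0 ^ j /\<^sub>R fact j)" by (simp add: gexp_def)
  also have "(\<lambda>j. 0 ^ j /\<^sub>R fact j) = (\<lambda>j. if j = 0 then 1 else 0 :: 'a grassmann)"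
    by (auto simp: fun_eq_iff power_0_left)
  finally show ?thesis by simp
qed

text \<open>The binomial formula, cut off after the term linear in \<open>s\<close>.\<close>

lemma power_add_nilpotent:
  fixes s T :: "'a::real_algebra_1"
  assumes "central s" "s * s = 0"
  shows "(s + T) ^ Suc j = T ^ Suc j + real (Suc j) *\<^sub>R (s * T ^ j)"
proof (induction j)
  case (Suc j)
  have c: "T * (s * T ^ j) = s * T ^ Suc j" "s * (s * T ^ j) = 0"
    using assms centralD[OF assms(1), of T] by (simp_all flip: mult.assoc)
  have "(s + T) ^ Suc (Suc j) = (s + T) * (T ^ Suc j + real (Suc j) *\<^sub>R (s * T ^ j))"
    unfolding Suc.IH[symmetric] by simp
  also have "\<dots> = T ^ Suc (Suc j) + s * T ^ Suc j + real (Suc j) *\<^sub>R (s * T ^ Suc j)"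
    by (simp only: distrib_left distrib_right mult_scaleR_right c power_Suc[of T "Suc j"]) simp
  finally show ?case by (simp only: of_nat_Suc[of "Suc j"] scaleR_add_left scaleR_one add.assoc)
qed simp

lemma gexp_add_nilpotent:
  assumes s: "central s" "s * s = 0" and 0: "gcoeff s {} = 0" "gcoeff T {} = 0"
  shows "gexp (s + T) = (1 + s) * gexp T"
proof -
  let ?f = "\<lambda>j. T ^ j /\<^sub>R fact j" and ?g = "\<lambda>j. (s + T) ^ j /\<^sub>R fact j"
  \<comment> \<open>A common cutoff for both series. It is used at \<open>N\<close> and at
    \<open>Suc N\<close>, since splitting off the term of index 0 shifts the summation by
    one.\<close>
  obtain N where N: "{j. ?f j \<noteq> 0} \<subseteq> {..<N}" "{j. ?g j \<noteq> 0} \<subseteq> {..<N}"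
  proof -
    have "finite ({j. ?f j \<noteq> 0} \<union> {j. ?g j \<noteq> 0})" using 0 by (intro finite_UnI finite_gpowers) auto
    then obtain N where "{j. ?f j \<noteq> 0} \<union> {j. ?g j \<noteq> 0} \<subseteq> {..<N}"
      unfolding finite_nat_set_iff_bounded by blast
    then show ?thesis using that by blast
  qed
  have e: "gexp T = sum ?f {..<M}" "gexp (s + T) = sum ?g {..<M}" if "M \<ge> N" for M
    unfolding gexp_def using N that
    by (intro Sum_any.expand_superset; force)+
  have *: "?g (Suc j) = ?f (Suc j) + s * ?f j" for j
    unfolding power_add_nilpotent[OF s] scaleR_add_right mult_scaleR_right
    by (simp add: fact_Suc del: of_nat_Suc)
  have "gexp (s + T) = ?g 0 + (\<Sum>j<N. ?g (Suc j))"
    by (simp only: e(2)[OF le_SucI[OF order_refl]] sum.lessThan_Suc_shift)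
  also have "(\<Sum>j<N. ?g (Suc j)) = (\<Sum>j<N. ?f (Suc j)) + s * (\<Sum>j<N. ?f j)"
    unfolding * by (simp only: sum.distrib sum_distrib_left)
  also have "?g 0 + \<dots> = (?f 0 + (\<Sum>j<N. ?f (Suc j))) + s * (\<Sum>j<N. ?f j)"
    by simp
  also have "\<dots> = sum ?f {..<Suc N} + s * sum ?f {..<N}"
    by (simp only: sum.lessThan_Suc_shift)
  also have "\<dots> = gexp T + s * gexp T"
    by (simp only: e(1)[OF le_SucI[OF order_refl]] e(1)[OF order_refl, symmetric])
  finally show ?thesis by (simp add: distrib_right)
qed

lemma gcoeff_sum: "gcoeff (sum f S) A = (\<Sum>a\<in>S. gcoeff (f a) A)"
  by (induction S rule: infinite_finite_induct) auto

text \<open>Turns the Gaussian weight into a finite product, which derivatives and subset expansions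
  can handle factor by factor.\<close>

lemma gexp_sum:
  assumes "finite U" "\<And>u. u \<in> U \<Longrightarrow> central (s u)" "\<And>u. u \<in> U \<Longrightarrow> s u * s u = 0"
    "\<And>u. u \<in> U \<Longrightarrow> gcoeff (s u) {} = 0"
  shows "gexp (\<Sum>u\<in>U. s u) = cprod (\<lambda>u. 1 + s u) U"
  using assms
proof (induction U)
  case (insert u U)
  have "gexp (\<Sum>u\<in>insert u U. s u) = (1 + s u) * gexp (\<Sum>u\<in>U. s u)"
    using insert by (simp add: gexp_add_nilpotent gcoeff_sum)
  then show ?case using insert by (subst cprod_insert_central) (auto intro: central_add)
qed simp

lemma gform_pair_nilpotent:
  assumes "x \<in> gforms" "y \<in> gforms"
  shows "x * y * (x * y) = 0"
proof -
  have "x * y * (x * y) = x * (y * x) * y" by (simp add: mult.assoc)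
  also have "\<dots> = - (x * x) * (y * y)" by (simp add: gform_anticommute[OF assms(2,1)] mult.assoc)
  finally show ?thesis by (simp only: gform_square[OF assms(1)] mult_zero_left minus_zero)
qed

lemma gcoeff_gform_empty: "x \<in> gforms \<Longrightarrow> gcoeff x {} = 0"
  by (induction rule: span_induct_alt) (auto simp: gen.rep_eq)

lemma gcoeff_mult_empty: "gcoeff (x * y) {} = gcoeff x {} * gcoeff y {}"
  by (simp add: gcoeff_mult)

section \<open>The Dirichlet Green function\<close>

text \<open>The generators of the Grassmann algebra serve as a basis of the space of vectors indexed by \<open>S\<close>.\<close>

lemma left_inverse_exists:
  fixes A :: "'v \<Rightarrow> 'v \<Rightarrow> real"
  assumes S: "finite S"
    and inj: "\<forall>c. (\<forall>v\<in>S. (\<Sum>u\<in>S. c u * A u v) = 0) \<longrightarrow> (\<forall>u\<in>S. c u = 0)"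
  shows "\<exists>G. \<forall>u\<in>S. \<forall>v\<in>S. (\<Sum>w\<in>S. G u w * A w v) = (if u = v then 1 else 0)"
proof -
  define T where "T u = (\<Sum>v\<in>S. A u v *\<^sub>R gen v)" for u
  have gT: "gcoeff (T u) {v} = A u v" if "v \<in> S" for u v
    using S that by (simp add: T_def gcoeff_sum gen.rep_eq sum.delta' if_distrib cong: if_cong)
  have inj_T: "inj_on T S"
  proof (rule inj_onI, rule ccontr)
    fix u u' assume u: "u \<in> S" "u' \<in> S" "T u = T u'" "u \<noteq> u'"
    \<comment> \<open>Two equal rows give the linear relation with coefficient 1 at \<open>u\<close>
      and -1 at \<open>u'\<close>.\<close>
    have "(\<Sum>w\<in>S. ((if w = u then 1 else 0) - (if w = u' then 1 else 0)) * A w v) = 0"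
      if "v \<in> S" for v
    proof -
      have "A u v = A u' v" using gT[OF that] u by metis
      then show ?thesis
        using S u by (simp add: left_diff_distrib sum_subtractf if_distrib[of "\<lambda>x. x * _"] cong: if_cong)
    qed
    then have "(if u = u then 1 else 0) - (if u = u' then 1 else 0) = (0 :: real)"
      using spec[OF inj, of "\<lambda>w. (if w = u then 1 else 0) - (if w = u' then 1 else 0)"] u by blast
    then show False using u by simp
  qed
  have ind: "independent (T ` S)"
  proof
    assume "dependent (T ` S)"
    then obtain c where c: "(\<Sum>x\<in>T ` S. c x *\<^sub>R x) = 0" "\<exists>x\<in>T ` S. c x \<noteq> 0"
      using S by (auto simp: dependent_finite)
    have "(\<Sum>u\<in>S. c (T u) * A u v) = 0" if "v \<in> S" for v
    proof -
      have "(\<Sum>u\<in>S. c (T u) *\<^sub>R T u) = 0" using c(1) by (simp add: sum.reindex[OF inj_T])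
      from arg_cong[OF this, of "\<lambda>x. gcoeff x {v}"] show ?thesis
        using that by (simp add: gcoeff_sum gT)
    qed
    then have "c (T u) = 0" if "u \<in> S" for u using spec[OF inj, of "\<lambda>u. c (T u)"] that by blast
    then show False using c(2) by auto
  qed
  have inj_gen: "inj_on gen (S :: 'v set)"
  proof (rule inj_onI)
    fix i j :: 'v assume "gen i = gen j"
    then have "gcoeff (gen i) {i} = gcoeff (gen j) {i}" by simp
    then show "i = j" by (simp add: gen.rep_eq split: if_splits)
  qed
  have sub: "T ` S \<subseteq> span (gen ` S)"
    by (auto simp: T_def intro!: span_sum span_scale intro: span_base)
  have "\<exists>g. \<forall>v\<in>S. (\<Sum>w\<in>S. g w * A w v) = (if u = v then 1 else 0)" if u: "u \<in> S" for u
  proof -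
    \<comment> \<open>Dimension count: otherwise the \<open>card S\<close> independent rows together
      with \<open>gen u\<close> would be \<open>card S + 1\<close> independent vectors in the span
      of \<open>card S\<close> generators.\<close>
    have "gen u \<in> span (T ` S)"
    proof (rule ccontr)
      assume n: "gen u \<notin> span (T ` S)"
      then have "gen u \<notin> T ` S" using span_base by blast
      have "card (insert (gen u) (T ` S)) \<le> card (gen ` S)"
        using independent_span_bound[of "gen ` S" "insert (gen u) (T ` S)"] S sub u
          independent_insertI[OF n ind] by (auto intro: span_base)
      then show False
        using \<open>gen u \<notin> T ` S\<close> S by (simp add: card_image inj_T inj_gen)
    qed
    then obtain c where "gen u = (\<Sum>x\<in>T ` S. c x *\<^sub>R x)"
      using S by (auto simp: span_finite)
    then have c: "gen u = (\<Sum>w\<in>S. c (T w) *\<^sub>R T w)" by (simp add: sum.reindex[OF inj_T])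
    have "(\<Sum>w\<in>S. c (T w) * A w v) = (if u = v then 1 else 0)" if "v \<in> S" for v
      using arg_cong[OF c, of "\<lambda>x. gcoeff x {v}"] that
      by (auto simp: gcoeff_sum gT gen.rep_eq)
    then show ?thesis by (intro exI[of _ "\<lambda>w. c (T w)"]) blast
  qed
  then show ?thesis by metis
qed

text \<open>Since \<open>A\<close> is symmetric, the transpose of a left inverse is a right inverse,
  and a left inverse agrees with every right inverse. This yields the symmetry of the inverse and
  the uniqueness that the description in \<open>inverse_on\<close> requires.\<close>

lemma inverse_on_symmetric:
  fixes A :: "'v \<Rightarrow> 'v \<Rightarrow> real"
  assumes S: "finite S" and sym: "\<And>u v. A u v = A v u"
    and inj: "\<forall>c. (\<forall>v\<in>S. (\<Sum>u\<in>S. c u * A u v) = 0) \<longrightarrow> (\<forall>u\<in>S. c u = 0)"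
  shows "\<And>u v. u \<in> S \<Longrightarrow> v \<in> S \<Longrightarrow> (\<Sum>w\<in>S. A u w * inverse_on S A w v) = (if u = v then 1 else 0)"
    and "\<And>u v. inverse_on S A u v = inverse_on S A v u"
    and "\<And>u v. u \<notin> S \<or> v \<notin> S \<Longrightarrow> inverse_on S A u v = 0"
proof -
  obtain G0 where G0: "\<forall>u\<in>S. \<forall>v\<in>S. (\<Sum>w\<in>S. G0 u w * A w v) = (if u = v then 1 else 0)"
    using left_inverse_exists[OF S inj] by blast
  define G where "G u v = (if u \<in> S \<and> v \<in> S then G0 u v else 0)" for u v
  have GA: "(\<Sum>w\<in>S. G u w * A w v) = (if u = v then 1 else 0)" if "u \<in> S" "v \<in> S" for u v
  proof -
    have "(\<Sum>w\<in>S. G u w * A w v) = (\<Sum>w\<in>S. G0 u w * A w v)"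
      using that by (intro sum.cong) (auto simp: G_def)
    then show ?thesis using G0 that by simp
  qed
  have AG: "(\<Sum>w\<in>S. A u w * G v w) = (if u = v then 1 else 0)" if "u \<in> S" "v \<in> S" for u v
    using GA[OF that(2,1)] sym by (simp add: mult.commute eq_commute)
  \<comment> \<open>The argument G = G(AB) = (GA)B = B, for one column. \<open>B\<close> carries its
    indices transposed so that \<open>G\<close> itself can be inserted, which gives symmetry; a
    genuine inverse is inserted with its indices swapped.\<close>
  have assoc: "G u v = B v u"
    if u: "u \<in> S" "v \<in> S" and B: "\<And>w. w \<in> S \<Longrightarrow> (\<Sum>x\<in>S. A w x * B v x) = (if w = v then 1 else 0)"
    for u v B
  proof -
    have "G u v = (\<Sum>w\<in>S. G u w * (if w = v then 1 else 0))"
      using S u by (simp add: if_distrib cong: if_cong)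
    also have "\<dots> = (\<Sum>w\<in>S. G u w * (\<Sum>x\<in>S. A w x * B v x))" using B by simp
    also have "\<dots> = (\<Sum>w\<in>S. \<Sum>x\<in>S. G u w * A w x * B v x)"
      by (simp add: sum_distrib_left mult.assoc)
    also have "\<dots> = (\<Sum>x\<in>S. (\<Sum>w\<in>S. G u w * A w x) * B v x)"
      by (subst sum.swap) (simp add: sum_distrib_right)
    also have "\<dots> = (\<Sum>x\<in>S. if u = x then B v x else 0)" using u GA by (intro sum.cong) auto
    finally show ?thesis using S u by simp
  qed
  have symG: "G u v = G v u" for u v
    using assoc[of u v G] AG by (cases "u \<in> S \<and> v \<in> S") (auto simp: G_def)
  have AG': "(\<Sum>w\<in>S. A u w * G w v) = (if u = v then 1 else 0)" if "u \<in> S" "v \<in> S" for u v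
  proof -
    have "(\<Sum>w\<in>S. A u w * G w v) = (\<Sum>w\<in>S. A u w * G v w)"
      by (intro sum.cong refl arg_cong2[of _ _ _ _ "(*)"] symG)
    then show ?thesis using AG that by simp
  qed
  have G0: "G u v = 0" if "u \<notin> S \<or> v \<notin> S" for u v
    using that by (auto simp: G_def)
  have "inverse_on S A = G"
    unfolding inverse_on_def
  proof (rule the_equality, goal_cases)
    case 1
    show ?case using GA AG' G0 by blast
  next
    case (2 B)
    show ?case
    proof (intro ext)
      fix u v
      show "B u v = G u v"
        using assoc[of u v "\<lambda>v x. B x v"] 2 by (cases "u \<in> S \<and> v \<in> S") (auto simp: G_def)
    qed
  qed
  then show "\<And>u v. u \<in> S \<Longrightarrow> v \<in> S \<Longrightarrow> (\<Sum>w\<in>S. A u w * inverse_on S A w v) = (if u = v then 1 else 0)"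
    and "\<And>u v. inverse_on S A u v = inverse_on S A v u"
    and "\<And>u v. u \<notin> S \<or> v \<notin> S \<Longrightarrow> inverse_on S A u v = 0"
    using AG' symG G0 by auto
qed

section \<open>Invertibility of the Dirichlet Laplacian\<close>

lemma conn_lf_graphD:
  assumes "conn_lf_graph L adj"
  shows "adj u v \<Longrightarrow> u \<in> L" "adj u v \<Longrightarrow> v \<in> L" "adj u v \<Longrightarrow> u \<noteq> v" "adj u v \<Longrightarrow> adj v u"
    "u \<in> L \<Longrightarrow> finite {w. adj u w}" "u \<in> L \<Longrightarrow> v \<in> L \<Longrightarrow> adj\<^sup>*\<^sup>* u v"
  using assms by (auto simp: conn_lf_graph_def)

lemma laplacian_sym:
  assumes "conn_lf_graph L adj"
  shows "laplacian adj u v = laplacian adj v u"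
  using conn_lf_graphD(4)[OF assms] by (auto simp: laplacian_def)

text \<open>As a sum of differences over all neighbours, with \<open>c\<close> extended by 0 outside
  \<Lambda>, the expression shows the Dirichlet condition and is ready for the maximum
  principle.\<close>

lemma laplacian_sum:
  assumes graph: "conn_lf_graph L adj" and fin: "finite \<Lambda>" and sub: "\<Lambda> \<subseteq> L" and v: "v \<in> \<Lambda>"
  shows "(\<Sum>u\<in>\<Lambda>. c u * - laplacian adj u v) =
    (\<Sum>u | adj v u. c v - (if u \<in> \<Lambda> then c u else 0))"
proof -
  note g = conn_lf_graphD[OF graph]
  have finv: "finite {u. adj v u}" using g(5) v sub by auto
  have "(\<Sum>u\<in>\<Lambda>. c u * - laplacian adj u v) =
      (\<Sum>u\<in>\<Lambda>. (if u = v then c v * real (card {u. adj v u}) else 0) - (if adj v u then c u else 0))"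
    using g(3,4) by (intro sum.cong) (auto simp: laplacian_def)
  also have "\<dots> = c v * real (card {u. adj v u}) - (\<Sum>u\<in>\<Lambda>. if adj v u then c u else 0)"
    using fin v by (simp add: sum_subtractf)
  also have "(\<Sum>u\<in>\<Lambda>. if adj v u then c u else 0) = (\<Sum>u | adj v u. if u \<in> \<Lambda> then c u else 0)"
    using fin finv by (simp add: sum.inter_restrict[symmetric] Int_def conj_commute flip: sum.inter_filter)
  finally show ?thesis by (simp add: sum_subtractf)
qed

text \<open>Where the extension \<open>e\<close> of \<open>c\<close> by 0 attains a positive maximum
  \<open>m\<close>, the equation is a vanishing sum of terms \<open>m - e w \<ge> 0\<close>, so all
  neighbours have the value \<open>m\<close> too. By connectedness the value reaches a vertex
  outside \<Lambda>, where \<open>e\<close> is 0.\<close>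

lemma laplacian_maximum_principle:
  assumes graph: "conn_lf_graph L adj" and fin: "finite \<Lambda>" and sub: "\<Lambda> \<subset> L"
    and c: "\<And>v. v \<in> \<Lambda> \<Longrightarrow> (\<Sum>u\<in>\<Lambda>. c u * - laplacian adj u v) = 0" and u: "u \<in> \<Lambda>"
  shows "c u \<le> 0"
proof (rule ccontr)
  assume "\<not> c u \<le> 0"
  note g = conn_lf_graphD[OF graph]
  define e where "e v = (if v \<in> \<Lambda> then c v else 0)" for v
  define m where "m = Max (c ` \<Lambda>)"
  have m: "c v \<le> m" if "v \<in> \<Lambda>" for v using fin that by (simp add: m_def)
  then have "m > 0" using u \<open>\<not> c u \<le> 0\<close> by fastforce
  then have em: "e v \<le> m" for v using m by (simp add: e_def)
  have "m \<in> c ` \<Lambda>" unfolding m_def using fin u by (intro Max_in) auto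
  then obtain v0 where v0: "v0 \<in> \<Lambda>" "c v0 = m" by auto
  have step: "e w = m" if v: "e v = m" and "adj v w" for v w
  proof -
    have vL: "v \<in> \<Lambda>" using v \<open>m > 0\<close> by (auto simp: e_def split: if_splits)
    have "(\<Sum>w | adj v w. m - e w) = 0"
      using laplacian_sum[OF graph fin _ vL, of c] c[OF vL] v vL sub by (simp add: e_def)
    moreover have "finite {w. adj v w}" using g(5) vL sub by auto
    ultimately have "m - e w = 0"
      using \<open>adj v w\<close> em by (subst (asm) sum_nonneg_eq_0_iff) (auto simp: algebra_simps)
    then show ?thesis by simp
  qed
  obtain z where z: "z \<in> L" "z \<notin> \<Lambda>" using sub by auto
  have "adj\<^sup>*\<^sup>* v0 z" using g(6) v0 z sub by auto
  then have "e z = m" by induction (use v0 step in \<open>auto simp: e_def\<close>)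
  then show False using z \<open>m > 0\<close> by (simp add: e_def)
qed

lemma laplacian_injective:
  assumes graph: "conn_lf_graph L adj" and fin: "finite \<Lambda>" and sub: "\<Lambda> \<subset> L"
    and c: "\<And>v. v \<in> \<Lambda> \<Longrightarrow> (\<Sum>u\<in>\<Lambda>. c u * - laplacian adj u v) = 0" and u: "u \<in> \<Lambda>"
  shows "c u = 0"
proof -
  have "c u \<le> 0" by (rule laplacian_maximum_principle[OF graph fin sub _ u]) (fact c)
  moreover have "- c u \<le> 0"
    by (rule laplacian_maximum_principle[OF graph fin sub _ u, of "\<lambda>u. - c u"])
      (use c in \<open>auto simp: sum_negf\<close>)
  ultimately show ?thesis by simp
qed

lemma green_properties:
  assumes "conn_lf_graph L adj" "finite \<Lambda>" "\<Lambda> \<subset> L"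
  shows "\<And>u v. u \<in> \<Lambda> \<Longrightarrow> v \<in> \<Lambda> \<Longrightarrow>
      (\<Sum>w\<in>\<Lambda>. - laplacian adj u w * green adj \<Lambda> w v) = (if u = v then 1 else 0)"
    and "\<And>u v. green adj \<Lambda> u v = green adj \<Lambda> v u"
    and "\<And>u v. u \<notin> \<Lambda> \<or> v \<notin> \<Lambda> \<Longrightarrow> green adj \<Lambda> u v = 0"
proof -
  have inj: "\<forall>c. (\<forall>v\<in>\<Lambda>. (\<Sum>u\<in>\<Lambda>. c u * - laplacian adj u v) = 0) \<longrightarrow> (\<forall>u\<in>\<Lambda>. c u = 0)"
    using laplacian_injective[OF assms] by blast
  have sym: "- laplacian adj u v = - laplacian adj v u" for u v
    using laplacian_sym[OF assms(1), of u v] by simp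
  note * = inverse_on_symmetric[of \<Lambda> "\<lambda>u v. - laplacian adj u v", OF assms(2) sym inj]
  show "\<And>u v. u \<in> \<Lambda> \<Longrightarrow> v \<in> \<Lambda> \<Longrightarrow>
      (\<Sum>w\<in>\<Lambda>. - laplacian adj u w * green adj \<Lambda> w v) = (if u = v then 1 else 0)"
    unfolding green_def by (rule *(1))
  show "\<And>u v. green adj \<Lambda> u v = green adj \<Lambda> v u"
    unfolding green_def by (rule *(2))
  show "\<And>u v. u \<notin> \<Lambda> \<or> v \<notin> \<Lambda> \<Longrightarrow> green adj \<Lambda> u v = 0"
    unfolding green_def by (rule *(3))
qed

section \<open>The fermionic Wick rule\<close>

text \<open>The product is the exponential of the sum of \<open>gen (Psi u) * y u\<close>, whose
  derivative is minus the form subtracted here. The exponential is even, so the derivative passes it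
  without a sign.\<close>

lemma gderiv_cprod_one_plus:
  assumes U: "finite U" and y: "range y \<subseteq> psibar_forms"
  shows "gderiv (Psibar v) (cprod (\<lambda>u. 1 + gen (Psi u) * y u) U * P) =
    cprod (\<lambda>u. 1 + gen (Psi u) * y u) U * gderiv (Psibar v) P
    - (\<Sum>u\<in>U. gcoeff (y u) {Psibar v} *\<^sub>R gen (Psi u)) * (cprod (\<lambda>u. 1 + gen (Psi u) * y u) U * P)"
  using U
proof (induction U)
  case (insert a U)
  let ?x = "\<lambda>u. gen (Psi u)" and ?s = "\<lambda>u. gen (Psi u) * y u"
  let ?Q = "cprod (\<lambda>u. 1 + ?s u) U * P" and ?D = "gderiv (Psibar v)"
  let ?\<xi> = "\<lambda>U. \<Sum>u\<in>U. gcoeff (y u) {Psibar v} *\<^sub>R gen (Psi u)"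
  have Y: "y j \<in> gforms" for j using y psi_forms_subset by auto
  have c: "central (?s u)" for u by (intro central_gform_mult Y) simp
  have E: "cprod (\<lambda>u. 1 + ?s u) (insert a U) = (1 + ?s a) * cprod (\<lambda>u. 1 + ?s u) U"
    using insert c by (intro cprod_insert_central) (auto intro: central_add)
  have x0: "?x a * (?s a * ?Q) = 0"
    using gform_square[of "?x a"] by (simp flip: mult.assoc)
  have "?D (cprod (\<lambda>u. 1 + ?s u) (insert a U) * P) = ?D ?Q + ?D (?s a * ?Q)"
    by (simp add: E distrib_right mult.assoc gderiv_linear)
  also have "?D (?s a * ?Q) = ?s a * ?D ?Q - gcoeff (y a) {Psibar v} *\<^sub>R (?x a * ?Q)"
    using Y by (intro gderiv_pair_mult) (auto simp: gen.rep_eq)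
  \<comment> \<open>\<open>?x a\<close> kills \<open>?s a\<close>, so the factor
    \<open>1 + ?s a\<close> can be inserted; it completes the product over
    \<open>insert a U\<close>.\<close>
  also have "?x a * ?Q = ?x a * ((1 + ?s a) * ?Q)"
    using x0 by (simp add: distrib_left distrib_right)
  also have "?D ?Q + (?s a * ?D ?Q - gcoeff (y a) {Psibar v} *\<^sub>R (?x a * ((1 + ?s a) * ?Q))) =
      (1 + ?s a) * ?D ?Q - gcoeff (y a) {Psibar v} *\<^sub>R (?x a * ((1 + ?s a) * ?Q))"
    by (simp add: distrib_right)
  also have "?D ?Q = cprod (\<lambda>u. 1 + ?s u) U * ?D P - ?\<xi> U * ?Q"
    by (rule insert.IH)
  also have "(1 + ?s a) * (cprod (\<lambda>u. 1 + ?s u) U * ?D P - ?\<xi> U * ?Q) =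
      (1 + ?s a) * cprod (\<lambda>u. 1 + ?s u) U * ?D P - ((1 + ?s a) * ?\<xi> U) * ?Q"
    by (simp only: right_diff_distrib mult.assoc)
  also have "(1 + ?s a) * ?\<xi> U = ?\<xi> U * (1 + ?s a)"
    by (intro centralD central_add c) simp
  finally show ?case
    using insert.hyps by (simp only: E sum.insert distrib_right mult.assoc mult_scaleR_left) (simp add: algebra_simps)
qed simp

text \<open>In the expansion over subsets of \<open>S\<close>, a product over a proper subset misses
  some \<open>Psi v\<close> and integrates to 0; only \<open>S\<close> itself contributes.\<close>

lemma gint_cprod_one_plus:
  assumes S: "finite S" and y: "range y \<subseteq> psibar_forms"
  shows "gint S (cprod (\<lambda>u. 1 + gen (Psi u) * y u) S) = det_on S (\<lambda>i j. gcoeff (y j) {Psibar i})"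
proof -
  let ?s = "\<lambda>u. gen (Psi u) * y u"
  have Y: "y j \<in> gforms" for j using y psi_forms_subset by auto
  have c: "central (?s u)" for u by (intro central_gform_mult Y) simp
  have "gint S (cprod (\<lambda>u. 1 + ?s u) S) = (\<Sum>A\<in>Pow S. gint S (cprod ?s A))"
    using S c by (simp add: cprod_one_plus gint_linear)
  also have "\<dots> = (\<Sum>A\<in>{S}. gint S (cprod ?s A))"
  proof (rule sum.mono_neutral_right, goal_cases)
    case 3
    show ?case
    proof
      fix A assume "A \<in> Pow S - {S}"
      then obtain v where "v \<in> S" "v \<notin> A" "A \<subseteq> S" by auto
      then show "gint S (cprod ?s A) = 0"
        using S y by (intro gint_eq_0[of S v] gderiv_Psi_cprod) (auto intro: finite_subset)
    qed
  qed (use S in auto)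
  finally show ?thesis using gint_cprod_pairs[OF assms] by simp
qed

lemma det_on_identity:
  assumes "finite S"
  shows "det_on S (\<lambda>i j. if i = j then 1 else 0) = 1"
  using assms
proof (induction S)
  case (insert a S)
  let ?I = "\<lambda>i j. if i = j then 1 else 0 :: real"
  have "det_on (insert a S) ?I = 1 * 1 - (\<Sum>b\<in>S. 0)"
    unfolding det_on_insert[OF insert.hyps] insert.IH
    by (intro arg_cong2[of _ _ _ _ "(-)"] sum.cong) (use insert.hyps in auto)
  then show ?case by simp
qed simp

text \<open>The second product already contains every \<open>Psi u\<close>, so each nonconstant term
  of the first repeats one of them and vanishes. This evaluates one side of the Wick rule that
  proves the determinant of the Laplacian nonzero.\<close>

lemma gint_saturated:
  assumes S: "finite S" and y: "range y \<subseteq> psibar_forms"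
  shows "gint S (cprod (\<lambda>u. 1 + gen (Psi u) * y u) S * cprod (\<lambda>u. gen (Psi u) * gen (Psibar u)) S) = 1"
proof -
  let ?s = "\<lambda>u. gen (Psi u) * y u" and ?t = "\<lambda>u. gen (Psi u) * gen (Psibar u)"
  have Y: "y j \<in> gforms" for j using y psi_forms_subset by auto
  have c: "central (?s u)" "central (?t u)" for u by (intro central_gform_mult Y; simp)+
  have "cprod ?s A * cprod ?t S = 0" if A: "A \<subseteq> S" "A \<noteq> {}" for A
  proof -
    obtain a where a: "a \<in> A" "a \<in> S" using A by auto
    have "cprod ?s (insert a (A - {a})) = ?s a * cprod ?s (A - {a})"
      using c finite_subset[OF A(1) S] by (intro cprod_insert_central) auto
    then have 1: "cprod ?s A = cprod ?s (A - {a}) * ?s a"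
      using a centralD[OF c(1)] by (simp add: insert_absorb)
    have "cprod ?t (insert a (S - {a})) = ?t a * cprod ?t (S - {a})"
      using c S by (intro cprod_insert_central) auto
    then have 2: "cprod ?t S = ?t a * cprod ?t (S - {a})"
      using a by (simp add: insert_absorb)
    have "?s a * ?t a = gen (Psi a) * (y a * gen (Psi a)) * gen (Psibar a)" by (simp add: mult.assoc)
    also have "\<dots> = - (gen (Psi a) * gen (Psi a)) * (y a * gen (Psibar a))"
      by (simp add: gform_anticommute[OF Y[of a]] mult.assoc)
    also have "\<dots> = 0" by (simp add: gform_square)
    finally have "?s a * ?t a = 0" .
    have "cprod ?s A * cprod ?t S = cprod ?s (A - {a}) * (?s a * ?t a) * cprod ?t (S - {a})"
      unfolding 1 2 by (simp only: mult.assoc)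
    then show ?thesis using \<open>?s a * ?t a = 0\<close> by simp
  qed
  then have 0: "gint S (cprod ?s A * cprod ?t S) = 0" if "A \<in> Pow S - {{}}" for A
    using that by (simp add: gint_linear)
  have "gint S (cprod (\<lambda>u. 1 + ?s u) S * cprod ?t S) = (\<Sum>A\<in>Pow S. gint S (cprod ?s A * cprod ?t S))"
    using S c by (simp add: cprod_one_plus gint_linear sum_distrib_right)
  also have "\<dots> = (\<Sum>A\<in>{{}}. gint S (cprod ?s A * cprod ?t S))"
    using S 0 by (intro sum.mono_neutral_right) auto
  also have "\<dots> = det_on S (\<lambda>i j. gcoeff (gen (Psibar j)) {Psibar i})"
    using gint_cprod_pairs[OF S, of "\<lambda>u. gen (Psibar u)"] by (simp add: image_subset_iff)
  also have "\<dots> = det_on S (\<lambda>i j. if i = j then 1 else 0)"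
    by (intro det_on_cong) (auto simp: gen.rep_eq)
  finally show ?thesis by (simp add: det_on_identity S)
qed

text \<open>
  The inner sum over \<open>u\<close> is minus the derivative of the action with respect to \<open>Psibar v\<close>, so the
  hypothesis on \<open>x\<close> is what allows integration by parts; \<open>d\<close> is essentially a Green function.
\<close>

lemma fermionic_Wick:
  fixes A :: "'v \<Rightarrow> 'v \<Rightarrow> real" and x y :: "'a \<Rightarrow> 'v fermion grassmann"
  assumes \<Lambda>: "finite \<Lambda>" and z: "range z \<subseteq> psibar_forms"
    and S: "finite S" and y: "range y \<subseteq> psibar_forms"
    and x: "\<And>i. i \<in> S \<Longrightarrow> x i =
      (\<Sum>v\<in>\<Lambda>. d i v *\<^sub>R (\<Sum>u\<in>\<Lambda>. gcoeff (z u) {Psibar v} *\<^sub>R gen (Psi u)))"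
  shows "gint \<Lambda> (cprod (\<lambda>u. 1 + gen (Psi u) * z u) \<Lambda> * cprod (\<lambda>i. x i * y i) S) =
    gint \<Lambda> (cprod (\<lambda>u. 1 + gen (Psi u) * z u) \<Lambda>) *
    det_on S (\<lambda>i j. \<Sum>v\<in>\<Lambda>. d i v * gcoeff (y j) {Psibar v})"
proof -
  let ?E = "cprod (\<lambda>u. 1 + gen (Psi u) * z u) \<Lambda>"
  let ?m = "\<lambda>i Y. \<Sum>v\<in>\<Lambda>. d i v * gcoeff Y {Psibar v}"
  let ?\<xi> = "\<lambda>v. \<Sum>u\<in>\<Lambda>. gcoeff (z u) {Psibar v} *\<^sub>R gen (Psi u)"
  have Z: "z j \<in> gforms" for j using z psi_forms_subset by auto
  have cE: "central ?E" by (intro central_cprod central_add central_gform_mult Z) auto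
  have X: "x i \<in> psi_forms" if "i \<in> S" for i
    unfolding x[OF that] psi_forms_def by (intro span_sum span_scale span_base) auto
  \<comment> \<open>\<open>T = S\<close> restricts the recursion to indices for which the expansion
    of \<open>x\<close> is assumed.\<close>
  show ?thesis
  proof (rule det_on_unique[where W = "\<lambda>S y. gint \<Lambda> (?E * cprod (\<lambda>i. x i * y i) S)" and m = ?m
        and T = S and Y = psibar_forms])
    fix a and T :: "'a set" and y :: "'a \<Rightarrow> 'v fermion grassmann"
    assume T: "finite T" "a \<notin> T" "insert a T \<subseteq> S" and y: "range y \<subseteq> psibar_forms"
    let ?\<Pi> = "cprod (\<lambda>i. x i * y i) T"
    have Y: "y j \<in> gforms" for j using y psi_forms_subset by auto
    have X': "x i \<in> gforms" "gcoeff (x i) {Psibar v} = 0" if "i \<in> insert a T" for i v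
    proof -
      have "x i \<in> psi_forms" using X T(3) that by blast
      then show "x i \<in> gforms" "gcoeff (x i) {Psibar v} = 0"
        using psi_forms_subset gcoeff_psi_forms by auto
    qed
    have "cprod (\<lambda>i. x i * y i) (insert a T) = x a * y a * ?\<Pi>"
      using T X' Y by (intro cprod_insert_central) (auto intro: central_gform_mult)
    then have "gint \<Lambda> (?E * cprod (\<lambda>i. x i * y i) (insert a T)) = gint \<Lambda> (x a * (?E * (y a * ?\<Pi>)))"
      using centralD[OF cE, of "x a"] by (simp flip: mult.assoc)
    also have "\<dots> = (\<Sum>v\<in>\<Lambda>. d a v * gint \<Lambda> (?\<xi> v * (?E * (y a * ?\<Pi>))))"
    proof -
      have "x a = (\<Sum>v\<in>\<Lambda>. d a v *\<^sub>R ?\<xi> v)" using x T(3) by auto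
      then show ?thesis by (simp only: sum_distrib_right mult_scaleR_left gint_linear) simp
    qed
    also have "\<dots> = (\<Sum>v\<in>\<Lambda>. d a v * gint \<Lambda> (?E * gderiv (Psibar v) (y a * ?\<Pi>)))"
    proof (intro sum.cong refl arg_cong2[of _ _ _ _ "(*)"])
      fix v assume "v \<in> \<Lambda>"
      \<comment> \<open>Integration by parts: the integral of a derivative is 0, and
        \<open>gderiv_cprod_one_plus\<close> splits that derivative into the two terms to be
        equated.\<close>
      have "0 = gint \<Lambda> (gderiv (Psibar v) (?E * (y a * ?\<Pi>)))"
        using \<Lambda> \<open>v \<in> \<Lambda>\<close> by (rule gint_gderiv_Psibar[symmetric])
      then show "gint \<Lambda> (?\<xi> v * (?E * (y a * ?\<Pi>))) = gint \<Lambda> (?E * gderiv (Psibar v) (y a * ?\<Pi>))"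
        by (simp only: gderiv_cprod_one_plus[OF \<Lambda> z] gint_linear)
    qed
    also have "\<dots> = (\<Sum>v\<in>\<Lambda>. d a v * (gcoeff (y a) {Psibar v} * gint \<Lambda> (?E * ?\<Pi>) -
        (\<Sum>b\<in>T. gcoeff (y b) {Psibar v} * gint \<Lambda> (?E * cprod (\<lambda>j. x j * (y(b := y a)) j) T))))"
    proof (intro sum.cong refl arg_cong2[of _ _ _ _ "(*)"])
      fix v
      have "gderiv (Psibar v) (y a * ?\<Pi>) = gcoeff (y a) {Psibar v} *\<^sub>R ?\<Pi> -
          (\<Sum>b\<in>T. gcoeff (y b) {Psibar v} *\<^sub>R cprod (\<lambda>j. x j * (y(b := y a)) j) T)"
        using T X' Y by (intro gderiv_form_cprod_pairs) auto
      then show "gint \<Lambda> (?E * gderiv (Psibar v) (y a * ?\<Pi>)) = gcoeff (y a) {Psibar v} * gint \<Lambda> (?E * ?\<Pi>) -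
        (\<Sum>b\<in>T. gcoeff (y b) {Psibar v} * gint \<Lambda> (?E * cprod (\<lambda>j. x j * (y(b := y a)) j) T))"
        by (simp only: right_diff_distrib sum_distrib_left mult_scaleR_right gint_linear) simp
    qed
    also have "\<dots> = ?m a (y a) * gint \<Lambda> (?E * ?\<Pi>) -
        (\<Sum>b\<in>T. ?m a (y b) * gint \<Lambda> (?E * cprod (\<lambda>j. x j * (y(b := y a)) j) T))"
      by (simp only: right_diff_distrib sum_subtractf sum_distrib_left sum_distrib_right mult.assoc
          sum.swap[of _ T \<Lambda>])
    finally show "gint \<Lambda> (?E * cprod (\<lambda>i. x i * y i) (insert a T)) = ?m a (y a) * gint \<Lambda> (?E * ?\<Pi>) -
        (\<Sum>b\<in>T. ?m a (y b) * gint \<Lambda> (?E * cprod (\<lambda>j. x j * (y(b := y a)) j) T))" .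
  qed (use S y in auto)
qed

lemma psibar_in_psibar_forms: "psibar \<Lambda> w \<in> psibar_forms"
  by (simp add: psibar_def) (simp add: psibar_forms_def span_zero)

section \<open>Moments of the edge fields in the fermionic Gaussian free field\<close>

context
  fixes L :: "'v set" and adj and \<Lambda>
  assumes graph: "conn_lf_graph L adj" and fin: "finite \<Lambda>" and sub: "\<Lambda> \<subset> L"
begin

private abbreviation (input) A where "A u v \<equiv> - laplacian adj u v"
text \<open>The action is the sum of \<open>gen (Psi u) * chi u\<close>, so that \<open>E\<close> is
  its exponential in product form.\<close>

private abbreviation (input) chi where "chi u \<equiv> \<Sum>v\<in>\<Lambda>. A u v *\<^sub>R gen (Psibar v)"
private abbreviation (input) E where "E \<equiv> cprod (\<lambda>u. 1 + gen (Psi u) * chi u) \<Lambda>"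

lemma range_chi: "range chi \<subseteq> psibar_forms"
  unfolding psibar_forms_def by (rule image_subsetI) (intro span_sum span_scale span_base rangeI)

lemma gcoeff_chi: "v \<in> \<Lambda> \<Longrightarrow> gcoeff (chi u) {Psibar v} = A u v"
  using fin by (simp add: gcoeff_sum gen.rep_eq sum.delta' if_distrib sum_negf cong: if_cong)

lemma gexp_action: "gexp (action adj \<Lambda>) = E"
proof -
  have "chi u \<in> gforms" for u using range_chi psi_forms_subset by blast
  moreover have "action adj \<Lambda> = (\<Sum>u\<in>\<Lambda>. gen (Psi u) * chi u)"
    unfolding action_def by (simp add: psi_def psibar_def sum_distrib_left)
  ultimately show ?thesis
    using fin by (simp only:, intro gexp_sum)
      (auto intro!: central_gform_mult gform_pair_nilpotent simp: gcoeff_mult_empty gcoeff_gform_empty simp del: scaleR_minus_left)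
qed

lemma gint_E: "gint \<Lambda> E = det_on \<Lambda> A"
  unfolding gint_cprod_one_plus[OF fin range_chi]
  by (intro det_on_cong) (simp only: gcoeff_chi laplacian_sym[OF graph])

text \<open>Brings a single fermion into the form that the Wick rule demands: the inner sums are, up
  to sign, derivatives of the action, and the Green function inverts the matrix in them. For
  \<open>w\<close> outside \<Lambda> both sides are 0, which covers edges that leave
  \<Lambda>.\<close>

lemma expand_psi:
  "(\<Sum>v\<in>\<Lambda>. green adj \<Lambda> v w *\<^sub>R (\<Sum>u\<in>\<Lambda>. gcoeff (chi u) {Psibar v} *\<^sub>R gen (Psi u))) = psi \<Lambda> w"
proof -
  have "(\<Sum>v\<in>\<Lambda>. green adj \<Lambda> v w *\<^sub>R (\<Sum>u\<in>\<Lambda>. gcoeff (chi u) {Psibar v} *\<^sub>R gen (Psi u))) =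
      (\<Sum>v\<in>\<Lambda>. \<Sum>u\<in>\<Lambda>. (A u v * green adj \<Lambda> v w) *\<^sub>R gen (Psi u))"
    by (intro sum.cong refl) (simp only: gcoeff_chi scaleR_sum_right scaleR_scaleR mult.commute)
  also have "\<dots> = (\<Sum>u\<in>\<Lambda>. (\<Sum>v\<in>\<Lambda>. A u v * green adj \<Lambda> v w) *\<^sub>R gen (Psi u))"
    by (subst sum.swap) (simp only: scaleR_sum_left)
  also have "\<dots> = (\<Sum>u\<in>\<Lambda>. (if u = w then 1 else 0) *\<^sub>R gen (Psi u))"
  proof (intro sum.cong refl)
    fix u assume "u \<in> \<Lambda>"
    then show "(\<Sum>v\<in>\<Lambda>. A u v * green adj \<Lambda> v w) *\<^sub>R gen (Psi u) = (if u = w then 1 else 0) *\<^sub>R gen (Psi u)"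
      using green_properties(1,3)[OF graph fin sub] by (cases "w \<in> \<Lambda>") auto
  qed
  also have "\<dots> = psi \<Lambda> w"
    using fin by (simp add: psi_def if_distrib[of "\<lambda>c. c *\<^sub>R _"] cong: if_cong)
  finally show ?thesis .
qed

text \<open>The Wick rule for all fields on \<open>\<Lambda>\<close> reads \<open>1 = det (-\<Delta>) det G\<close>.\<close>

lemma det_laplacian_nonzero: "det_on \<Lambda> A \<noteq> 0"
proof -
  have "gint \<Lambda> (E * cprod (\<lambda>i. gen (Psi i) * gen (Psibar i)) \<Lambda>) = gint \<Lambda> E *
      det_on \<Lambda> (\<lambda>i j. \<Sum>v\<in>\<Lambda>. green adj \<Lambda> v i * gcoeff (gen (Psibar j)) {Psibar v})"
  proof (rule fermionic_Wick[OF fin range_chi fin])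
    fix i assume "i \<in> \<Lambda>"
    then show "gen (Psi i) =
        (\<Sum>v\<in>\<Lambda>. green adj \<Lambda> v i *\<^sub>R (\<Sum>u\<in>\<Lambda>. gcoeff (chi u) {Psibar v} *\<^sub>R gen (Psi u)))"
      unfolding expand_psi by (simp add: psi_def)
  qed auto
  then have "1 = det_on \<Lambda> A * det_on \<Lambda> (\<lambda>i j. \<Sum>v\<in>\<Lambda>. green adj \<Lambda> v i * gcoeff (gen (Psibar j)) {Psibar v})"
    unfolding gint_saturated[OF fin range_chi] gint_E .
  then show ?thesis by (intro notI) (simp only: mult_zero_left one_neq_zero)
qed

lemma gcoeff_psibar: "v \<in> \<Lambda> \<Longrightarrow> gcoeff (psibar \<Lambda> w) {Psibar v} = (if v = w then 1 else 0)"
  by (auto simp: psibar_def gen.rep_eq)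

text \<open>By linearity the difference of \<open>psi\<close> along an edge \<open>f\<close> is
  expanded with the coefficients \<open>?d f\<close>; pairing these with the difference of
  \<open>psibar\<close> along \<open>g\<close> gives the four Green function terms of the transfer
  current. The partition function cancels against the normalization.\<close>

lemma fgff_cprod_zeta:
  assumes V: "good adj \<Lambda> V" and F: "finite F" "F \<subseteq> edges_of adj V"
  shows "fgff adj \<Lambda> (cprod (zeta \<Lambda>) F) = det_on F (transfer_current adj \<Lambda> V)"
proof -
  let ?G = "green adj \<Lambda>" and ?h = "head V" and ?t = "tail V"
  let ?x = "\<lambda>f. psi \<Lambda> (?h f) - psi \<Lambda> (?t f)" and ?y = "\<lambda>f. psibar \<Lambda> (?h f) - psibar \<Lambda> (?t f)"
  let ?d = "\<lambda>f v. ?G v (?h f) - ?G v (?t f)"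
  note G = green_properties[OF graph fin sub]
  have y: "range ?y \<subseteq> psibar_forms"
    using psibar_in_psibar_forms[of \<Lambda>] unfolding psibar_forms_def
    by (intro image_subsetI) (intro span_diff)
  have x: "?x f \<in> gforms" for f
    by (auto simp: psi_def span_diff span_zero span_neg)
  have zeta: "zeta \<Lambda> f = ?x f * ?y f" if f: "f \<in> F" for f
  proof -
    obtain v w where "v \<in> V" "f = {v, w}" "adj v w"
      using f F by (auto simp: edges_of_def edges_at_def)
    moreover from this have "w \<notin> V" using V by (auto simp: good_def)
    ultimately show ?thesis by (simp add: tail_head zeta_orientation)
  qed
  have "cprod (zeta \<Lambda>) F = cprod (\<lambda>f. ?x f * ?y f) F"
    using x y psi_forms_subset by (intro cprod_cong_central zeta central_gform_mult) auto
  then have "gint \<Lambda> (gexp (action adj \<Lambda>) * cprod (zeta \<Lambda>) F) = gint \<Lambda> E *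
      det_on F (\<lambda>i j. \<Sum>v\<in>\<Lambda>. ?d i v * gcoeff (?y j) {Psibar v})"
    unfolding gexp_action
    by (simp only:) (rule fermionic_Wick[OF fin range_chi F(1) y],
      simp only: scaleR_left_diff_distrib sum_subtractf expand_psi)
  also have "det_on F (\<lambda>i j. \<Sum>v\<in>\<Lambda>. ?d i v * gcoeff (?y j) {Psibar v}) =
      det_on F (transfer_current adj \<Lambda> V)"
  proof (rule det_on_cong)
    fix f g
    have *: "(\<Sum>v\<in>\<Lambda>. ?d f v * gcoeff (psibar \<Lambda> w) {Psibar v}) = ?d f w" for w
    proof -
      have "(\<Sum>v\<in>\<Lambda>. ?d f v * gcoeff (psibar \<Lambda> w) {Psibar v}) = (\<Sum>v\<in>\<Lambda>. if v = w then ?d f v else 0)"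
        by (intro sum.cong refl) (simp add: gcoeff_psibar)
      then show ?thesis using fin G(3) by simp
    qed
    have "(\<Sum>v\<in>\<Lambda>. ?d f v * gcoeff (?y g) {Psibar v}) = ?d f (?h g) - ?d f (?t g)"
      using *[of "?h g"] *[of "?t g"]
      by (simp only: gcoeff_simps(3) right_diff_distrib[of "?d f _"] sum_subtractf)
    \<comment> \<open>\<open>?d f\<close> puts the endpoints of \<open>g\<close> into the first
      argument of the Green function, so its symmetry is needed.\<close>
    then show "(\<Sum>v\<in>\<Lambda>. ?d f v * gcoeff (?y g) {Psibar v}) = transfer_current adj \<Lambda> V f g"
      unfolding transfer_current_def
      using G(2)[of "?h f" "?h g"] G(2)[of "?h f" "?t g"] G(2)[of "?t f" "?h g"] G(2)[of "?t f" "?t g"]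
      by linarith
  qed
  finally show ?thesis
    unfolding gint_E fgff_def gint_def[symmetric] using det_laplacian_nonzero by simp
qed

end

lemma linear_fgff: "linear (fgff adj \<Lambda>)"
  using linear_gint[of \<Lambda>]
  by (simp add: linear_iff fgff_def gint_def[symmetric] algebra_simps add_divide_distrib)

section \<open>Sums over subsets, permutations and partitions\<close>

lemma sum_Pow_Un:
  assumes "finite S" "finite T" "S \<inter> T = {}"
  shows "(\<Sum>C\<in>Pow (S \<union> T). h C) = (\<Sum>A\<in>Pow S. \<Sum>D\<in>Pow T. h (A \<union> D))"
proof -
  have "(\<Sum>A\<in>Pow S. \<Sum>D\<in>Pow T. h (A \<union> D)) = (\<Sum>(A, D)\<in>Pow S \<times> Pow T. h (A \<union> D))"
    by (simp add: sum.cartesian_product)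
  also have "\<dots> = (\<Sum>C\<in>Pow (S \<union> T). h C)"
    by (rule sum.reindex_bij_witness[of _ "\<lambda>C. (C \<inter> S, C \<inter> T)" "\<lambda>(A, D). A \<union> D"])
      (use assms in \<open>auto 0 3\<close>)
  finally show ?thesis by simp
qed

text \<open>Choosing a subset of each of the disjoint sets \<open>F B\<close> is choosing one subset
  \<open>E\<close> of their union; the choices are recovered as
  \<open>E \<inter> F B\<close>.\<close>

lemma prod_sum_Pow:
  fixes g :: "'b \<Rightarrow> 'a set \<Rightarrow> 'c::comm_semiring_1"
  assumes "finite \<pi>" "\<And>B. B \<in> \<pi> \<Longrightarrow> finite (F B)" "disjoint_family_on F \<pi>"
  shows "(\<Prod>B\<in>\<pi>. \<Sum>E\<in>Pow (F B). g B E) = (\<Sum>E\<in>Pow (\<Union>B\<in>\<pi>. F B). \<Prod>B\<in>\<pi>. g B (E \<inter> F B))"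
  using assms
proof (induction \<pi>)
  case (insert B \<pi>)
  let ?U = "\<Union>B\<in>\<pi>. F B"
  have disj: "F B \<inter> F B' = {}" if "B' \<in> \<pi>" for B'
    using insert that unfolding disjoint_family_on_def by auto
  have "(\<Sum>E\<in>Pow (\<Union>B\<in>insert B \<pi>. F B). \<Prod>B\<in>insert B \<pi>. g B (E \<inter> F B)) =
      (\<Sum>A\<in>Pow (F B). \<Sum>D\<in>Pow ?U. \<Prod>B'\<in>insert B \<pi>. g B' ((A \<union> D) \<inter> F B'))"
    unfolding UN_insert by (rule sum_Pow_Un) (use insert disj in auto)
  also have "\<dots> = (\<Sum>A\<in>Pow (F B). \<Sum>D\<in>Pow ?U. g B A * (\<Prod>B'\<in>\<pi>. g B' (D \<inter> F B')))"
  proof (intro sum.cong refl)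
    fix A D assume A: "A \<in> Pow (F B)" and D: "D \<in> Pow ?U"
    have "(A \<union> D) \<inter> F B = A" using A D disj by blast
    moreover have "(\<Prod>B'\<in>\<pi>. g B' ((A \<union> D) \<inter> F B')) = (\<Prod>B'\<in>\<pi>. g B' (D \<inter> F B'))"
    proof (intro prod.cong refl)
      fix B' assume "B' \<in> \<pi>"
      then have "(A \<union> D) \<inter> F B' = D \<inter> F B'" using A disj[of B'] by blast
      then show "g B' ((A \<union> D) \<inter> F B') = g B' (D \<inter> F B')" by simp
    qed
    ultimately show "(\<Prod>B'\<in>insert B \<pi>. g B' ((A \<union> D) \<inter> F B')) = g B A * (\<Prod>B'\<in>\<pi>. g B' (D \<inter> F B'))"
      using insert.hyps by simp
  qed
  also have "\<dots> = (\<Sum>A\<in>Pow (F B). g B A) * (\<Sum>D\<in>Pow ?U. \<Prod>B'\<in>\<pi>. g B' (D \<inter> F B'))"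
    by (simp add: sum_product)
  also have "(\<Sum>D\<in>Pow ?U. \<Prod>B'\<in>\<pi>. g B' (D \<inter> F B')) = (\<Prod>B\<in>\<pi>. \<Sum>E\<in>Pow (F B). g B E)"
    using insert.prems by (intro insert.IH[symmetric]) (auto simp: disjoint_family_on_def)
  finally show ?case using insert.hyps by simp
qed simp

text \<open>By finiteness a permutation that maps \<open>S\<close> into itself maps it onto itself,
  hence keeps \<open>T\<close> as well and splits uniquely. The predicate \<open>R\<close> carries
  the conditions for the blocks not yet split off in \<open>prod_det_on\<close>.\<close>

lemma sum_permutes_split:
  assumes fin: "finite S" "finite T" and disj: "S \<inter> T = {}"
  shows "(\<Sum>\<sigma> | \<sigma> permutes S. \<Sum>\<rho> | \<rho> permutes T \<and> R \<rho>. g (\<sigma> \<circ> \<rho>)) =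
    (\<Sum>\<tau> | \<tau> permutes (S \<union> T) \<and> (\<forall>f\<in>S. \<tau> f \<in> S) \<and> R (restrict_id \<tau> T). g \<tau>)"
proof -
  have "(\<Sum>\<sigma> | \<sigma> permutes S. \<Sum>\<rho> | \<rho> permutes T \<and> R \<rho>. g (\<sigma> \<circ> \<rho>)) =
      (\<Sum>(\<sigma>, \<rho>)\<in>{\<sigma>. \<sigma> permutes S} \<times> {\<rho>. \<rho> permutes T \<and> R \<rho>}. g (\<sigma> \<circ> \<rho>))"
    by (simp add: sum.cartesian_product)
  also have "\<dots> = (\<Sum>\<tau> | \<tau> permutes (S \<union> T) \<and> (\<forall>f\<in>S. \<tau> f \<in> S) \<and> R (restrict_id \<tau> T). g \<tau>)"
  proof (rule sum.reindex_bij_witness[of _ "\<lambda>\<tau>. (restrict_id \<tau> S, restrict_id \<tau> T)" "\<lambda>(\<sigma>, \<rho>). \<sigma> \<circ> \<rho>"], goal_cases)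
    case (1 p)
    obtain \<sigma> \<rho> where p: "p = (\<sigma>, \<rho>)" by force
    with 1 have *: "\<sigma> permutes S" "\<rho> permutes T" by auto
    have "\<sigma> (\<rho> x) = \<sigma> x" if "x \<in> S" for x
    proof -
      have "x \<notin> T" using that disj by blast
      then show ?thesis using permutes_not_in[OF *(2)] by simp
    qed
    moreover have "\<sigma> (\<rho> x) = \<rho> x" if "x \<in> T" for x
    proof -
      have "\<rho> x \<notin> S" using permutes_in_image[OF *(2), of x] that disj by blast
      then show ?thesis using permutes_not_in[OF *(1)] by simp
    qed
    ultimately have "restrict_id (\<sigma> \<circ> \<rho>) S = \<sigma>" "restrict_id (\<sigma> \<circ> \<rho>) T = \<rho>"
      using permutes_not_in[OF *(1)] permutes_not_in[OF *(2)]
      by (auto simp: restrict_id_def fun_eq_iff)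
    then show ?case by (simp add: p)
  next
    case (2 p)
    obtain \<sigma> \<rho> where p: "p = (\<sigma>, \<rho>)" by force
    with 2 have *: "\<sigma> permutes S" "\<rho> permutes T" "R \<rho>" by auto
    have S: "\<sigma> (\<rho> x) = \<sigma> x" if "x \<in> S" for x
    proof -
      have "x \<notin> T" using that disj by blast
      then show ?thesis using permutes_not_in[OF *(2)] by simp
    qed
    have "\<sigma> (\<rho> x) = \<rho> x" if "x \<in> T" for x
    proof -
      have "\<rho> x \<notin> S" using permutes_in_image[OF *(2), of x] that disj by blast
      then show ?thesis using permutes_not_in[OF *(1)] by simp
    qed
    then have "restrict_id (\<sigma> \<circ> \<rho>) T = \<rho>"
      using permutes_not_in[OF *(2)] by (auto simp: restrict_id_def fun_eq_iff)
    moreover have "\<sigma> \<circ> \<rho> permutes (S \<union> T)"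
      using * by (intro permutes_compose) (auto intro: permutes_subset)
    moreover have "\<forall>f\<in>S. (\<sigma> \<circ> \<rho>) f \<in> S"
      using S permutes_in_image[OF *(1)] by auto
    ultimately show ?case using *(3) by (simp add: p)
  next
    case (3 \<tau>)
    then have \<tau>: "\<tau> permutes (S \<union> T)" "\<And>f. f \<in> S \<Longrightarrow> \<tau> f \<in> S" by auto
    have "\<tau> x \<in> T" if x: "x \<in> T" for x
    proof (rule ccontr)
      assume "\<tau> x \<notin> T"
      then have "\<tau> x \<in> S" using permutes_in_image[OF \<tau>(1), of x] x by auto
      moreover have "\<tau> ` S = S"
        using \<tau> fin permutes_inj[OF \<tau>(1)] by (intro card_subset_eq) (auto simp: card_image inj_on_def dest: injD)
      ultimately obtain y where "y \<in> S" "\<tau> x = \<tau> y" by auto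
      then show False using permutes_inj[OF \<tau>(1)] x disj by (auto dest: injD)
    qed
    then show ?case
      using permutes_not_in[OF \<tau>(1)] disj \<tau>(2) by (auto simp: restrict_id_def fun_eq_iff)
  next
    case (4 \<tau>)
    then have \<tau>: "\<tau> permutes (S \<union> T)" "\<And>f. f \<in> S \<Longrightarrow> \<tau> f \<in> S" "R (restrict_id \<tau> T)" by auto
    have inj: "inj_on \<tau> A" for A using permutes_inj[OF \<tau>(1)] inj_on_subset by blast
    have S: "\<tau> ` S = S"
      using \<tau> fin inj by (intro card_subset_eq) (auto simp: card_image)
    have "\<tau> ` T = T"
    proof -
      have "\<tau> ` T = \<tau> ` (S \<union> T - S)" using disj by (intro arg_cong[of _ _ "(`) \<tau>"]) auto
      also have "\<dots> = (S \<union> T) - S"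
        using image_set_diff[OF permutes_inj[OF \<tau>(1)], of "S \<union> T" S] S permutes_image[OF \<tau>(1)] by simp
      finally show ?thesis using disj by auto
    qed
    then show ?case using S inj \<tau>(3) by (auto simp: bij_betw_def intro!: permutes_restrict_id)
  qed auto
  finally show ?thesis .
qed

text \<open>A permutation of \<open>E\<close> that keeps every \<open>F B\<close> amounts to one
  permutation per block, and signs and products of entries multiply. The blocks are split off one at
  a time.\<close>

lemma prod_det_on:
  assumes "finite \<pi>" "finite E" "E \<subseteq> (\<Union>B\<in>\<pi>. F B)" "disjoint_family_on F \<pi>"
  shows "(\<Prod>B\<in>\<pi>. det_on (E \<inter> F B) M) =
    (\<Sum>\<tau> | \<tau> permutes E \<and> (\<forall>B\<in>\<pi>. \<forall>f\<in>E \<inter> F B. \<tau> f \<in> F B). of_int (sign \<tau>) * (\<Prod>f\<in>E. M f (\<tau> f)))"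
  using assms
proof (induction \<pi> arbitrary: E)
  case empty
  then have "{\<tau>. \<tau> permutes E \<and> (\<forall>B\<in>{}. \<forall>f\<in>E \<inter> F B. \<tau> f \<in> F B)} = {id}" by auto
  then show ?case using empty by simp
next
  case (insert B \<pi>)
  let ?S = "E \<inter> F B" and ?T = "E - F B"
  let ?R = "\<lambda>E \<tau>. \<forall>B\<in>\<pi>. \<forall>f\<in>E \<inter> F B. \<tau> f \<in> F B"
  let ?g = "\<lambda>E \<tau>. of_int (sign \<tau>) * (\<Prod>f\<in>E. M f (\<tau> f))"
  have disj: "F B \<inter> F B' = {}" if "B' \<in> \<pi>" for B'
    using insert that unfolding disjoint_family_on_def by auto
  have E: "?S \<union> ?T = E" "?S \<inter> ?T = {}" by auto
  have T: "?T \<inter> F B' = E \<inter> F B'" if "B' \<in> \<pi>" for B' using disj[OF that] by auto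
  have "(\<Prod>B\<in>insert B \<pi>. det_on (E \<inter> F B) M) = det_on ?S M * (\<Prod>B\<in>\<pi>. det_on (?T \<inter> F B) M)"
    using insert.hyps T by (simp cong: prod.cong)
  also have "(\<Prod>B\<in>\<pi>. det_on (?T \<inter> F B) M) = (\<Sum>\<rho> | \<rho> permutes ?T \<and> ?R ?T \<rho>. ?g ?T \<rho>)"
    using insert.prems by (intro insert.IH) (auto simp: disjoint_family_on_def)
  also have "det_on ?S M * \<dots> =
      (\<Sum>\<sigma> | \<sigma> permutes ?S. \<Sum>\<rho> | \<rho> permutes ?T \<and> ?R ?T \<rho>. ?g ?S \<sigma> * ?g ?T \<rho>)"
    unfolding det_on_def by (rule sum_product)
  also have "\<dots> = (\<Sum>\<sigma> | \<sigma> permutes ?S. \<Sum>\<rho> | \<rho> permutes ?T \<and> ?R ?T \<rho>. ?g E (\<sigma> \<circ> \<rho>))"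
  proof (intro sum.cong refl)
    fix \<sigma> \<rho> assume "\<sigma> \<in> {\<sigma>. \<sigma> permutes ?S}" "\<rho> \<in> {\<rho>. \<rho> permutes ?T \<and> ?R ?T \<rho>}"
    then have *: "\<sigma> permutes ?S" "\<rho> permutes ?T" by auto
    have "permutation \<sigma>" "permutation \<rho>"
      using * insert.prems(1) by (auto simp: permutation_permutes intro: exI[of _ ?S] exI[of _ ?T])
    then have "sign (\<sigma> \<circ> \<rho>) = sign \<sigma> * sign \<rho>" by (rule sign_compose)
    moreover have "(\<Prod>f\<in>E. M f ((\<sigma> \<circ> \<rho>) f)) = (\<Prod>f\<in>?S. M f (\<sigma> f)) * (\<Prod>f\<in>?T. M f (\<rho> f))"
    proof -
      have "(\<Prod>f\<in>E. M f ((\<sigma> \<circ> \<rho>) f)) = (\<Prod>f\<in>?S. M f ((\<sigma> \<circ> \<rho>) f)) * (\<Prod>f\<in>?T. M f ((\<sigma> \<circ> \<rho>) f))"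
        using prod.union_disjoint[of ?S ?T] insert.prems(1) E by (metis finite_Diff finite_Int)
      also have "(\<Prod>f\<in>?S. M f ((\<sigma> \<circ> \<rho>) f)) = (\<Prod>f\<in>?S. M f (\<sigma> f))"
        using permutes_not_in[OF *(2)] by (intro prod.cong) auto
      also have "(\<Prod>f\<in>?T. M f ((\<sigma> \<circ> \<rho>) f)) = (\<Prod>f\<in>?T. M f (\<rho> f))"
      proof (intro prod.cong refl)
        fix f assume "f \<in> ?T"
        then have "\<rho> f \<notin> ?S" using permutes_in_image[OF *(2), of f] by auto
        then show "M f ((\<sigma> \<circ> \<rho>) f) = M f (\<rho> f)" using permutes_not_in[OF *(1)] by simp
      qed
      finally show ?thesis .
    qed
    ultimately show "?g ?S \<sigma> * ?g ?T \<rho> = ?g E (\<sigma> \<circ> \<rho>)" by simp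
  qed
  also have "\<dots> = (\<Sum>\<tau> | \<tau> permutes (?S \<union> ?T) \<and> (\<forall>f\<in>?S. \<tau> f \<in> ?S) \<and> ?R ?T (restrict_id \<tau> ?T). ?g E \<tau>)"
    by (rule sum_permutes_split) (use insert.prems(1) in auto)
  also have "{\<tau>. \<tau> permutes (?S \<union> ?T) \<and> (\<forall>f\<in>?S. \<tau> f \<in> ?S) \<and> ?R ?T (restrict_id \<tau> ?T)} =
      {\<tau>. \<tau> permutes E \<and> (\<forall>B\<in>insert B \<pi>. \<forall>f\<in>E \<inter> F B. \<tau> f \<in> F B)}"
  proof -
    have "(\<forall>f\<in>?S. \<tau> f \<in> ?S) \<longleftrightarrow> (\<forall>f\<in>?S. \<tau> f \<in> F B)" if "\<tau> permutes E" for \<tau>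
      using permutes_in_image[OF that] by auto
    moreover have "?R ?T (restrict_id \<tau> ?T) \<longleftrightarrow> ?R E \<tau>" for \<tau>
    proof (intro ball_cong refl)
      fix B' f assume "B' \<in> \<pi>"
      show "?T \<inter> F B' = E \<inter> F B'" using T \<open>B' \<in> \<pi>\<close> .
      assume "f \<in> E \<inter> F B'"
      then have "f \<in> ?T" using T[OF \<open>B' \<in> \<pi>\<close>] by auto
      then show "restrict_id \<tau> ?T f \<in> F B' \<longleftrightarrow> \<tau> f \<in> F B'" by simp
    qed
    ultimately show ?thesis unfolding E(1) by auto
  qed
  finally show ?case .
qed

section \<open>The alternating sum over partitions\<close>

text \<open>The Moebius function of the partition lattice, from a partition with \<open>m\<close>
  blocks up to the partition with one block.\<close>

definition moebius_weight :: "nat \<Rightarrow> real" where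
  "moebius_weight m = fact (m - 1) * (-1) ^ (m - 1)"

lemma moebius_weight_Suc: "m > 0 \<Longrightarrow> moebius_weight (Suc m) + real m * moebius_weight m = 0"
  by (cases m) (auto simp: moebius_weight_def fact_Suc algebra_simps)

text \<open>
  Restricting a partition to \<open>V - C\<close> gives a partition \<open>\<sigma>\<close> into \<open>m\<close> blocks, and \<open>\<sigma>\<close> arises from
  exactly \<open>m + 1\<close> partitions: \<open>C\<close> is either a block of its own (\<open>X = {}\<close> below) or joined to a block
  \<open>X\<close> of \<open>\<sigma>\<close>.  By \<open>moebius_weight_Suc\<close> the weights of these partitions cancel.
\<close>

lemma sum_partitions_closed_0:
  assumes fin: "finite V" and C: "C \<subseteq> V" "C \<noteq> {}" "C \<noteq> V" "Q C"
    and meet: "\<And>B. B \<subseteq> V \<Longrightarrow> Q B \<Longrightarrow> C \<subseteq> B \<or> C \<inter> B = {}"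
    and join: "\<And>B. B \<subseteq> V - C \<Longrightarrow> Q (B \<union> C) \<longleftrightarrow> Q B"
  shows "(\<Sum>\<pi> | partition_on V \<pi> \<and> (\<forall>B\<in>\<pi>. Q B). moebius_weight (card \<pi>)) = 0"
proof -
  let ?P = "{\<sigma>. partition_on (V - C) \<sigma> \<and> (\<forall>B\<in>\<sigma>. Q B)}"
  let ?i = "\<lambda>(\<sigma>, X). insert (X \<union> C) (\<sigma> - {X})"
  \<comment> \<open>\<open>?b\<close> is the block that contains \<open>C\<close>, unique by
    \<open>block\<close> below; \<open>?j\<close> takes \<open>C\<close> out of it and drops the
    block if nothing is left.\<close>
  let ?b = "\<lambda>\<pi>. \<Union>{B\<in>\<pi>. C \<subseteq> B}"
  let ?j = "\<lambda>\<pi>. ((\<pi> - {?b \<pi>}) \<union> ({?b \<pi> - C} - {{}}), ?b \<pi> - C)"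
  have finP: "finite ?P" using finitely_many_partition_on[of "V - C"] fin by auto
  have fin\<sigma>: "finite \<sigma>" if "\<sigma> \<in> ?P" for \<sigma> using finite_elements[of "V - C" \<sigma>] fin that by auto
  have \<sigma>D: "B \<subseteq> V" "B \<inter> C = {}" "B \<noteq> {}" "B' \<in> \<sigma> \<Longrightarrow> B \<noteq> B' \<Longrightarrow> B \<inter> B' = {}" "Q B"
    if "\<sigma> \<in> ?P" "B \<in> \<sigma>" for \<sigma> B B'
    using that by (auto simp: partition_on_def disjoint_def)
  have block: "\<exists>B. B \<in> \<pi> \<and> C \<subseteq> B \<and> ?b \<pi> = B \<and> (\<forall>B'\<in>\<pi>. B' \<noteq> B \<longrightarrow> B' \<inter> B = {})"
    if \<pi>: "partition_on V \<pi>" "\<forall>B\<in>\<pi>. Q B" for \<pi>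
  proof -
    have disj: "\<And>B B'. B \<in> \<pi> \<Longrightarrow> B' \<in> \<pi> \<Longrightarrow> B \<noteq> B' \<Longrightarrow> B \<inter> B' = {}" "\<Union>\<pi> = V"
      using \<pi> by (auto simp: partition_on_def disjoint_def)
    obtain c where "c \<in> C" using C by auto
    then obtain B where B: "B \<in> \<pi>" "c \<in> B" using C(1) disj(2) by blast
    then have "C \<subseteq> B" using meet[of B] \<pi>(2) \<open>c \<in> C\<close> disj(2) by blast
    moreover have "B' = B" if "B' \<in> \<pi>" "C \<subseteq> B'" for B'
      using disj(1)[of B' B] that B \<open>c \<in> C\<close> by blast
    then have "{B\<in>\<pi>. C \<subseteq> B} = {B}" using B \<open>C \<subseteq> B\<close> by blast
    ultimately show ?thesis using B disj(1) by (intro exI[of _ B]) auto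
  qed
  have "(\<Sum>\<pi> | partition_on V \<pi> \<and> (\<forall>B\<in>\<pi>. Q B). moebius_weight (card \<pi>)) =
      (\<Sum>p\<in>(SIGMA \<sigma>:?P. insert {} \<sigma>). moebius_weight (card (?i p)))"
  proof (rule sum.reindex_bij_witness[of _ ?i ?j], goal_cases)
    case (1 \<pi>)
    then have "partition_on V \<pi>" "\<forall>B\<in>\<pi>. Q B" by auto
    from block[OF this] obtain B
      where B: "B \<in> \<pi>" "C \<subseteq> B" "?b \<pi> = B" "\<forall>B'\<in>\<pi>. B' \<noteq> B \<longrightarrow> B' \<inter> B = {}"
      by (elim exE conjE)
    \<comment> \<open>If \<open>B - C\<close> were another block of \<pi>, then \<open>?i\<close>
      would delete that block as well.\<close>
    have "B - C \<notin> \<pi> - {B}"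
    proof
      assume "B - C \<in> \<pi> - {B}"
      then have "B - C \<in> \<pi>" "B - C \<noteq> B" by simp_all
      then have "(B - C) \<inter> B = {}" by (rule B(4)[rule_format])
      then have "B - C = {}" by auto
      with \<open>B - C \<in> \<pi>\<close> have "{} \<in> \<pi>" by simp
      then show False using \<open>partition_on V \<pi>\<close> by (simp add: partition_on_def)
    qed
    moreover have "B - C \<union> C = B" using B by auto
    ultimately show ?case unfolding B(3) using B(1) by auto
  next
    case (2 \<pi>)
    then have "partition_on V \<pi>" "\<forall>B\<in>\<pi>. Q B" by auto
    from block[OF this] obtain B
      where B: "B \<in> \<pi>" "C \<subseteq> B" "?b \<pi> = B" "\<forall>B'\<in>\<pi>. B' \<noteq> B \<longrightarrow> B' \<inter> B = {}"
      by (elim exE conjE)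
    have \<pi>: "\<Union>\<pi> = V" "\<And>B B'. B \<in> \<pi> \<Longrightarrow> B' \<in> \<pi> \<Longrightarrow> B \<noteq> B' \<Longrightarrow> B \<inter> B' = {}" "{} \<notin> \<pi>" "\<And>B. B \<in> \<pi> \<Longrightarrow> Q B"
      using 2 by (auto simp: partition_on_def disjoint_def)
    have "B - C \<subseteq> V - C" "(B - C) \<union> C = B" using B \<pi>(1) by auto
    then have QB: "Q (B - C)" using join[of "B - C"] \<pi>(4)[OF B(1)] by simp
    have "\<Union>((\<pi> - {B}) \<union> ({B - C} - {{}})) = V - C"
    proof -
      have "\<Union>(\<pi> - {B}) = V - B" using \<pi>(1,2) B(1) by blast
      moreover have "\<Union>({B - C} - {{}}) = B - C" by auto
      moreover have "B \<subseteq> V" using \<pi>(1) B(1) by blast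
      ultimately show ?thesis using B(2) by (simp only: Union_Un_distrib) blast
    qed
    moreover have "disjoint ((\<pi> - {B}) \<union> ({B - C} - {{}}))"
      unfolding disjoint_def using \<pi>(2) B(1,4) by blast
    ultimately have "partition_on (V - C) ((\<pi> - {B}) \<union> ({B - C} - {{}}))"
      using \<pi>(3) by (auto simp: partition_on_def)
    then show ?case unfolding B(3) using QB \<pi>(4) by auto
  next
    case (3 p)
    obtain \<sigma> X where p: "p = (\<sigma>, X)" by force
    with 3 have \<sigma>: "\<sigma> \<in> ?P" and X: "X = {} \<or> X \<in> \<sigma>" by auto
    have XC: "X \<inter> C = {}" using X \<sigma>D(2)[OF \<sigma>] by auto
    have b: "?b (insert (X \<union> C) (\<sigma> - {X})) = X \<union> C"
    proof -
      have "\<not> C \<subseteq> B" if "B \<in> \<sigma>" for B using \<sigma>D(2)[OF \<sigma> that] C(2) by blast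
      then have "{B \<in> insert (X \<union> C) (\<sigma> - {X}). C \<subseteq> B} = {X \<union> C}" by auto
      then show ?thesis by simp
    qed
    have n: "X \<union> C \<notin> \<sigma>" using \<sigma>D(2)[OF \<sigma>, of "X \<union> C"] C(2) by blast
    have e: "X \<union> C - C = X" using XC by auto
    have n0: "{} \<notin> \<sigma>" using \<sigma>D(3)[OF \<sigma>] by blast
    show ?case unfolding p prod.case b e using n n0 X by auto
  next
    case (4 p)
    obtain \<sigma> X where p: "p = (\<sigma>, X)" by force
    with 4 have \<sigma>: "\<sigma> \<in> ?P" and X: "X = {} \<or> X \<in> \<sigma>" by auto
    have U: "\<Union>\<sigma> = V - C" using \<sigma> by (auto simp: partition_on_def)
    have QX: "Q (X \<union> C)"
    proof (cases "X = {}")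
      case False
      then have "X \<subseteq> V - C" "Q X" using X U \<sigma>D(5)[OF \<sigma>] by auto
      then show ?thesis using join by simp
    qed (use C in simp)
    have "\<Union>(insert (X \<union> C) (\<sigma> - {X})) = V"
      using U C(1) X by blast
    moreover have "disjoint (insert (X \<union> C) (\<sigma> - {X}))"
      unfolding disjoint_def using X \<sigma>D(2,4)[OF \<sigma>] by blast
    moreover have "{} \<notin> insert (X \<union> C) (\<sigma> - {X})" using C(2) \<sigma>D(3)[OF \<sigma>] by blast
    ultimately show ?case
      unfolding p using QX \<sigma> by (auto simp: partition_on_def)
  next
    case (5 \<pi>)
    then have "partition_on V \<pi>" "\<forall>B\<in>\<pi>. Q B" by auto
    from block[OF this] obtain B
      where B: "B \<in> \<pi>" "C \<subseteq> B" "?b \<pi> = B" "\<forall>B'\<in>\<pi>. B' \<noteq> B \<longrightarrow> B' \<inter> B = {}"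
      by (elim exE conjE)
    have "B - C \<notin> \<pi> - {B}"
    proof
      assume "B - C \<in> \<pi> - {B}"
      then have "B - C \<in> \<pi>" "B - C \<noteq> B" by simp_all
      then have "(B - C) \<inter> B = {}" by (rule B(4)[rule_format])
      then have "B - C = {}" by auto
      with \<open>B - C \<in> \<pi>\<close> have "{} \<in> \<pi>" by simp
      then show False using \<open>partition_on V \<pi>\<close> by (simp add: partition_on_def)
    qed
    moreover have "B - C \<union> C = B" using B by auto
    ultimately have "?i (?j \<pi>) = \<pi>" unfolding B(3) using B(1) by auto
    then show ?case by simp
  qed
  also have "\<dots> = (\<Sum>\<sigma>\<in>?P. \<Sum>X\<in>insert {} \<sigma>. moebius_weight (card (insert (X \<union> C) (\<sigma> - {X}))))"
    using finP fin\<sigma> by (subst sum.Sigma) (auto intro!: sum.cong)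
  also have "\<dots> = 0"
  proof (rule sum.neutral, rule ballI)
    fix \<sigma> assume \<sigma>: "\<sigma> \<in> ?P"
    have n0: "{} \<notin> \<sigma>" using \<sigma>D(3)[OF \<sigma>] by blast
    have n: "X \<union> C \<notin> \<sigma>" for X using \<sigma>D(2)[OF \<sigma>, of "X \<union> C"] C(2) by blast
    \<comment> \<open>This is where \<open>C \<noteq> V\<close> enters: the cancellation fails for 0
      blocks.\<close>
    have "\<sigma> \<noteq> {}" using \<sigma> C by (auto simp: partition_on_def)
    then have "card \<sigma> > 0" using fin\<sigma>[OF \<sigma>] by (simp add: card_gt_0_iff)
    have "card (insert (X \<union> C) (\<sigma> - {X})) = card \<sigma>" if "X \<in> \<sigma>" for X
      using that n[of X] fin\<sigma>[OF \<sigma>] \<open>card \<sigma> > 0\<close> by (simp add: card_insert_if card_Diff_singleton)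
    then have "(\<Sum>X\<in>insert {} \<sigma>. moebius_weight (card (insert (X \<union> C) (\<sigma> - {X})))) =
        moebius_weight (Suc (card \<sigma>)) + real (card \<sigma>) * moebius_weight (card \<sigma>)"
      using fin\<sigma>[OF \<sigma>] n0 n[of "{}"] by simp
    then show "(\<Sum>X\<in>insert {} \<sigma>. moebius_weight (card (insert (X \<union> C) (\<sigma> - {X})))) = 0"
      using moebius_weight_Suc[OF \<open>card \<sigma> > 0\<close>] by simp
  qed
  finally show ?thesis .
qed

text \<open>If \<open>R\<close> connects \<open>V\<close>, only the partition \<open>{V}\<close>
  remains, with weight 1. Otherwise the component \<open>C\<close> of some vertex is a proper
  subset, and by symmetry of \<open>R\<close> every closed set contains \<open>C\<close> or misses
  it, so that the cancellation applies.\<close>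

lemma sum_partitions_closed:
  assumes fin: "finite V" "V \<noteq> {}" and sym: "\<And>a b. R a b \<Longrightarrow> R b a" and R: "\<And>a b. R a b \<Longrightarrow> b \<in> V"
  shows "(\<Sum>\<pi> | partition_on V \<pi> \<and> (\<forall>B\<in>\<pi>. \<forall>a\<in>B. \<forall>b. R a b \<longrightarrow> b \<in> B). moebius_weight (card \<pi>)) =
    (if \<forall>v\<in>V. \<forall>w\<in>V. R\<^sup>*\<^sup>* v w then 1 else 0)"
proof -
  let ?Q = "\<lambda>B. \<forall>a\<in>B. \<forall>b. R a b \<longrightarrow> b \<in> B"
  have reach: "w \<in> B" if "R\<^sup>*\<^sup>* v w" "v \<in> B" "?Q B" for v w B
    using that by induction auto
  show ?thesis
  proof (cases "\<forall>v\<in>V. \<forall>w\<in>V. R\<^sup>*\<^sup>* v w")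
    case True
    have "{\<pi>. partition_on V \<pi> \<and> (\<forall>B\<in>\<pi>. ?Q B)} = {{V}}"
    proof (intro equalityI subsetI)
      fix \<pi> assume "\<pi> \<in> {\<pi>. partition_on V \<pi> \<and> (\<forall>B\<in>\<pi>. ?Q B)}"
      then have \<pi>: "partition_on V \<pi>" "\<And>B. B \<in> \<pi> \<Longrightarrow> ?Q B" by auto
      have "B = V" if "B \<in> \<pi>" for B
      proof -
        have "B \<subseteq> V" "B \<noteq> {}" using \<pi>(1) that by (auto simp: partition_on_def)
        then show ?thesis using reach[OF _ _ \<pi>(2)[OF that]] True by blast
      qed
      moreover have "\<pi> \<noteq> {}" using \<pi>(1) fin by (auto simp: partition_on_def)
      ultimately show "\<pi> \<in> {{V}}" by auto
    qed (use fin R in \<open>auto intro: partition_on_space\<close>)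
    then show ?thesis using True by (simp add: moebius_weight_def)
  next
    case False
    then obtain v w where vw: "v \<in> V" "w \<in> V" "\<not> R\<^sup>*\<^sup>* v w" by auto
    define C where "C = {u. R\<^sup>*\<^sup>* v u}"
    have "symp R\<^sup>*\<^sup>*" using sym by (intro symp_rtranclp) (auto simp: symp_def)
    have converse: "R\<^sup>*\<^sup>* u v" if "u \<in> C" for u
      using that \<open>symp R\<^sup>*\<^sup>*\<close> by (auto simp: C_def dest: sympD)
    have "(\<Sum>\<pi> | partition_on V \<pi> \<and> (\<forall>B\<in>\<pi>. ?Q B). moebius_weight (card \<pi>)) = 0"
    proof (rule sum_partitions_closed_0[where C = C])
      show "C \<subseteq> V" using reach[of v _ V] vw R by (auto simp: C_def)
      show "C \<noteq> {}" "C \<noteq> V" using vw by (auto simp: C_def)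
      show "?Q C" by (auto simp: C_def intro: rtranclp.rtrancl_into_rtrancl)
    next
      fix B assume B: "B \<subseteq> V" "?Q B"
      show "C \<subseteq> B \<or> C \<inter> B = {}"
      proof (rule disjCI)
        assume "C \<inter> B \<noteq> {}"
        then obtain u where "u \<in> C" "u \<in> B" by auto
        then have "v \<in> B" using reach[OF converse _ B(2)] by auto
        then show "C \<subseteq> B" using reach[OF _ _ B(2)] by (auto simp: C_def)
      qed
    next
      fix B assume B: "B \<subseteq> V - C"
      have C: "b \<in> C" if "a \<in> C" "R a b" for a b
        using that by (auto simp: C_def intro: rtranclp.rtrancl_into_rtrancl)
      show "?Q (B \<union> C) \<longleftrightarrow> ?Q B"
        using B C sym by blast
    qed (use fin in auto)
    then show ?thesis using False by simp
  qed
qed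

section \<open>The cumulants of the fields\<close>

text \<open>Since \<open>z e * (1 - z e) = z e\<close>, the factors with \<open>e \<in> E\<close>
  are absorbed by the first product; the remaining ones are expanded.\<close>

lemma cprod_mult_cprod_one_minus:
  assumes N: "finite N" "E \<subseteq> N" and c: "\<And>e. e \<in> N \<Longrightarrow> central (z e)"
    and sq: "\<And>e. e \<in> N \<Longrightarrow> z e * z e = (0 :: 'a::real_algebra_1)"
  shows "cprod z E * cprod (\<lambda>e. 1 - z e) N =
    (\<Sum>A\<in>Pow (N - E). (-1) ^ card A *\<^sub>R cprod z (E \<union> A))"
proof -
  have finE: "finite E" using N finite_subset by auto
  have cE: "cprod z E * cprod (\<lambda>e. 1 - z e) E = cprod z E"
    using finE N(2)
  proof (induction E)
    case (insert e E)
    have ce: "central (z e)" "\<And>x. x \<in> E \<Longrightarrow> central (z x)" using insert.prems c by auto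
    have "cprod z (insert e E) * cprod (\<lambda>e. 1 - z e) (insert e E) =
        z e * (cprod z E * (1 - z e)) * cprod (\<lambda>e. 1 - z e) E"
      using insert.hyps ce by (simp add: cprod_insert_central central_diff mult.assoc)
    also have "cprod z E * (1 - z e) = (1 - z e) * cprod z E"
      using ce by (intro centralD[symmetric] central_diff) auto
    also have "z e * ((1 - z e) * cprod z E) = z e * cprod z E"
    proof -
      have "z e * (1 - z e) = z e" using sq[of e] insert.prems by (simp add: right_diff_distrib)
      then show ?thesis by (simp flip: mult.assoc)
    qed
    also have "z e * cprod z E * cprod (\<lambda>e. 1 - z e) E = cprod z (insert e E)"
      using insert ce by (simp add: cprod_insert_central mult.assoc)
    finally show ?case .
  qed simp
  have "N = E \<union> (N - E)" using N by auto
  then have "cprod (\<lambda>e. 1 - z e) N = cprod (\<lambda>e. 1 - z e) (E \<union> (N - E))" by simp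
  also have "\<dots> = cprod (\<lambda>e. 1 - z e) E * cprod (\<lambda>e. 1 - z e) (N - E)"
    using N c finE by (intro cprod_Un_central) (auto intro!: central_diff)
  finally have "cprod z E * cprod (\<lambda>e. 1 - z e) N = cprod z E * cprod (\<lambda>e. 1 + - z e) (N - E)"
    by (simp add: cE flip: mult.assoc)
  also have "cprod (\<lambda>e. 1 + - z e) (N - E) = (\<Sum>A\<in>Pow (N - E). cprod (\<lambda>e. - z e) A)"
    using N c by (intro cprod_one_plus) (auto intro: central_uminus)
  also have "cprod z E * \<dots> = (\<Sum>A\<in>Pow (N - E). cprod z E * cprod (\<lambda>e. - z e) A)"
    by (simp add: sum_distrib_left)
  also have "\<dots> = (\<Sum>A\<in>Pow (N - E). (-1) ^ card A *\<^sub>R cprod z (E \<union> A))"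
  proof (rule sum.cong)
    fix A assume A: "A \<in> Pow (N - E)"
    then have subA: "A \<subseteq> N" and finA: "finite A" using finite_subset[of A N] N by auto
    have "cprod (\<lambda>e. - z e) A = (-1) ^ card A *\<^sub>R cprod z A"
      using finA subA
    proof (induction A)
      case (insert e A)
      then show ?case
        using c by (simp add: cprod_insert_central central_uminus subset_iff)
    qed simp
    moreover have "cprod z (E \<union> A) = cprod z E * cprod z A"
      using A finA finE N c by (intro cprod_Un_central) auto
    ultimately show "cprod z E * cprod (\<lambda>e. - z e) A = (-1) ^ card A *\<^sub>R cprod z (E \<union> A)"
      by simp
  qed simp
  finally show ?thesis .
qed

text \<open>The origin of the coefficient K: a set \<open>C = E \<union> A\<close> arises once for
  each of its subsets \<open>E\<close> of size \<open>k\<close>, which gives the binomial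
  coefficient, and the sign of \<open>A\<close> is \<open>(-1) ^ k * (-1) ^ card C\<close>.\<close>

lemma sum_card_subsets_Diff:
  fixes h :: "'v set set \<Rightarrow> 'b::real_vector"
  assumes N: "finite N"
  shows "(\<Sum>E | E \<subseteq> N \<and> card E = k. \<Sum>A\<in>Pow (N - E). (-1) ^ card A *\<^sub>R h (E \<union> A)) =
    (-1) ^ k *\<^sub>R (\<Sum>C\<in>Pow N. K_single k C *\<^sub>R h C)"
proof -
  have fin: "finite {E. E \<subseteq> N \<and> card E = k}" if "finite N" for N :: "'v set set"
    using that by auto
  have "(\<Sum>E | E \<subseteq> N \<and> card E = k. \<Sum>A\<in>Pow (N - E). (-1) ^ card A *\<^sub>R h (E \<union> A)) =
      (\<Sum>(E, A)\<in>(SIGMA E:{E. E \<subseteq> N \<and> card E = k}. Pow (N - E)). (-1) ^ card A *\<^sub>R h (E \<union> A))"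
    using N fin by (subst sum.Sigma) auto
  also have "\<dots> = (\<Sum>(C, E)\<in>(SIGMA C:Pow N. {E. E \<subseteq> C \<and> card E = k}). ((-1) ^ k * (-1) ^ card C) *\<^sub>R h C)"
  proof (rule sum.reindex_bij_witness[of _ "\<lambda>(C, E). (E, C - E)" "\<lambda>(E, A). (E \<union> A, E)"], goal_cases)
    case (5 p)
    obtain E A where p: "p = (E, A)" by force
    with 5 have EA: "E \<subseteq> N" "card E = k" "A \<subseteq> N" "E \<inter> A = {}" by auto
    then have "card (E \<union> A) = k + card A"
      using N by (subst card_Un_disjoint) (auto intro: finite_subset)
    then have "(-1) ^ k * (-1) ^ card (E \<union> A) = ((-1) ^ card A :: real)"
      by (simp add: power_add flip: mult.assoc power_mult_distrib)
    then show ?case by (simp add: p)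
  qed auto
  also have "\<dots> = (\<Sum>C\<in>Pow N. \<Sum>E | E \<subseteq> C \<and> card E = k. ((-1) ^ k * (-1) ^ card C) *\<^sub>R h C)"
    using N fin finite_subset[OF _ N] by (subst sum.Sigma) auto
  also have "\<dots> = (\<Sum>C\<in>Pow N. (-1) ^ k *\<^sub>R (K_single k C *\<^sub>R h C))"
  proof (intro sum.cong refl)
    fix C assume "C \<in> Pow N"
    then have "card {E. E \<subseteq> C \<and> card E = k} = card C choose k"
      using N by (intro n_subsets) (auto intro: finite_subset)
    then show "(\<Sum>E | E \<subseteq> C \<and> card E = k. ((-1) ^ k * (-1) ^ card C) *\<^sub>R h C) =
        (-1) ^ k *\<^sub>R (K_single k C *\<^sub>R h C)"
      by (simp add: K_single_def sum_constant_scaleR mult_ac)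
  qed
  finally show ?thesis by (simp add: scaleR_sum_right)
qed

lemma zeta_central_nilpotent:
  assumes "e \<in> edges_at adj v"
  shows "central (zeta \<Lambda> e)" "zeta \<Lambda> e * zeta \<Lambda> e = 0"
proof -
  obtain w where e: "e = {v, w}" using assms by (auto simp: edges_at_def)
  have "psi \<Lambda> w - psi \<Lambda> v \<in> gforms" "psibar \<Lambda> w - psibar \<Lambda> v \<in> gforms"
    by (auto simp: psi_def psibar_def span_diff span_zero span_neg)
  then show "central (zeta \<Lambda> e)" "zeta \<Lambda> e * zeta \<Lambda> e = 0"
    unfolding e zeta_orientation by (auto intro: central_gform_mult gform_pair_nilpotent)
qed

lemma X_times_Y:
  assumes "finite (edges_at adj v)"
  shows "X_field adj \<Lambda> k v * Y_field adj \<Lambda> v =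
    (-1) ^ k *\<^sub>R (\<Sum>C\<in>Pow (edges_at adj v). K_single k C *\<^sub>R cprod (zeta \<Lambda>) C)"
  unfolding X_field_def Y_field_def sum_distrib_right
  using assms
  by (simp add: cprod_mult_cprod_one_minus zeta_central_nilpotent flip: sum_card_subsets_Diff)

lemma edges_at_finite:
  assumes "conn_lf_graph L adj" "v \<in> L"
  shows "finite (edges_at adj v)"
proof -
  have "edges_at adj v = (\<lambda>w. {v, w}) ` {w. adj v w}" by (auto simp: edges_at_def)
  then show ?thesis using conn_lf_graphD(5)[OF assms] by simp
qed

section \<open>Good sets and the expansion of the cumulant\<close>

context
  fixes L :: "'v set" and adj and \<Lambda> V and k :: "'v \<Rightarrow> nat"
  assumes graph: "conn_lf_graph L adj" and fin: "finite \<Lambda>" and sub: "\<Lambda> \<subset> L"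
    and V: "good adj \<Lambda> V"
begin

private abbreviation (input) "N \<equiv> edges_at adj"
private abbreviation (input) "F \<equiv> edges_of adj"
private abbreviation (input) "Z \<equiv> \<lambda>v. X_field adj \<Lambda> (k v) v * Y_field adj \<Lambda> v"

lemma V_props: "V \<subseteq> \<Lambda>" "finite V" "V \<subseteq> L"
  using V fin sub by (auto simp: good_def intro: finite_subset)

text \<open>Goodness of \<open>V\<close> enters here: the other endpoint of an edge at a vertex of
  \<open>V\<close> lies outside \<open>V\<close>.\<close>

lemma edges_at_props:
  assumes "v \<in> V"
  shows "finite (N v)" "\<And>w. w \<in> V \<Longrightarrow> f \<in> N v \<Longrightarrow> f \<in> N w \<Longrightarrow> v = w"
    "\<And>f. f \<in> N v \<Longrightarrow> tail V f = v"
proof -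
  show "finite (N v)" using edges_at_finite[OF graph] assms V_props by auto
  have *: "f = {v, w} \<and> w \<notin> V" if "f \<in> N v" "f = {v, w}" "v \<in> V" "adj v w" for v w f
    using that V by (auto simp: good_def)
  show "tail V f = v" if f: "f \<in> N v" for f
  proof -
    obtain w where "f = {v, w}" "adj v w" using f by (auto simp: edges_at_def)
    moreover from this have "w \<notin> V" using V assms by (auto simp: good_def)
    ultimately show ?thesis using tail_head(1)[OF assms] by simp
  qed
  show "v = w" if w: "w \<in> V" "f \<in> N v" "f \<in> N w" for w
  proof -
    obtain a where "f = {v, a}" "adj v a" using w(2) by (auto simp: edges_at_def)
    moreover obtain b where "f = {w, b}" using w(3) by (auto simp: edges_at_def)
    ultimately have "a \<notin> V" "w \<in> {v, a}" using V assms by (auto simp: good_def)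
    then show ?thesis using w by auto
  qed
qed

lemma edges_with_tail_eq:
  assumes "\<E> \<subseteq> F V" "v \<in> V"
  shows "edges_with_tail V \<E> v = \<E> \<inter> N v"
  using assms edges_at_props(3) unfolding edges_with_tail_def edges_of_def by blast

lemma finite_edges_of: "B \<subseteq> V \<Longrightarrow> finite (F B)"
  using edges_at_props(1) V_props(2) unfolding edges_of_def by (auto intro: finite_subset)

text \<open>The sets \<open>N v\<close> are disjoint, so a choice of edges at each vertex of
  \<open>B\<close> is a single subset of \<open>F B\<close>, and the product of the fields stays a
  sum over edge sets.\<close>

lemma cprod_fields:
  assumes "B \<subseteq> V"
  shows "cprod Z B = (-1) ^ (\<Sum>v\<in>B. k v) *\<^sub>R
    (\<Sum>\<E>\<in>Pow (F B). (\<Prod>v\<in>B. K_single (k v) (\<E> \<inter> N v)) *\<^sub>R cprod (zeta \<Lambda>) \<E>)"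
proof -
  have "finite B" using assms V_props(2) finite_subset by auto
  then show ?thesis using assms
  proof (induction B)
    case empty
    then show ?case by (simp add: edges_of_def)
  next
    case (insert v B)
    let ?K = "\<lambda>v \<E>. K_single (k v) (\<E> \<inter> N v)" and ?\<zeta> = "cprod (zeta \<Lambda>)"
    have vV: "v \<in> V" and BV: "B \<subseteq> V" using insert.prems by auto
    have finF: "finite (F B)" by (rule finite_edges_of[OF BV])
    have disj: "N v \<inter> F B = {}"
      using edges_at_props(2)[OF vV] insert.hyps BV unfolding edges_of_def by blast
    have Z: "Z v = (-1) ^ k v *\<^sub>R (\<Sum>C\<in>Pow (N v). K_single (k v) C *\<^sub>R ?\<zeta> C)"
      by (rule X_times_Y) (rule edges_at_props(1)[OF vV])
    have "cprod Z (insert v B) = Z v * cprod Z B"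
      by (rule cprod_insert) (use insert.hyps fields_commute in auto)
    also have "\<dots> = (-1) ^ (\<Sum>v\<in>insert v B. k v) *\<^sub>R
        (\<Sum>C\<in>Pow (N v). \<Sum>\<E>\<in>Pow (F B). (K_single (k v) C * (\<Prod>v\<in>B. ?K v \<E>)) *\<^sub>R (?\<zeta> C * ?\<zeta> \<E>))"
      unfolding Z insert.IH[OF BV] using insert.hyps
      by (simp add: power_add sum_product mult_ac)
    also have "(\<Sum>C\<in>Pow (N v). \<Sum>\<E>\<in>Pow (F B). (K_single (k v) C * (\<Prod>v\<in>B. ?K v \<E>)) *\<^sub>R (?\<zeta> C * ?\<zeta> \<E>)) =
        (\<Sum>C\<in>Pow (N v). \<Sum>\<E>\<in>Pow (F B). (\<Prod>v\<in>insert v B. ?K v (C \<union> \<E>)) *\<^sub>R ?\<zeta> (C \<union> \<E>))"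
    proof (intro sum.cong refl)
      fix C \<E> assume C: "C \<in> Pow (N v)" and \<E>: "\<E> \<in> Pow (F B)"
      have "central (zeta \<Lambda> e)" if "e \<in> C \<union> \<E>" for e
        using that C \<E> unfolding edges_of_def by (auto intro: zeta_central_nilpotent)
      then have "?\<zeta> (C \<union> \<E>) = ?\<zeta> C * ?\<zeta> \<E>"
        using C \<E> disj finF edges_at_props(1)[OF vV]
        by (intro cprod_Un_central) (auto intro: finite_subset)
      moreover have "(C \<union> \<E>) \<inter> N v = C" using C \<E> disj by auto
      moreover have "(\<Prod>v\<in>B. ?K v (C \<union> \<E>)) = (\<Prod>v\<in>B. ?K v \<E>)"
      proof (intro prod.cong refl)
        fix u assume u: "u \<in> B"
        have "N u \<subseteq> F B" using u by (auto simp: edges_of_def)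
        then have "(C \<union> \<E>) \<inter> N u = \<E> \<inter> N u" using C disj by blast
        then show "?K u (C \<union> \<E>) = ?K u \<E>" by simp
      qed
      ultimately show "(K_single (k v) C * (\<Prod>v\<in>B. ?K v \<E>)) *\<^sub>R (?\<zeta> C * ?\<zeta> \<E>) =
          (\<Prod>v\<in>insert v B. ?K v (C \<union> \<E>)) *\<^sub>R ?\<zeta> (C \<union> \<E>)"
        using insert.hyps by simp
    qed
    also have "\<dots> = (\<Sum>\<E>\<in>Pow (N v \<union> F B). (\<Prod>v\<in>insert v B. ?K v \<E>) *\<^sub>R ?\<zeta> \<E>)"
      using disj finF edges_at_props(1)[OF vV] by (intro sum_Pow_Un[symmetric])
    also have "N v \<union> F B = F (insert v B)" by (simp add: edges_of_def)
    finally show ?case .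
  qed
qed

lemma fgff_fields:
  assumes "B \<subseteq> V"
  shows "fgff adj \<Lambda> (cprod Z B) = (-1) ^ (\<Sum>v\<in>B. k v) *
    (\<Sum>\<E>\<in>Pow (F B). (\<Prod>v\<in>B. K_single (k v) (\<E> \<inter> N v)) * det_on \<E> (transfer_current adj \<Lambda> V))"
proof -
  have "fgff adj \<Lambda> (cprod (zeta \<Lambda>) \<E>) = det_on \<E> (transfer_current adj \<Lambda> V)" if "\<E> \<in> Pow (F B)" for \<E>
  proof (rule fgff_cprod_zeta[OF graph fin sub V])
    show "finite \<E>" using that finite_edges_of[OF assms] finite_subset by auto
    show "\<E> \<subseteq> F V" using that assms by (auto simp: edges_of_def)
  qed
  then show ?thesis
    unfolding cprod_fields[OF assms]
    by (simp add: linear_scale[OF linear_fgff] linear_sum[OF linear_fgff])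
qed

text \<open>Multigraph edges also follow \<tau> backwards. That direction is covered because a
  finite set which \<tau> maps into itself is mapped onto itself.\<close>

lemma preserves_iff_closed:
  assumes \<E>: "\<E> \<subseteq> F V" and \<tau>: "\<tau> permutes \<E>" and B: "B \<subseteq> V"
  shows "(\<forall>f\<in>\<E> \<inter> F B. \<tau> f \<in> F B) \<longleftrightarrow>
    (\<forall>a\<in>B. \<forall>b. a \<in> V \<and> b \<in> V \<and> multigraph_edges adj \<E> \<tau> a b \<noteq> {} \<longrightarrow> b \<in> B)"
proof (intro iffI ballI allI impI)
  fix a b assume inv: "\<forall>f\<in>\<E> \<inter> F B. \<tau> f \<in> F B" and a: "a \<in> B"
    and ab: "a \<in> V \<and> b \<in> V \<and> multigraph_edges adj \<E> \<tau> a b \<noteq> {}"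
  then obtain f f' where f: "f \<in> \<E>" "f \<in> N a" "f' \<in> \<E>" "f' \<in> N b" "\<tau> f = f' \<or> \<tau> f' = f"
    by (auto simp: multigraph_edges_def split: if_splits)
  have "f \<in> F B" using f a by (auto simp: edges_of_def)
  have inj: "inj_on \<tau> A" for A using permutes_inj[OF \<tau>] inj_on_subset by blast
  have "\<tau> ` (\<E> \<inter> F B) = \<E> \<inter> F B"
  proof (rule card_subset_eq)
    show "finite (\<E> \<inter> F B)" using finite_edges_of[OF B] by simp
    show "\<tau> ` (\<E> \<inter> F B) \<subseteq> \<E> \<inter> F B" using inv permutes_in_image[OF \<tau>] by auto
  qed (use inj in \<open>simp add: card_image\<close>)
  then have "f' \<in> F B"
  proof (cases "\<tau> f = f'")
    case False
    then have "\<tau> f' = f" using f by simp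
    obtain g where "g \<in> \<E> \<inter> F B" "\<tau> g = f"
      using \<open>f \<in> F B\<close> f(1) \<open>\<tau> ` (\<E> \<inter> F B) = \<E> \<inter> F B\<close> by (metis IntI imageE)
    then show ?thesis using \<open>\<tau> f' = f\<close> permutes_inj[OF \<tau>] by (auto dest: injD)
  qed (use inv f(1) \<open>f \<in> F B\<close> in auto)
  then obtain c where "c \<in> B" "f' \<in> N c" by (auto simp: edges_of_def)
  then show "b \<in> B" using edges_at_props(2)[of b c f'] f(4) ab B by auto
next
  fix f assume cl: "\<forall>a\<in>B. \<forall>b. a \<in> V \<and> b \<in> V \<and> multigraph_edges adj \<E> \<tau> a b \<noteq> {} \<longrightarrow> b \<in> B"
    and f: "f \<in> \<E> \<inter> F B"
  then obtain a where a: "a \<in> B" "f \<in> N a" by (auto simp: edges_of_def)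
  have "\<tau> f \<in> \<E>" using f permutes_in_image[OF \<tau>] by auto
  then obtain b where b: "b \<in> V" "\<tau> f \<in> N b" using \<E> by (auto simp: edges_of_def)
  have "b \<in> B"
  proof (cases "a = b")
    case False
    then have "(f, \<tau> f) \<in> multigraph_edges adj \<E> \<tau> a b"
      using a b f \<open>\<tau> f \<in> \<E>\<close> by (simp add: multigraph_edges_def)
    then show ?thesis using cl a(1) b(1) B by blast
  qed (use a in simp)
  then show "\<tau> f \<in> F B" using b by (auto simp: edges_of_def)
qed

lemma sum_partitions_preserved:
  assumes \<E>: "\<E> \<subseteq> F V" and \<tau>: "\<tau> permutes \<E>" and ne: "V \<noteq> {}"
  shows "(\<Sum>\<pi> | partition_on V \<pi> \<and> (\<forall>B\<in>\<pi>. \<forall>f\<in>\<E> \<inter> F B. \<tau> f \<in> F B). moebius_weight (card \<pi>)) =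
    (if connected_perm adj V \<E> \<tau> then 1 else 0)"
proof -
  let ?R = "\<lambda>a b. a \<in> V \<and> b \<in> V \<and> multigraph_edges adj \<E> \<tau> a b \<noteq> {}"
  have "{\<pi>. partition_on V \<pi> \<and> (\<forall>B\<in>\<pi>. \<forall>f\<in>\<E> \<inter> F B. \<tau> f \<in> F B)} =
      {\<pi>. partition_on V \<pi> \<and> (\<forall>B\<in>\<pi>. \<forall>a\<in>B. \<forall>b. ?R a b \<longrightarrow> b \<in> B)}"
  proof (intro Collect_cong conj_cong refl ball_cong)
    fix \<pi> B assume "partition_on V \<pi>" "B \<in> \<pi>"
    then have "B \<subseteq> V" by (auto simp: partition_on_def)
    then show "(\<forall>f\<in>\<E> \<inter> F B. \<tau> f \<in> F B) \<longleftrightarrow> (\<forall>a\<in>B. \<forall>b. ?R a b \<longrightarrow> b \<in> B)"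
      by (rule preserves_iff_closed[OF \<E> \<tau>])
  qed
  moreover have "?R b a" if ab: "?R a b" for a b
  proof -
    obtain f f' where "(f, f') \<in> multigraph_edges adj \<E> \<tau> a b" using ab by auto
    then have "(f', f) \<in> multigraph_edges adj \<E> \<tau> b a"
      by (auto simp: multigraph_edges_def split: if_splits)
    then show ?thesis using ab by auto
  qed
  then have "(\<Sum>\<pi> | partition_on V \<pi> \<and> (\<forall>B\<in>\<pi>. \<forall>a\<in>B. \<forall>b. ?R a b \<longrightarrow> b \<in> B). moebius_weight (card \<pi>)) =
      (if \<forall>v\<in>V. \<forall>w\<in>V. ?R\<^sup>*\<^sup>* v w then 1 else 0)"
    by (intro sum_partitions_closed[OF V_props(2) ne]) auto
  moreover have "(\<forall>v\<in>V. \<forall>w\<in>V. ?R\<^sup>*\<^sup>* v w) \<longleftrightarrow> connected_perm adj V \<E> \<tau>"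
  proof -
    \<comment> \<open>With one vertex, reflexivity gives reachability, in accordance with the case
      \<open>card V = 1\<close> of \<open>connected_perm\<close>.\<close>
    have "?R\<^sup>*\<^sup>* v w" if "card V = 1" "v \<in> V" "w \<in> V" for v w
      using that by (auto simp: card_1_singleton_iff)
    then show ?thesis unfolding connected_perm_def by blast
  qed
  ultimately show ?thesis by simp
qed

text \<open>Here \<E> still ranges over all subsets of \<open>F V\<close>, which is the form that
  multiplying out the moments produces.\<close>

lemma cumulant_fields:
  assumes ne: "V \<noteq> {}"
  shows "cumulant (fgff adj \<Lambda>) Z V = (-1) ^ (\<Sum>v\<in>V. k v) *
    (\<Sum>\<E>\<in>Pow (F V). K_coeff V k \<E> *
       (\<Sum>\<tau>\<in>S_co adj V \<E>. of_int (sign \<tau>) * (\<Prod>f\<in>\<E>. transfer_current adj \<Lambda> V f (\<tau> f))))"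
proof -
  let ?M = "transfer_current adj \<Lambda> V" and ?c = "(-1) ^ (\<Sum>v\<in>V. k v) :: real"
  let ?P = "{\<pi>. partition_on V \<pi>}"
  let ?w = "\<lambda>\<E> \<tau>. of_int (sign \<tau>) * (\<Prod>f\<in>\<E>. ?M f (\<tau> f))"
  let ?pres = "\<lambda>\<E> \<tau> \<pi>. \<forall>B\<in>\<pi>. \<forall>f\<in>\<E> \<inter> F B. \<tau> f \<in> F B"
  have finP: "finite ?P" using finitely_many_partition_on V_props(2) by auto
  have finF: "finite (F V)" by (rule finite_edges_of) simp
  \<comment> \<open>The sets \<open>F B\<close> of different blocks are disjoint, so the product of
    the block sums is one sum over \<E>, and the product of block determinants becomes a sum over
    the permutations that keep every block.\<close>
  have moment: "(\<Prod>B\<in>\<pi>. fgff adj \<Lambda> (cprod Z B)) =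
      ?c * (\<Sum>\<E>\<in>Pow (F V). K_coeff V k \<E> * (\<Sum>\<tau> | \<tau> permutes \<E> \<and> ?pres \<E> \<tau> \<pi>. ?w \<E> \<tau>))"
    if \<pi>: "partition_on V \<pi>" for \<pi>
  proof -
    have U: "\<Union>\<pi> = V" and disj: "\<forall>A\<in>\<pi>. \<forall>B\<in>\<pi>. A \<noteq> B \<longrightarrow> A \<inter> B = {}"
      using \<pi> by (auto simp: partition_on_def disjoint_def)
    have fin\<pi>: "finite \<pi>" using finite_elements[OF V_props(2) \<pi>] .
    have BV: "B \<subseteq> V" if "B \<in> \<pi>" for B using U that by auto
    have finB: "\<forall>B\<in>\<pi>. finite B" using BV V_props(2) finite_subset by blast
    have FU: "(\<Union>B\<in>\<pi>. F B) = F V" using U by (auto simp: edges_of_def)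
    have dF: "disjoint_family_on F \<pi>"
      unfolding disjoint_family_on_def
    proof (intro ballI impI, rule ccontr)
      fix A B assume AB: "A \<in> \<pi>" "B \<in> \<pi>" "A \<noteq> B" "F A \<inter> F B \<noteq> {}"
      then obtain f a b where f: "a \<in> A" "b \<in> B" "f \<in> N a" "f \<in> N b" by (auto simp: edges_of_def)
      then have "a = b" using edges_at_props(2)[of a b f] BV AB by blast
      then show False using f disj AB by blast
    qed
    have "(\<Prod>B\<in>\<pi>. fgff adj \<Lambda> (cprod Z B)) =
        (\<Prod>B\<in>\<pi>. (-1) ^ (\<Sum>v\<in>B. k v)) *
        (\<Prod>B\<in>\<pi>. \<Sum>\<E>\<in>Pow (F B). (\<Prod>v\<in>B. K_single (k v) (\<E> \<inter> N v)) * det_on \<E> ?M)"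
      using fgff_fields BV by (simp flip: prod.distrib)
    also have "(\<Prod>B\<in>\<pi>. (-1) ^ (\<Sum>v\<in>B. k v)) = ?c"
      using sum.Union_disjoint[OF finB disj, of k] by (simp add: U o_def flip: power_sum)
    also have "(\<Prod>B\<in>\<pi>. \<Sum>\<E>\<in>Pow (F B). (\<Prod>v\<in>B. K_single (k v) (\<E> \<inter> N v)) * det_on \<E> ?M) =
        (\<Sum>\<E>\<in>Pow (F V). \<Prod>B\<in>\<pi>. (\<Prod>v\<in>B. K_single (k v) (\<E> \<inter> F B \<inter> N v)) * det_on (\<E> \<inter> F B) ?M)"
      using fin\<pi> dF finite_edges_of BV by (subst prod_sum_Pow) (auto simp: FU)
    also have "\<dots> = (\<Sum>\<E>\<in>Pow (F V). K_coeff V k \<E> * (\<Sum>\<tau> | \<tau> permutes \<E> \<and> ?pres \<E> \<tau> \<pi>. ?w \<E> \<tau>))"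
    proof (intro sum.cong refl)
      fix \<E> assume "\<E> \<in> Pow (F V)"
      then have \<E>: "\<E> \<subseteq> F V" by simp
      have "(\<Prod>B\<in>\<pi>. \<Prod>v\<in>B. K_single (k v) (\<E> \<inter> F B \<inter> N v)) =
          (\<Prod>B\<in>\<pi>. \<Prod>v\<in>B. K_single (k v) (edges_with_tail V \<E> v))"
      proof (intro prod.cong refl)
        fix B v assume "B \<in> \<pi>" "v \<in> B"
        then have "\<E> \<inter> F B \<inter> N v = \<E> \<inter> N v" "v \<in> V" using BV by (auto simp: edges_of_def)
        then show "K_single (k v) (\<E> \<inter> F B \<inter> N v) = K_single (k v) (edges_with_tail V \<E> v)"
          using edges_with_tail_eq[OF \<E>] by simp
      qed
      also have "\<dots> = K_coeff V k \<E>"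
        using prod.Union_disjoint[OF finB disj, of "\<lambda>v. K_single (k v) (edges_with_tail V \<E> v)"]
        by (simp add: U K_coeff_def)
      finally show "(\<Prod>B\<in>\<pi>. (\<Prod>v\<in>B. K_single (k v) (\<E> \<inter> F B \<inter> N v)) * det_on (\<E> \<inter> F B) ?M) =
          K_coeff V k \<E> * (\<Sum>\<tau> | \<tau> permutes \<E> \<and> ?pres \<E> \<tau> \<pi>. ?w \<E> \<tau>)"
        using prod_det_on[OF fin\<pi> finite_subset[OF \<E> finF], of F ?M] \<E> dF
        by (simp add: prod.distrib FU)
    qed
    finally show ?thesis .
  qed
  have "cumulant (fgff adj \<Lambda>) Z V = (\<Sum>\<pi>\<in>?P. moebius_weight (card \<pi>) * (?c *
      (\<Sum>\<E>\<in>Pow (F V). K_coeff V k \<E> * (\<Sum>\<tau> | \<tau> permutes \<E> \<and> ?pres \<E> \<tau> \<pi>. ?w \<E> \<tau>))))"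
    unfolding cumulant_def moebius_weight_def by (intro sum.cong refl) (simp only: moment mem_Collect_eq)
  also have "\<dots> = ?c * (\<Sum>\<E>\<in>Pow (F V). K_coeff V k \<E> *
      (\<Sum>\<pi>\<in>?P. moebius_weight (card \<pi>) * (\<Sum>\<tau> | \<tau> permutes \<E> \<and> ?pres \<E> \<tau> \<pi>. ?w \<E> \<tau>)))"
    unfolding sum_distrib_left
    by (subst sum.swap) (simp only: mult.left_commute[of "moebius_weight _"])
  also have "\<dots> = ?c * (\<Sum>\<E>\<in>Pow (F V). K_coeff V k \<E> * (\<Sum>\<tau>\<in>S_co adj V \<E>. ?w \<E> \<tau>))"
  proof (intro sum.cong refl arg_cong2[of _ _ _ _ "(*)"])
    fix \<E> assume "\<E> \<in> Pow (F V)"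
    then have \<E>: "\<E> \<subseteq> F V" by simp
    have finS: "finite {\<tau>. \<tau> permutes \<E>}" using finite_subset[OF \<E> finF] by (rule finite_permutations)
    have "(\<Sum>\<pi>\<in>?P. moebius_weight (card \<pi>) * (\<Sum>\<tau> | \<tau> permutes \<E> \<and> ?pres \<E> \<tau> \<pi>. ?w \<E> \<tau>)) =
        (\<Sum>\<pi>\<in>?P. \<Sum>\<tau> | \<tau> permutes \<E>. if ?pres \<E> \<tau> \<pi> then moebius_weight (card \<pi>) * ?w \<E> \<tau> else 0)"
      using finS by (intro sum.cong refl) (simp add: sum_distrib_left flip: sum.inter_filter)
    \<comment> \<open>After the exchange \<E> and \<tau> are fixed and only the weights of the
      partitions remain to be summed.\<close>
    also have "\<dots> = (\<Sum>\<tau> | \<tau> permutes \<E>. \<Sum>\<pi>\<in>?P. if ?pres \<E> \<tau> \<pi> then moebius_weight (card \<pi>) * ?w \<E> \<tau> else 0)"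
      by (rule sum.swap)
    also have "\<dots> = (\<Sum>\<tau> | \<tau> permutes \<E>. (\<Sum>\<pi> | partition_on V \<pi> \<and> ?pres \<E> \<tau> \<pi>. moebius_weight (card \<pi>)) * ?w \<E> \<tau>)"
      using finP by (intro sum.cong refl) (simp add: sum_distrib_right flip: sum.inter_filter)
    also have "\<dots> = (\<Sum>\<tau> | \<tau> permutes \<E>. if connected_perm adj V \<E> \<tau> then ?w \<E> \<tau> else 0)"
      by (intro sum.cong refl) (simp add: sum_partitions_preserved[OF \<E> _ ne])
    also have "\<dots> = (\<Sum>\<tau>\<in>S_co adj V \<E>. ?w \<E> \<tau>)"
      using finS by (simp add: S_co_def flip: sum.inter_filter)
    finally show "(\<Sum>\<pi>\<in>?P. moebius_weight (card \<pi>) * (\<Sum>\<tau> | \<tau> permutes \<E> \<and> ?pres \<E> \<tau> \<pi>. ?w \<E> \<tau>)) =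
        (\<Sum>\<tau>\<in>S_co adj V \<E>. ?w \<E> \<tau>)" .
  qed
  finally show ?thesis .
qed

end

theorem theorem4p1:
  fixes L :: "'v set" and adj :: "'v \<Rightarrow> 'v \<Rightarrow> bool" and \<Lambda> V :: "'v set" and k :: "'v \<Rightarrow> nat"
  assumes graph: "conn_lf_graph L adj"
    and Lambda: "finite \<Lambda>" "\<Lambda> \<noteq> {}" "\<Lambda> \<subset> L"
    and V: "good adj \<Lambda> V" "V \<subseteq> inner_vertices L adj \<Lambda>" "V \<noteq> {}"
    and k: "\<forall>v\<in>V. k v \<ge> 1"
  shows "cumulant (fgff adj \<Lambda>) (\<lambda>v. X_field adj \<Lambda> (k v) v * Y_field adj \<Lambda> v) V =
    (-1) ^ (\<Sum>v\<in>V. k v) *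
    (\<Sum>\<E> | \<E> \<subseteq> edges_of adj V \<and> (\<forall>v\<in>V. card (edges_with_tail V \<E> v) \<ge> k v).
       K_coeff V k \<E> *
       (\<Sum>\<tau>\<in>S_co adj V \<E>.
          of_int (sign \<tau>) * (\<Prod>f\<in>\<E>. transfer_current adj \<Lambda> V f (\<tau> f))))"
proof -
  let ?F = "{\<E>. \<E> \<subseteq> edges_of adj V \<and> (\<forall>v\<in>V. card (edges_with_tail V \<E> v) \<ge> k v)}"
  have finV: "finite V" by (rule V_props(2)[OF graph Lambda(1,3) V(1)])
  \<comment> \<open>If some vertex has fewer than \<open>k v\<close> edges of \<E>, its binomial
    coefficient is 0; this accounts for the restricted range of summation.\<close>
  have "K_coeff V k \<E> = 0" if "\<E> \<in> Pow (edges_of adj V) - ?F" for \<E>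
    using that finV by (auto simp: K_coeff_def K_single_def not_le)
  then show ?thesis
    unfolding cumulant_fields[OF graph Lambda(1,3) V(1,3)]
    using finite_edges_of[OF graph Lambda(1,3) V(1) order_refl]
    by (intro arg_cong2[of _ _ _ _ "(*)"] refl sum.mono_neutral_right) auto
qed

end
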